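(* Let $b_1, b_2: \mathbb{D}^2 \to \mathbb{D}$ be non-constant holomorphic functions, let $\alpha \in \mathbb{T}$, and let $\sigma^1 = \sigma_\alpha[b_1]$ and $\sigma^2 = \sigma_\alpha[b_2]$ be the corresponding Clark-Aleksandrov measures on $\mathbb{T}^2$. Let $k_{b_1}(\cdot, w)$ denote the reproducing kernel of $\mathcal{H}(b_1)$ at $w \in \mathbb{D}^2$. Let $\sigma^1 = \sigma^1_0 + \sigma^1_1 + \sigma^1_2$ be the decomposition of the pluriharmonic measure $\sigma^1$ described in the context. Suppose that there is a set $N \subset \mathbb{T}^2$ which is a null set for $A(\mathbb{D}^2)^\perp$ and which is a carrier of $\sigma^1_0$. Then the following conditions are equivalent: (i) $\sigma^1 \ll \sigma^2$ and $\frac{d\sigma^1}{d\sigma^2} \in L^2(\sigma^2)$; (ii) $\frac{\alpha - b_2}{\alpha - b_1}\, k_{b_1}(\cdot, w) \in \mathcal{H}(b_2)$ for all $w \in \mathbb{D}^2$; (iii) $\frac{\alpha - b_2}{\alpha - b_1}\, k_{b_1}(\cdot, w) \in \mathcal{H}(b_2)$ for some $w \in \mathbb{D}^2$.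
   Context: $\mathbb{D}$ is the open unit disc in $\mathbb{C}$ and $\mathbb{T}$ the unit circle. Clark-Aleksandrov measures: for a non-constant holomorphic $b:\mathbb{D}^2\to\mathbb{D}$ and $\alpha\in\mathbb{T}$, $\sigma_\alpha[b]$ is the unique positive Borel measure on $\mathbb{T}^2$ such that $$\int_{\mathbb{T}^2} \prod_{j=1}^2 \frac{1-|z_j|^2}{|\zeta_j - z_j|^2}\, d\sigma_\alpha[b](\zeta) = \frac{1-|b(z)|^2}{|\alpha - b(z)|^2}, \quad z\in\mathbb{D}^2.$$ De Branges-Rovnyak spaces: let $C(z,w) = \prod_{j=1}^2 \frac{1}{1 - z_j\overline{w_j}}$ be the Cauchy kernel. $\mathcal{H}(b)$ is the reproducing kernel Hilbert space of functions on $\mathbb{D}^2$ with reproducing kernel $k_b(z,w) = (1 - b(z)\overline{b(w)})\,C(z,w)$, $z,w\in\mathbb{D}^2$. The bidisc algebra $A(\mathbb{D}^2)$ is the set of continuous functions on $\overline{\mathbb{D}^2}$ that are holomorphic in $\mathbb{D}^2$; $A(\mathbb{D}^2)^\perp$ is the set of complex Borel measures $\mu$ on $\mathbb{T}^2$ with $\int f\,d\mu = 0$ for all $f\in A(\mathbb{D}^2)$. A Borel set $S\subset\mathbb{T}^2$ is a null set for $A(\mathbb{D}^2)^\perp$ if $|\mu|(S)=0$ for all $\mu\in A(\mathbb{D}^2)^\perp$. A Borel set $S$ is a carrier of $\mu$ (carries $\mu$) if $\mu(A)=\mu(A\cap S)$ for all Borel $A\subset\mathbb{T}^2$. Pluriharmonic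 measures: $\mathrm{RP}(\mathbb{T}^2)$ is the class of measures on $\mathbb{T}^2$ whose Poisson integral is the real part of a holomorphic function on $\mathbb{D}^2$; equivalently, real measures $\mu$ with $\int z_1^{k_1}z_2^{k_2}\,d\mu = 0$ for $k_1,k_2\in\mathbb{Z}$ unless $k_1,k_2\ge 0$ or $k_1,k_2\le 0$. Every Clark-Aleksandrov measure belongs to $\mathrm{RP}(\mathbb{T}^2)$. Decomposition: every $\mu\in \mathrm{RP}(\mathbb{T}^2)$ can be decomposed as $\mu=\mu_0+\mu_1+\mu_2$, where $\mu_0,\mu_1,\mu_2$ are mutually singular measures in $\mathrm{RP}(\mathbb{T}^2)$ such that: $\mu_0 = \overline{z_1}z_2\,T_*(\nu_0)$ for some $\nu_0\in A(\mathbb{D}^2)^\perp$ that is absolutely continuous with respect to some representing measure for $(0,0)$ (a Borel probability measure $\rho$ on $\mathbb{T}^2$ with $\int f\,d\rho = f(0,0)$ for all $f\in A(\mathbb{D}^2)$), where $T(z_1,z_2)=(z_1,\overline{z_2})$ and $T_*$ denotes pushforward, $T_*(\nu)(S)=\nu(T^{-1}(S))$; $\mu_1=\tau_1\times m$, where $\tau_1$ is a real measure on $\mathbb{T}$ carried by a set of Lebesgue measure zero; and $\mu_2 = m\times\tau_2$, where $\tau_2$ is a real measure on $\mathbb{T}$ carried by a set of Lebesgue measure zero. Here $m$ is normalized Lebesgue measure on $\mathbb{T}$. *)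

theory Defs
  imports "HOL-Probability.Probability"
begin

section \<open>Bidisc, torus and holomorphic functions of two variables\<close>

definition bidisc :: "(complex \<times> complex) set" where
  "bidisc = ball 0 1 \<times> ball 0 1"

definition closed_bidisc :: "(complex \<times> complex) set" where
  "closed_bidisc = cball 0 1 \<times> cball 0 1"

definition torus :: "(complex \<times> complex) set" where
  "torus = sphere 0 1 \<times> sphere 0 1"

abbreviation torus_borel :: "(complex \<times> complex) measure" where
  "torus_borel \<equiv> restrict_space borel torus"

abbreviation circle_borel :: "complex measure" where
  "circle_borel \<equiv> restrict_space borel (sphere 0 1)"

definition circle_lebesgue :: "complex measure" where
  "circle_lebesgue = distr (uniform_measure lborel {0..1}) circle_borel (\<lambda>t. cis (2 * pi * t))"

text \<open>Holomorphy means complex Frechet differentiability: the real derivative is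
  complex linear.\<close>

definition holomorphic2_on :: "(complex \<times> complex \<Rightarrow> complex) \<Rightarrow> (complex \<times> complex) set \<Rightarrow> bool" where
  "holomorphic2_on f S \<longleftrightarrow>
     (\<forall>z\<in>S. \<exists>a b. (f has_derivative (\<lambda>h. a * fst h + b * snd h)) (at z within S))"

definition bidisc_algebra :: "(complex \<times> complex \<Rightarrow> complex) set" where
  "bidisc_algebra = {f. continuous_on closed_bidisc f \<and> holomorphic2_on f bidisc}"


section \<open>Complex measures\<close>

text \<open>A complex measure on the measurable space \<open>M\<close> is a countably additive set function.
  Only its values on \<open>sets M\<close> are meaningful; the measure carried by \<open>M\<close> itself is ignored.\<close>

definition complex_measure :: "'a measure \<Rightarrow> ('a set \<Rightarrow> complex) \<Rightarrow> bool" where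
  "complex_measure M \<mu> \<longleftrightarrow>
     \<mu> {} = 0 \<and>
     (\<forall>A::nat \<Rightarrow> 'a set. range A \<subseteq> sets M \<longrightarrow> disjoint_family A \<longrightarrow> (\<lambda>i. \<mu> (A i)) sums \<mu> (\<Union>i. A i))"

definition real_measure :: "'a measure \<Rightarrow> ('a set \<Rightarrow> complex) \<Rightarrow> bool" where
  "real_measure M \<mu> \<longleftrightarrow> complex_measure M \<mu> \<and> (\<forall>A\<in>sets M. \<mu> A \<in> \<real>)"

definition complex_measure_of :: "'a measure \<Rightarrow> 'a set \<Rightarrow> complex" where
  "complex_measure_of M A = of_real (measure M A)"

definition total_variation :: "'a measure \<Rightarrow> ('a set \<Rightarrow> complex) \<Rightarrow> 'a set \<Rightarrow> ennreal" where
  "total_variation M \<mu> S =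
     (SUP E \<in> {E::nat \<Rightarrow> 'a set. range E \<subseteq> sets M \<and> disjoint_family E \<and> (\<Union>i. E i) = S}.
        \<Sum>i. ennreal (norm (\<mu> (E i))))"

text \<open>The positive part in the Jordan decomposition of a finite signed measure.\<close>

definition positive_variation :: "'a measure \<Rightarrow> ('a set \<Rightarrow> real) \<Rightarrow> 'a measure" where
  "positive_variation M \<phi> =
     measure_of (space M) (sets M) (\<lambda>E. SUP F \<in> {F \<in> sets M. F \<subseteq> E}. ennreal (\<phi> F))"

definition cm_integral :: "'a measure \<Rightarrow> ('a set \<Rightarrow> complex) \<Rightarrow> ('a \<Rightarrow> complex) \<Rightarrow> complex" where
  "cm_integral M \<mu> f =
     (integral\<^sup>L (positive_variation M (\<lambda>A. Re (\<mu> A))) f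
        - integral\<^sup>L (positive_variation M (\<lambda>A. - Re (\<mu> A))) f)
     + \<i> * (integral\<^sup>L (positive_variation M (\<lambda>A. Im (\<mu> A))) f
        - integral\<^sup>L (positive_variation M (\<lambda>A. - Im (\<mu> A))) f)"

definition carrier_of :: "'a measure \<Rightarrow> ('a set \<Rightarrow> complex) \<Rightarrow> 'a set \<Rightarrow> bool" where
  "carrier_of M \<mu> S \<longleftrightarrow> S \<in> sets M \<and> (\<forall>A\<in>sets M. \<mu> A = \<mu> (A \<inter> S))"

definition mutually_singular :: "'a measure \<Rightarrow> ('a set \<Rightarrow> complex) \<Rightarrow> ('a set \<Rightarrow> complex) \<Rightarrow> bool" where
  "mutually_singular M \<mu> \<nu> \<longleftrightarrow>
     (\<exists>A B. A \<inter> B = {} \<and> carrier_of M \<mu> A \<and> carrier_of M \<nu> B)"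

definition push_forward :: "'a measure \<Rightarrow> ('a \<Rightarrow> 'b) \<Rightarrow> ('a set \<Rightarrow> complex) \<Rightarrow> 'b set \<Rightarrow> complex" where
  "push_forward M g \<mu> S = \<mu> (g -` S \<inter> space M)"

definition cm_density :: "'a measure \<Rightarrow> ('a \<Rightarrow> complex) \<Rightarrow> ('a set \<Rightarrow> complex) \<Rightarrow> 'a set \<Rightarrow> complex" where
  "cm_density M h \<mu> A = cm_integral M \<mu> (\<lambda>x. indicator A x * h x)"

definition annihilator :: "(complex \<times> complex \<Rightarrow> complex) set \<Rightarrow> ((complex \<times> complex) set \<Rightarrow> complex) set" where
  "annihilator F = {\<mu>. complex_measure torus_borel \<mu> \<and> (\<forall>f\<in>F. cm_integral torus_borel \<mu> f = 0)}"

definition null_set_for :: "((complex \<times> complex) set \<Rightarrow> complex) set \<Rightarrow> (complex \<times> complex) set \<Rightarrow> bool" where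
  "null_set_for \<M> S \<longleftrightarrow>
     S \<in> sets torus_borel \<and> (\<forall>\<mu>\<in>\<M>. total_variation torus_borel \<mu> S = 0)"

definition representing_measure_0 :: "(complex \<times> complex) measure \<Rightarrow> bool" where
  "representing_measure_0 \<rho> \<longleftrightarrow>
     prob_space \<rho> \<and> sets \<rho> = sets torus_borel \<and>
     (\<forall>f\<in>bidisc_algebra. integral\<^sup>L \<rho> f = f (0, 0))"


section \<open>Pluriharmonic measures and their decomposition\<close>

definition poisson2 :: "complex \<times> complex \<Rightarrow> complex \<times> complex \<Rightarrow> real" where
  "poisson2 z \<zeta> =
     (1 - (cmod (fst z))\<^sup>2) / (cmod (fst \<zeta> - fst z))\<^sup>2 *
     ((1 - (cmod (snd z))\<^sup>2) / (cmod (snd \<zeta> - snd z))\<^sup>2)"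

definition RP :: "((complex \<times> complex) set \<Rightarrow> complex) set" where
  "RP = {\<mu>. real_measure torus_borel \<mu> \<and>
     (\<exists>F. holomorphic2_on F bidisc \<and>
        (\<forall>z\<in>bidisc. cm_integral torus_borel \<mu> (\<lambda>\<zeta>. of_real (poisson2 z \<zeta>)) = of_real (Re (F z))))}"

text \<open>The components \<open>\<mu>1\<close> and \<open>\<mu>2\<close> are the products of \<open>\<tau>1\<close>, \<open>\<tau>2\<close> with normalized Lebesgue
  measure; a complex measure on the torus is determined by its values on Borel rectangles.\<close>

definition RP_decomposition ::
  "((complex \<times> complex) set \<Rightarrow> complex) \<Rightarrow> ((complex \<times> complex) set \<Rightarrow> complex) \<Rightarrow>
   ((complex \<times> complex) set \<Rightarrow> complex) \<Rightarrow> ((complex \<times> complex) set \<Rightarrow> complex) \<Rightarrow> bool" where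
  "RP_decomposition \<mu> \<mu>0 \<mu>1 \<mu>2 \<longleftrightarrow>
     \<mu>0 \<in> RP \<and> \<mu>1 \<in> RP \<and> \<mu>2 \<in> RP \<and>
     (\<forall>A\<in>sets torus_borel. \<mu> A = \<mu>0 A + \<mu>1 A + \<mu>2 A) \<and>
     mutually_singular torus_borel \<mu>0 \<mu>1 \<and>
     mutually_singular torus_borel \<mu>0 \<mu>2 \<and>
     mutually_singular torus_borel \<mu>1 \<mu>2 \<and>
     (\<exists>\<nu>0 \<rho>. \<nu>0 \<in> annihilator bidisc_algebra \<and> representing_measure_0 \<rho> \<and>
        (\<forall>A\<in>sets torus_borel. emeasure \<rho> A = 0 \<longrightarrow> \<nu>0 A = 0) \<and>
        (\<forall>A\<in>sets torus_borel. \<mu>0 A =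
           cm_density torus_borel (\<lambda>\<zeta>. cnj (fst \<zeta>) * snd \<zeta>)
             (push_forward torus_borel (\<lambda>\<zeta>. (fst \<zeta>, cnj (snd \<zeta>))) \<nu>0) A)) \<and>
     (\<exists>\<tau>1 Z. real_measure circle_borel \<tau>1 \<and>
        carrier_of circle_borel \<tau>1 Z \<and> emeasure circle_lebesgue Z = 0 \<and>
        (\<forall>A\<in>sets circle_borel. \<forall>B\<in>sets circle_borel.
           \<mu>1 (A \<times> B) = \<tau>1 A * of_real (measure circle_lebesgue B))) \<and>
     (\<exists>\<tau>2 Z. real_measure circle_borel \<tau>2 \<and>
        carrier_of circle_borel \<tau>2 Z \<and> emeasure circle_lebesgue Z = 0 \<and>
        (\<forall>A\<in>sets circle_borel. \<forall>B\<in>sets circle_borel.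
           \<mu>2 (A \<times> B) = of_real (measure circle_lebesgue A) * \<tau>2 B))"


section \<open>Clark-Aleksandrov measures\<close>

text \<open>The Clark-Aleksandrov measure of \<open>b\<close> at \<open>\<alpha>\<close> is the unique \<open>\<sigma>\<close> with this property.\<close>

definition clark_measure ::
  "(complex \<times> complex \<Rightarrow> complex) \<Rightarrow> complex \<Rightarrow> (complex \<times> complex) measure \<Rightarrow> bool" where
  "clark_measure b \<alpha> \<sigma> \<longleftrightarrow>
     finite_measure \<sigma> \<and> sets \<sigma> = sets torus_borel \<and>
     (\<forall>z\<in>bidisc. (\<integral>\<zeta>. poisson2 z \<zeta> \<partial>\<sigma>) = (1 - (cmod (b z))\<^sup>2) / (cmod (\<alpha> - b z))\<^sup>2)"


section \<open>Reproducing kernel Hilbert spaces\<close>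

text \<open>Functions on \<open>X\<close> are represented by total functions that vanish outside \<open>X\<close>.\<close>

definition zero_extend :: "'a set \<Rightarrow> ('a \<Rightarrow> complex) \<Rightarrow> 'a \<Rightarrow> complex" where
  "zero_extend X f z = (if z \<in> X then f z else 0)"

text \<open>\<open>H\<close> with inner product \<open>ip\<close> (linear in the first argument) is the Hilbert space of functions
  on \<open>X\<close> with reproducing kernel \<open>K\<close>. By the Moore-Aronszajn theorem, \<open>H\<close> and the restriction
  of \<open>ip\<close> to \<open>H\<close> are determined by \<open>X\<close> and \<open>K\<close>.\<close>

locale rkhs =
  fixes X :: "'a set"
    and K :: "'a \<Rightarrow> 'a \<Rightarrow> complex"
    and H :: "('a \<Rightarrow> complex) set"
    and ip :: "('a \<Rightarrow> complex) \<Rightarrow> ('a \<Rightarrow> complex) \<Rightarrow> complex"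
  assumes vanish_outside: "\<lbrakk>f \<in> H; z \<notin> X\<rbrakk> \<Longrightarrow> f z = 0"
    and zero_mem: "(\<lambda>z. 0) \<in> H"
    and add_mem: "\<lbrakk>f \<in> H; g \<in> H\<rbrakk> \<Longrightarrow> (\<lambda>z. f z + g z) \<in> H"
    and scale_mem: "f \<in> H \<Longrightarrow> (\<lambda>z. c * f z) \<in> H"
    and ip_add: "\<lbrakk>f \<in> H; g \<in> H; h \<in> H\<rbrakk> \<Longrightarrow> ip (\<lambda>z. f z + g z) h = ip f h + ip g h"
    and ip_scale: "\<lbrakk>f \<in> H; g \<in> H\<rbrakk> \<Longrightarrow> ip (\<lambda>z. c * f z) g = c * ip f g"
    and ip_cnj: "\<lbrakk>f \<in> H; g \<in> H\<rbrakk> \<Longrightarrow> ip g f = cnj (ip f g)"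
    and ip_nonneg: "f \<in> H \<Longrightarrow> 0 \<le> Re (ip f f)"
    and ip_definite: "\<lbrakk>f \<in> H; ip f f = 0\<rbrakk> \<Longrightarrow> f = (\<lambda>z. 0)"
    and complete: "\<lbrakk>range F \<subseteq> H;
        \<forall>e>0. \<exists>N. \<forall>m\<ge>N. \<forall>n\<ge>N.
          sqrt (Re (ip (\<lambda>z. F m z - F n z) (\<lambda>z. F m z - F n z))) < e\<rbrakk>
      \<Longrightarrow> \<exists>f\<in>H. (\<lambda>n::nat. sqrt (Re (ip (\<lambda>z. F n z - f z) (\<lambda>z. F n z - f z)))) \<longlonglongrightarrow> 0"
    and kernel_mem: "w \<in> X \<Longrightarrow> zero_extend X (\<lambda>z. K z w) \<in> H"
    and reproducing: "\<lbrakk>f \<in> H; w \<in> X\<rbrakk> \<Longrightarrow> ip f (zero_extend X (\<lambda>z. K z w)) = f w"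

definition cauchy2 :: "complex \<times> complex \<Rightarrow> complex \<times> complex \<Rightarrow> complex" where
  "cauchy2 z w = 1 / (1 - fst z * cnj (fst w)) * (1 / (1 - snd z * cnj (snd w)))"

definition dbr_kernel ::
  "(complex \<times> complex \<Rightarrow> complex) \<Rightarrow> complex \<times> complex \<Rightarrow> complex \<times> complex \<Rightarrow> complex" where
  "dbr_kernel b z w = (1 - b z * cnj (b w)) * cauchy2 z w"

text \<open>\<open>(H, ip)\<close> is the de Branges-Rovnyak space of \<open>b\<close>.\<close>

definition de_branges_rovnyak ::
  "(complex \<times> complex \<Rightarrow> complex) \<Rightarrow> (complex \<times> complex \<Rightarrow> complex) set \<Rightarrow>
   ((complex \<times> complex \<Rightarrow> complex) \<Rightarrow> (complex \<times> complex \<Rightarrow> complex) \<Rightarrow> complex) \<Rightarrow> bool" where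
  "de_branges_rovnyak b H ip \<longleftrightarrow> rkhs bidisc (dbr_kernel b) H ip"

end

theory Submission
  imports Defs "HOL-Complex_Analysis.Complex_Analysis"
begin

text \<open>
  Polarizing the defining identity of \<open>\<sigma> = \<sigma>\<^sub>\<alpha>[b]\<close>, one coordinate at a time, gives
  \<open>\<integral> C(z, \<zeta>) C(\<zeta>, w) d\<sigma>(\<zeta>) = k\<^sub>b(z, w) / ((1 - cnj \<alpha> b(z)) (1 - \<alpha> cnj (b(w))))\<close>, so that
  \<open>H(b)\<close> consists of the functions \<open>(1 - cnj \<alpha> b(z)) \<integral> f(\<zeta>) C(z, \<zeta>) d\<sigma>(\<zeta>)\<close> with
  \<open>f \<in> L\<^sup>2(\<sigma>)\<close>. The function in (ii) is a multiple of
  \<open>(1 - cnj \<alpha> b\<^sub>2(z)) \<integral> C(\<zeta>, w) C(z, \<zeta>) d\<sigma>\<^sup>1(\<zeta>)\<close>, which is of this form for \<open>b\<^sub>2\<close> if (i) holds.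
  Conversely, (iii) yields \<open>f \<in> L\<^sup>2(\<sigma>\<^sup>2)\<close> such that \<open>\<nu> = cnj f \<sigma>\<^sup>2 - cnj (C(\<cdot>, w)) \<sigma>\<^sup>1\<close> annihilates
  the bidisc algebra. On \<open>N\<close> this measure vanishes, which bounds \<open>\<sigma>\<^sup>1\<close> there. Over a Lebesgue null set
  \<open>Z\<close> of the first coordinate, the F. and M. Riesz theorem shows that both Clark measures are products with
  Lebesgue measure and that the first marginal of \<open>\<nu>\<close> vanishes; averaging over the second coordinate
  bounds \<open>\<sigma>\<^sup>1\<close> on \<open>Z \<times> T\<close>. By the decomposition, \<open>\<sigma>\<^sup>1\<close> is carried by \<open>N\<close>, a set \<open>Z\<^sub>1 \<times> T\<close> and a
  set \<open>T \<times> Z\<^sub>2\<close> of these types.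
\<close>

section \<open>Approximation in pre-Hilbert spaces\<close>

text \<open>On the torus a measure that annihilates the bidisc algebra can be singular, so the
  one-variable argument is available only for marginals. Hence the split of the carrier: on
  \<open>N\<close> the vanishing of \<nu> is an assumption, and on the two cylinders a marginal is
  used. Over a null set Z the marginal tests only functions of one coordinate; a general test
  function has to be replaced by its mean over the other coordinate. This is harmless precisely
  because both Clark measures are products over Z. That structure comes from pluriharmonicity: once
  the second coordinate is conjugated, the density \<zeta>1 cnj \<zeta>2 turns a Clark measure into
  an annihilating one, and the one-variable theorem applies to each Fourier slice. The pieces are
  joined by estimates \<integral> \<phi> d\<sigma>1 \<le> K ||\<phi>|| with the norm of
  L^2(\<sigma>2): such bounds add up over overlapping sets and are converted into a density only
  once, at the end.\<close>

locale semi_inner_product =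
  fixes L :: "('a \<Rightarrow> complex) set"
    and ip :: "('a \<Rightarrow> complex) \<Rightarrow> ('a \<Rightarrow> complex) \<Rightarrow> complex"
  assumes zero_mem: "(\<lambda>z. 0) \<in> L"
    and add_mem: "\<lbrakk>f \<in> L; g \<in> L\<rbrakk> \<Longrightarrow> (\<lambda>z. f z + g z) \<in> L"
    and scale_mem: "f \<in> L \<Longrightarrow> (\<lambda>z. c * f z) \<in> L"
    and ip_add: "\<lbrakk>f \<in> L; g \<in> L; h \<in> L\<rbrakk> \<Longrightarrow> ip (\<lambda>z. f z + g z) h = ip f h + ip g h"
    and ip_scale: "\<lbrakk>f \<in> L; g \<in> L\<rbrakk> \<Longrightarrow> ip (\<lambda>z. c * f z) g = c * ip f g"
    and ip_cnj: "\<lbrakk>f \<in> L; g \<in> L\<rbrakk> \<Longrightarrow> ip g f = cnj (ip f g)"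
    and ip_nonneg: "f \<in> L \<Longrightarrow> 0 \<le> Re (ip f f)"
begin

lemma diff_mem:
  assumes "f \<in> L" "g \<in> L"
  shows "(\<lambda>z. f z - g z) \<in> L"
  using add_mem[OF assms(1) scale_mem[OF assms(2), of "-1"]] by simp

lemma ip_diff:
  assumes "f \<in> L" "g \<in> L" "h \<in> L"
  shows "ip (\<lambda>z. f z - g z) h = ip f h - ip g h"
  using ip_add[OF assms(1) scale_mem[OF assms(2), of "-1"] assms(3)] ip_scale[OF assms(2,3), of "-1"]
  by simp

lemma ip_add_right:
  assumes "f \<in> L" "g \<in> L" "h \<in> L"
  shows "ip h (\<lambda>z. f z + g z) = ip h f + ip h g"
proof -
  have "ip h (\<lambda>z. f z + g z) = cnj (ip (\<lambda>z. f z + g z) h)"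
    by (intro ip_cnj add_mem assms)
  then show ?thesis
    using assms by (simp add: ip_add ip_cnj[of _ h])
qed

lemma ip_scale_right:
  assumes "f \<in> L" "h \<in> L"
  shows "ip h (\<lambda>z. c * f z) = cnj c * ip h f"
proof -
  have "ip h (\<lambda>z. c * f z) = cnj (ip (\<lambda>z. c * f z) h)"
    by (intro ip_cnj scale_mem assms)
  then show ?thesis
    using assms by (simp add: ip_scale ip_cnj[of _ h])
qed

lemma ip_diff_right:
  assumes "f \<in> L" "g \<in> L" "h \<in> L"
  shows "ip h (\<lambda>z. f z - g z) = ip h f - ip h g"
  using ip_add_right[OF assms(1) scale_mem[OF assms(2), of "-1"] assms(3)]
    ip_scale_right[OF assms(2,3), of "-1"] by simp

lemma ip_expand:
  assumes f: "f \<in> L" and g: "g \<in> L"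
  shows "Re (ip (\<lambda>z. f z - c * g z) (\<lambda>z. f z - c * g z)) =
    Re (ip f f) - 2 * Re (cnj c * ip f g) + (cmod c)\<^sup>2 * Re (ip g g)"
proof -
  have cg: "(\<lambda>z. c * g z) \<in> L" using g by (rule scale_mem)
  have "ip (\<lambda>z. f z - c * g z) (\<lambda>z. f z - c * g z) =
      ip f f - cnj c * ip f g - c * cnj (ip f g) + c * cnj c * ip g g"
    using ip_diff[OF f cg diff_mem[OF f cg]] ip_diff_right[OF f cg f] ip_diff_right[OF f cg cg]
    by (simp add: ip_scale ip_scale_right f g cg ip_cnj[of f g] algebra_simps)
  also have "\<dots> = ip f f - (cnj c * ip f g + cnj (cnj c * ip f g)) + of_real ((cmod c)\<^sup>2) * ip g g"
    by (simp add: complex_norm_square[symmetric] algebra_simps)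
  finally have eq: "ip (\<lambda>z. f z - c * g z) (\<lambda>z. f z - c * g z) = \<dots>" .
  show ?thesis unfolding eq by simp
qed

text \<open>Only semi-definiteness is available, so a vector \<open>g\<close> with
  \<open>ip g g = 0\<close> needs a separate argument. Test vectors f - s (ip f g) g with real s
  make the cross term real.\<close>

lemma cauchy_schwarz:
  assumes f: "f \<in> L" and g: "g \<in> L"
  shows "(cmod (ip f g))\<^sup>2 \<le> Re (ip f f) * Re (ip g g)"
proof -
  define x where "x = ip f g"
  have *: "0 \<le> Re (ip f f) - 2 * s * (cmod x)\<^sup>2 + s\<^sup>2 * (cmod x)\<^sup>2 * Re (ip g g)" for s :: real
  proof -
    have "0 \<le> Re (ip (\<lambda>z. f z - (s * x) * g z) (\<lambda>z. f z - (s * x) * g z))"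
      by (intro ip_nonneg diff_mem scale_mem f g)
    also have "\<dots> = Re (ip f f) - 2 * Re (cnj (s * x) * x) + (cmod (s * x))\<^sup>2 * Re (ip g g)"
      unfolding ip_expand[OF f g] x_def by simp
    also have "cnj (s * x) * x = of_real (s * (cmod x)\<^sup>2)"
      using complex_norm_square[of x] by (simp add: mult_ac)
    finally show ?thesis by (simp add: norm_mult power_mult_distrib algebra_simps)
  qed
  show ?thesis
  proof (cases "Re (ip g g) = 0")
    case True
    have "2 * s * (cmod x)\<^sup>2 \<le> Re (ip f f)" for s
      using *[of s] True by simp
    \<comment> \<open>A linear function of s that is bounded above has slope zero. This s would give
      2 (Re (ip f f) + 1) \<le> Re (ip f f).\<close>
    from this[of "(Re (ip f f) + 1) / (cmod x)\<^sup>2"] have "cmod x = 0"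
      using ip_nonneg[OF f] by (cases "cmod x = 0") simp_all
    then show ?thesis using True x_def by simp
  next
    case False
    then have G: "Re (ip g g) > 0" using ip_nonneg[OF g] by simp
    have "(1 / Re (ip g g))\<^sup>2 * (cmod x)\<^sup>2 * Re (ip g g) = 1 / Re (ip g g) * (cmod x)\<^sup>2"
      using G by (simp add: power2_eq_square)
    \<comment> \<open>This s minimizes the quadratic in s.\<close>
    with *[of "1 / Re (ip g g)"] have "1 / Re (ip g g) * (cmod x)\<^sup>2 \<le> Re (ip f f)" by linarith
    then have "(cmod x)\<^sup>2 \<le> Re (ip f f) * Re (ip g g)"
      using G by (simp add: pos_divide_le_eq)
    then show ?thesis by (simp add: x_def)
  qed
qed

text \<open>A substitute for the orthogonal projection onto a subspace P that need not be closed, in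
  a space that need not be complete. Points whose squared distance to \<phi> is within 1/(n+1) of
  the infimum form a Cauchy sequence by the parallelogram law, and a first variation shows that the
  residuals become orthogonal to P. The explicit Cauchy rate can be carried over by an isometry and
  is the one that \<open>L2_complete\<close> expects.\<close>

lemma minimizing_sequence:
  assumes P: "P \<subseteq> L" "(\<lambda>z. 0) \<in> P" "\<And>f g. f \<in> P \<Longrightarrow> g \<in> P \<Longrightarrow> (\<lambda>z. f z + g z) \<in> P"
    "\<And>c f. f \<in> P \<Longrightarrow> (\<lambda>z. c * f z) \<in> P"
    and \<phi>: "\<phi> \<in> L"
  obtains p :: "nat \<Rightarrow> 'a \<Rightarrow> complex" where "\<And>n. p n \<in> P"
    "\<And>m n. Re (ip (\<lambda>z. p m z - p n z) (\<lambda>z. p m z - p n z)) \<le> 2 / Suc m + 2 / Suc n"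
    "\<And>q. q \<in> P \<Longrightarrow> (\<lambda>n. ip (\<lambda>z. \<phi> z - p n z) q) \<longlonglongrightarrow> 0"
proof -
  define D where "D p = Re (ip (\<lambda>z. \<phi> z - p z) (\<lambda>z. \<phi> z - p z))" for p
  define d where "d = Inf (D ` P)"
  have D0: "0 \<le> D p" if "p \<in> P" for p
    unfolding D_def using that P \<phi> by (intro ip_nonneg diff_mem) auto
  have bdd: "bdd_below (D ` P)" using D0 by (intro bdd_belowI[of _ 0]) auto
  have dle: "d \<le> D p" if "p \<in> P" for p
    unfolding d_def using that bdd by (intro cInf_lower) auto
  have "\<exists>p\<in>P. D p < d + 1 / Suc n" for n
  proof -
    have "Inf (D ` P) < d + 1 / Suc n" unfolding d_def by simp
    then show ?thesis using cInf_lessD[of "D ` P" "d + 1 / Suc n"] P(2) by auto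
  qed
  then obtain p where p: "\<And>n. p n \<in> P" "\<And>n. D (p n) < d + 1 / Suc n" by metis
  have pL: "p n \<in> L" for n using p P by auto
  have cau: "Re (ip (\<lambda>z. p m z - p n z) (\<lambda>z. p m z - p n z)) \<le> 2 / Suc m + 2 / Suc n" for m n
  proof -
    define a where "a = (\<lambda>z. \<phi> z - p m z)"
    define b where "b = (\<lambda>z. \<phi> z - p n z)"
    have ab: "a \<in> L" "b \<in> L" unfolding a_def b_def by (intro diff_mem \<phi> pL)+
    have 1: "(\<lambda>z. p m z - p n z) = (\<lambda>z. b z - 1 * a z)" unfolding a_def b_def by auto
    \<comment> \<open>The midpoint lies in P, so its squared distance is at least d; this is the
      lower bound that enters the parallelogram identity.\<close>
    have mid: "(\<lambda>z. (1/2) * (p m z + p n z)) \<in> P" by (intro P p)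
    have 2: "Re (ip (\<lambda>z. b z - (-1) * a z) (\<lambda>z. b z - (-1) * a z)) = 4 * D (\<lambda>z. (1/2) * (p m z + p n z))"
    proof -
      define u where "u = (\<lambda>z. \<phi> z - (1/2) * (p m z + p n z))"
      have u: "u \<in> L" unfolding u_def using mid P by (intro diff_mem \<phi>) auto
      have "(\<lambda>z. b z - (-1) * a z) = (\<lambda>z. 2 * u z)"
        unfolding a_def b_def u_def by (auto simp: algebra_simps)
      then show ?thesis unfolding D_def u_def[symmetric]
        by (simp add: ip_scale[OF u scale_mem[OF u]] ip_scale_right[OF u u])
    qed
    have "Re (ip (\<lambda>z. b z - 1 * a z) (\<lambda>z. b z - 1 * a z)) +
        Re (ip (\<lambda>z. b z - (-1) * a z) (\<lambda>z. b z - (-1) * a z)) = 2 * D (p m) + 2 * D (p n)"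
      unfolding ip_expand[OF ab(2,1)] by (simp add: D_def a_def b_def)
    then have "Re (ip (\<lambda>z. b z - 1 * a z) (\<lambda>z. b z - 1 * a z)) \<le> 2 * D (p m) + 2 * D (p n) - 4 * d"
      using 2 dle[OF mid] by linarith
    also have "\<dots> \<le> 2 / Suc m + 2 / Suc n" using p(2)[of m] p(2)[of n] by simp
    finally show ?thesis using 1 by simp
  qed
  have orth: "(\<lambda>n. ip (\<lambda>z. \<phi> z - p n z) q) \<longlonglongrightarrow> 0" if q: "q \<in> P" for q
  proof -
    have qL: "q \<in> L" using q P by auto
    define G where "G = Re (ip q q)"
    have G: "0 \<le> G" unfolding G_def by (rule ip_nonneg[OF qL])
    have b: "(cmod (ip (\<lambda>z. \<phi> z - p n z) q))\<^sup>2 \<le> (G + 1) / Suc n" for n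
    proof -
      define a where "a = (\<lambda>z. \<phi> z - p n z)"
      have a: "a \<in> L" unfolding a_def by (intro diff_mem \<phi> pL)
      define x where "x = ip a q"
      \<comment> \<open>The optimal step would be 1/G. The shift by 1 covers G = 0 and keeps s G
        \<le> 1, so that half of the gain in the linear term survives the quadratic term.\<close>
      define s where "s = 1 / (G + 1)"
      have s: "0 < s" "s * G \<le> 1" using G by (simp_all add: s_def)
      have "(\<lambda>z. p n z + (s * x) * q z) \<in> P" by (intro P p q)
      from dle[OF this] have "d \<le> Re (ip (\<lambda>z. a z - (s * x) * q z) (\<lambda>z. a z - (s * x) * q z))"
        unfolding D_def a_def by (simp add: algebra_simps)
      also have "\<dots> = Re (ip a a) - 2 * Re (cnj (s * x) * x) + (cmod (s * x))\<^sup>2 * G"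
        unfolding ip_expand[OF a qL] x_def G_def by simp
      also have "cnj (s * x) * x = of_real (s * (cmod x)\<^sup>2)"
        using complex_norm_square[of x] by (simp add: mult_ac)
      also have "Re (ip a a) = D (p n)" by (simp add: D_def a_def)
      finally have "2 * s * (cmod x)\<^sup>2 \<le> 1 / Suc n + s\<^sup>2 * (cmod x)\<^sup>2 * G"
        using p(2)[of n] s by (simp add: norm_mult power_mult_distrib algebra_simps)
      moreover have "s\<^sup>2 * (cmod x)\<^sup>2 * G \<le> s * (cmod x)\<^sup>2"
        using mult_left_mono[OF s(2), of "s * (cmod x)\<^sup>2"] s by (simp add: power2_eq_square mult_ac)
      ultimately have "s * (cmod x)\<^sup>2 \<le> 1 / Suc n" by linarith
      then have "(cmod x)\<^sup>2 / (G + 1) \<le> 1 / Suc n" by (simp add: s_def)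
      then have "(cmod x)\<^sup>2 \<le> 1 / Suc n * (G + 1)" using G by (subst (asm) pos_divide_le_eq) auto
      then show ?thesis by (simp add: x_def a_def)
    qed
    have "(\<lambda>n. (G + 1) / Suc n) \<longlonglongrightarrow> 0"
      by (rule LIMSEQ_Suc[OF lim_const_over_n])
    then have "(\<lambda>n. (cmod (ip (\<lambda>z. \<phi> z - p n z) q))\<^sup>2) \<longlonglongrightarrow> 0"
      by (rule Lim_null_comparison[rotated]) (use b in auto)
    then have "(\<lambda>n. sqrt ((cmod (ip (\<lambda>z. \<phi> z - p n z) q))\<^sup>2)) \<longlonglongrightarrow> sqrt 0"
      by (rule tendsto_real_sqrt)
    then show ?thesis by (simp add: tendsto_norm_zero_iff)
  qed
  show thesis using that[of p] p(1) cau orth by blast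
qed

end

lemma rkhs_semi_inner_product:
  assumes "rkhs X K H ip"
  shows "semi_inner_product H ip"
proof -
  interpret rkhs X K H ip by fact
  show ?thesis
    by unfold_locales (fact zero_mem add_mem scale_mem ip_add ip_scale ip_cnj ip_nonneg)+
qed

section \<open>Square-integrable functions and completeness in square mean\<close>

definition square_integrable :: "'a measure \<Rightarrow> ('a \<Rightarrow> complex) set" where
  "square_integrable M = {f \<in> borel_measurable M. integrable M (\<lambda>x. (cmod (f x))\<^sup>2)}"

lemma mult_le_sum_squares: "a * b \<le> a\<^sup>2 + b\<^sup>2" for a b :: real
  using sum_squares_bound[of "\<bar>a\<bar>" "\<bar>b\<bar>"] abs_ge_self[of "a * b"] abs_ge_zero[of "a * b"]
  unfolding mult.assoc abs_mult[symmetric] power2_abs by linarith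

lemma integrable_mult_square_integrable:
  assumes "f \<in> square_integrable M" "g \<in> square_integrable M"
  shows "integrable M (\<lambda>x. f x * g x)"
proof (rule Bochner_Integration.integrable_bound)
  show "integrable M (\<lambda>x. (cmod (f x))\<^sup>2 + (cmod (g x))\<^sup>2)"
    using assms by (auto simp: square_integrable_def)
  show "(\<lambda>x. f x * g x) \<in> borel_measurable M"
    using assms by (auto simp: square_integrable_def)
  show "AE x in M. norm (f x * g x) \<le> norm ((cmod (f x))\<^sup>2 + (cmod (g x))\<^sup>2)"
    by (auto simp: norm_mult mult_le_sum_squares)
qed

lemma borel_measurable_cnj [measurable]:
  "f \<in> borel_measurable M \<Longrightarrow> (\<lambda>x. cnj (f x)) \<in> borel_measurable M"
  by (rule borel_measurable_continuous_on[OF continuous_on_cnj[OF continuous_on_id]])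

lemma square_integrable_cnj:
  "f \<in> square_integrable M \<Longrightarrow> (\<lambda>x. cnj (f x)) \<in> square_integrable M"
  by (auto simp: square_integrable_def intro: borel_measurable_cnj)

lemma square_integrable_mult_bounded:
  assumes "f \<in> square_integrable M" "g \<in> borel_measurable M" "\<And>x. x \<in> space M \<Longrightarrow> cmod (g x) \<le> B"
  shows "(\<lambda>x. g x * f x) \<in> square_integrable M"
proof -
  have "integrable M (\<lambda>x. (cmod (g x * f x))\<^sup>2)"
  proof (rule Bochner_Integration.integrable_bound)
    show "integrable M (\<lambda>x. B\<^sup>2 * (cmod (f x))\<^sup>2)"
      using assms by (auto simp: square_integrable_def)
    show "(\<lambda>x. (cmod (g x * f x))\<^sup>2) \<in> borel_measurable M"
      using assms by (auto simp: square_integrable_def)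
    show "AE x in M. norm ((cmod (g x * f x))\<^sup>2) \<le> norm (B\<^sup>2 * (cmod (f x))\<^sup>2)"
      using assms by (auto simp: norm_mult power_mult_distrib intro!: mult_right_mono power_mono)
  qed
  then show ?thesis using assms by (auto simp: square_integrable_def)
qed

lemma square_integrable_add:
  assumes "f \<in> square_integrable M" "g \<in> square_integrable M"
  shows "(\<lambda>x. f x + g x) \<in> square_integrable M"
proof -
  have "integrable M (\<lambda>x. (cmod (f x + g x))\<^sup>2)"
  proof (rule Bochner_Integration.integrable_bound)
    show "integrable M (\<lambda>x. 2 * (cmod (f x))\<^sup>2 + 2 * (cmod (g x))\<^sup>2)"
      using assms by (auto simp: square_integrable_def)
    show "(\<lambda>x. (cmod (f x + g x))\<^sup>2) \<in> borel_measurable M"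
      using assms by (auto simp: square_integrable_def)
    have "(cmod (f x + g x))\<^sup>2 \<le> 2 * (cmod (f x))\<^sup>2 + 2 * (cmod (g x))\<^sup>2" for x
    proof -
      have "(cmod (f x + g x))\<^sup>2 \<le> (cmod (f x) + cmod (g x))\<^sup>2"
        by (intro power_mono norm_triangle_ineq) auto
      also have "\<dots> \<le> 2 * (cmod (f x))\<^sup>2 + 2 * (cmod (g x))\<^sup>2"
        using sum_squares_bound[of "cmod (f x)" "cmod (g x)"] by (simp add: power2_sum)
      finally show ?thesis .
    qed
    then show "AE x in M. norm ((cmod (f x + g x))\<^sup>2) \<le> norm (2 * (cmod (f x))\<^sup>2 + 2 * (cmod (g x))\<^sup>2)"
      by (auto intro: order_trans)
  qed
  then show ?thesis using assms by (auto simp: square_integrable_def)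
qed

lemma square_integrable_scale:
  "f \<in> square_integrable M \<Longrightarrow> (\<lambda>x. c * f x) \<in> square_integrable M"
  by (rule square_integrable_mult_bounded[where B="cmod c"]) auto

lemma square_integrable_bounded:
  assumes "finite_measure M" "f \<in> borel_measurable M" "\<And>x. x \<in> space M \<Longrightarrow> cmod (f x) \<le> B"
  shows "f \<in> square_integrable M"
proof -
  interpret finite_measure M by fact
  have "(\<lambda>x. 1) \<in> square_integrable M" by (auto simp: square_integrable_def)
  from square_integrable_mult_bounded[OF this assms(2,3)] show ?thesis by auto
qed

lemma square_integrable_integrable:
  assumes "finite_measure M" "f \<in> square_integrable M"
  shows "integrable M f"
  using integrable_mult_square_integrable[OF assms(2) square_integrable_bounded[OF assms(1), of "\<lambda>_. 1" 1]]
  by auto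

text \<open>The elements are functions, not classes modulo null sets, so this form is only
  semi-definite.\<close>

lemma L2_semi_inner_product:
  "semi_inner_product (square_integrable M) (\<lambda>f g. \<integral>x. f x * cnj (g x) \<partial>M)"
proof
  fix f g h assume "f \<in> square_integrable M" "g \<in> square_integrable M" "h \<in> square_integrable M"
  then have "integrable M (\<lambda>x. f x * cnj (h x))" "integrable M (\<lambda>x. g x * cnj (h x))"
    by (auto intro!: integrable_mult_square_integrable square_integrable_cnj)
  then show "(\<integral>x. (f x + g x) * cnj (h x) \<partial>M) = (\<integral>x. f x * cnj (h x) \<partial>M) + (\<integral>x. g x * cnj (h x) \<partial>M)"
    by (simp add: distrib_right)
next
  fix f g and c :: complex
  show "(\<integral>x. (c * f x) * cnj (g x) \<partial>M) = c * (\<integral>x. f x * cnj (g x) \<partial>M)"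
    by (simp add: mult.assoc)
next
  fix f g :: "'a \<Rightarrow> complex"
  have "cnj (\<integral>x. f x * cnj (g x) \<partial>M) = (\<integral>x. cnj (f x * cnj (g x)) \<partial>M)"
    by (rule Bochner_Integration.integral_cnj[symmetric])
  then show "(\<integral>x. g x * cnj (f x) \<partial>M) = cnj (\<integral>x. f x * cnj (g x) \<partial>M)"
    by (simp add: mult.commute)
next
  fix f
  have "(\<integral>x. f x * cnj (f x) \<partial>M) = (\<integral>x. complex_of_real ((cmod (f x))\<^sup>2) \<partial>M)"
    by (simp only: complex_norm_square)
  then show "0 \<le> Re (\<integral>x. f x * cnj (f x) \<partial>M)"
    by (simp only: integral_complex_of_real Re_complex_of_real) (rule integral_nonneg_AE, auto)
qed (auto intro: square_integrable_add square_integrable_scale, simp add: square_integrable_def)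

lemma L2_self: "Re (\<integral>x. f x * cnj (f x) \<partial>M) = (\<integral>x. (cmod (f x))\<^sup>2 \<partial>M)"
proof -
  have "(\<integral>x. f x * cnj (f x) \<partial>M) = (\<integral>x. complex_of_real ((cmod (f x))\<^sup>2) \<partial>M)"
    by (simp only: complex_norm_square)
  then show ?thesis by (simp only: integral_complex_of_real Re_complex_of_real)
qed

text \<open>Riesz-Fischer: a rapidly converging subsequence converges almost everywhere, and Fatou's
  lemma makes its pointwise limit the limit in square mean of the whole sequence.\<close>

lemma L2_complete:
  fixes p :: "nat \<Rightarrow> 'a \<Rightarrow> complex"
  assumes fin: "finite_measure M" and p: "\<And>n. p n \<in> square_integrable M"
    and cau: "\<And>m n. (\<integral>x. (cmod (p m x - p n x))\<^sup>2 \<partial>M) \<le> 2 / Suc m + 2 / Suc n"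
  obtains f where "f \<in> square_integrable M" "(\<lambda>n. \<integral>x. (cmod (p n x - f x))\<^sup>2 \<partial>M) \<longlonglongrightarrow> 0"
proof -
  interpret finite_measure M by fact
  interpret L2: semi_inner_product "square_integrable M" "\<lambda>f g. \<integral>x. f x * cnj (g x) \<partial>M"
    by (rule L2_semi_inner_product)
  have pm[measurable]: "p n \<in> borel_measurable M" for n using p by (auto simp: square_integrable_def)
  \<comment> \<open>Along the indices 4^k the squared norms of consecutive differences are at most
    4/4^k, so the norms decay like 2^(-k) and are summable.\<close>
  define q where "q k = p (4 ^ k)" for k
  have qm[measurable]: "q k \<in> borel_measurable M" for k unfolding q_def by measurable
  define d where "d k x = q (Suc k) x - q k x" for k x
  have dm[measurable]: "d k \<in> borel_measurable M" for k unfolding d_def by measurable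
  have dsi: "d k \<in> square_integrable M" for k
    unfolding d_def q_def using L2.diff_mem[OF p p] by simp
  have d2: "(\<integral>x. (cmod (d k x))\<^sup>2 \<partial>M) \<le> 4 / 4 ^ k" for k
  proof -
    have "(\<integral>x. (cmod (d k x))\<^sup>2 \<partial>M) \<le> 2 / Suc (4 ^ Suc k) + 2 / Suc (4 ^ k)"
      unfolding d_def q_def by (rule cau)
    also have "\<dots> \<le> 2 / 4 ^ k + 2 / 4 ^ k"
      by (intro add_mono divide_left_mono mult_pos_pos) (auto intro: add_pos_pos)
    finally show ?thesis by simp
  qed
  \<comment> \<open>Finite total mass turns the L^2 bounds into L^1 bounds. Adding 1 to the mass
    lets it be dominated by a perfect square.\<close>
  have d1: "(\<integral>\<^sup>+x. norm (d k x) \<partial>M) \<le> ennreal (2 * (measure M (space M) + 1) * (1/2) ^ k)" for k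
  proof -
    have nd: "(\<lambda>x. complex_of_real (norm (d k x))) \<in> square_integrable M"
      using dsi by (auto simp: square_integrable_def)
    have one: "(\<lambda>x. 1) \<in> square_integrable M" by (auto simp: square_integrable_def)
    have int: "integrable M (\<lambda>x. norm (d k x))"
      using square_integrable_integrable[OF fin dsi] by simp
    have eq: "(\<integral>x. complex_of_real (norm (d k x)) * cnj 1 \<partial>M) = of_real (\<integral>x. norm (d k x) \<partial>M)"
      by simp
    have "(\<integral>x. norm (d k x) \<partial>M)\<^sup>2 \<le> (\<integral>x. (cmod (d k x))\<^sup>2 \<partial>M) * measure M (space M)"
      using L2.cauchy_schwarz[OF nd one] unfolding L2_self eq by simp
    also have "\<dots> \<le> 4 / 4 ^ k * (measure M (space M) + 1)\<^sup>2"
    proof (intro mult_mono d2)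
      show "measure M (space M) \<le> (measure M (space M) + 1)\<^sup>2"
        by (simp add: power2_sum)
    qed auto
    also have "\<dots> = (2 * (measure M (space M) + 1) * (1/2) ^ k)\<^sup>2"
    proof -
      have "((1/2::real) ^ k)\<^sup>2 = 1 / 4 ^ k"
        by (simp add: power2_eq_square power_one_over flip: power_mult_distrib)
      then show ?thesis unfolding power_mult_distrib by simp
    qed
    finally have "(\<integral>x. norm (d k x) \<partial>M) \<le> 2 * (measure M (space M) + 1) * (1/2) ^ k"
      by (rule power2_le_imp_le) auto
    then show ?thesis
      by (subst nn_integral_eq_integral[OF int]) (auto intro: ennreal_leI)
  qed
  have "(\<integral>\<^sup>+x. (\<Sum>k. ennreal (norm (d k x))) \<partial>M) = (\<Sum>k. \<integral>\<^sup>+x. norm (d k x) \<partial>M)"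
    by (rule nn_integral_suminf) auto
  also have "\<dots> \<le> (\<Sum>k. ennreal (2 * (measure M (space M) + 1) * (1/2) ^ k))"
    by (intro suminf_le d1 summableI)
  also have "\<dots> = ennreal (\<Sum>k. 2 * (measure M (space M) + 1) * (1/2) ^ k)"
    by (intro suminf_ennreal2 summable_mult) auto
  also have "\<dots> < \<infinity>" by simp
  finally have "(\<integral>\<^sup>+x. (\<Sum>k. ennreal (norm (d k x))) \<partial>M) \<noteq> \<infinity>" by simp
  then have "AE x in M. (\<Sum>k. ennreal (norm (d k x))) \<noteq> \<infinity>"
    by (intro nn_integral_PInf_AE) auto
  then have conv: "AE x in M. convergent (\<lambda>k. q k x)"
  proof (rule AE_mp, intro AE_I2 impI)
    fix x assume "(\<Sum>k. ennreal (norm (d k x))) \<noteq> \<infinity>"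
    then have "summable (\<lambda>k. norm (d k x))"
      by (intro summable_suminf_not_top) auto
    then have "summable (\<lambda>k. d k x)" by (rule summable_norm_cancel)
    then have "convergent (\<lambda>n. \<Sum>k<n. d k x)" by (simp add: summable_iff_convergent)
    moreover have "(\<Sum>k<n. d k x) = q n x - q 0 x" for n
      unfolding d_def by (rule sum_lessThan_telescope)
    ultimately have "convergent (\<lambda>n. q n x - q 0 x + q 0 x)"
      by (intro convergent_add convergent_const) auto
    then show "convergent (\<lambda>k. q k x)" by simp
  qed
  define f where "f x = lim (\<lambda>k. q k x)" for x
  have fm[measurable]: "f \<in> borel_measurable M"
    unfolding f_def by (rule borel_measurable_lim_metric) simp
  have qf: "AE x in M. (\<lambda>k. q k x) \<longlonglongrightarrow> f x"
    using conv by eventually_elim (simp add: f_def convergent_LIMSEQ_iff)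
  \<comment> \<open>Fatou's lemma in k with n fixed: the Cauchy bound for the indices n and 4^k
    survives in the limit, and n \<le> 4^k for k \<ge> n turns it into 4/(n+1).\<close>
  have le: "(\<integral>\<^sup>+x. (cmod (p n x - f x))\<^sup>2 \<partial>M) \<le> ennreal (4 / Suc n)" for n
  proof -
    have "(\<integral>\<^sup>+x. (cmod (p n x - f x))\<^sup>2 \<partial>M) =
        (\<integral>\<^sup>+x. liminf (\<lambda>k. ennreal ((cmod (p n x - q k x))\<^sup>2)) \<partial>M)"
    proof (rule nn_integral_cong_AE)
      show "AE x in M. ennreal ((cmod (p n x - f x))\<^sup>2) = liminf (\<lambda>k. ennreal ((cmod (p n x - q k x))\<^sup>2))"
        using qf
      proof eventually_elim
        case (elim x)
        then have "(\<lambda>k. ennreal ((cmod (p n x - q k x))\<^sup>2)) \<longlonglongrightarrow> ennreal ((cmod (p n x - f x))\<^sup>2)"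
          by (intro tendsto_intros)
        then show ?case by (intro lim_imp_Liminf[symmetric]) auto
      qed
    qed
    also have "\<dots> \<le> liminf (\<lambda>k. \<integral>\<^sup>+x. ennreal ((cmod (p n x - q k x))\<^sup>2) \<partial>M)"
      by (rule nn_integral_liminf) auto
    also have "\<dots> \<le> limsup (\<lambda>k. \<integral>\<^sup>+x. ennreal ((cmod (p n x - q k x))\<^sup>2) \<partial>M)"
      by (rule Liminf_le_Limsup) simp
    also have "\<dots> \<le> ennreal (4 / Suc n)"
    proof (rule Limsup_bounded, rule eventually_sequentiallyI)
      fix k assume k: "n \<le> k"
      have "integrable M (\<lambda>x. (cmod (p n x - q k x))\<^sup>2)"
        using L2.diff_mem[OF p[of n] p[of "4 ^ k"]] by (auto simp: square_integrable_def q_def)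
      then have "(\<integral>\<^sup>+x. ennreal ((cmod (p n x - q k x))\<^sup>2) \<partial>M) = ennreal (\<integral>x. (cmod (p n x - q k x))\<^sup>2 \<partial>M)"
        by (intro nn_integral_eq_integral) auto
      also have "\<dots> \<le> ennreal (2 / Suc n + 2 / Suc (4 ^ k))"
        unfolding q_def by (intro ennreal_leI cau)
      also have "\<dots> \<le> ennreal (2 / Suc n + 2 / Suc n)"
      proof (intro ennreal_leI add_mono divide_left_mono order_refl)
        have "n \<le> 4 ^ k" using k less_exp[of k] power_mono[of "2::nat" 4 k] by linarith
        then show "real (Suc n) \<le> real (Suc (4 ^ k))" by (simp only: of_nat_le_iff Suc_le_mono)
      qed (auto intro!: mult_pos_pos add_pos_nonneg)
      finally show "(\<integral>\<^sup>+x. ennreal ((cmod (p n x - q k x))\<^sup>2) \<partial>M) \<le> ennreal (4 / Suc n)" by simp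
    qed
    finally show ?thesis .
  qed
  have pfi: "integrable M (\<lambda>x. (cmod (p n x - f x))\<^sup>2)" for n
    using le[of n] by (intro integrableI_nonneg) (auto intro: le_less_trans)
  then have pf: "(\<lambda>x. p n x - f x) \<in> square_integrable M" for n
    by (auto simp: square_integrable_def)
  have f: "f \<in> square_integrable M" using L2.diff_mem[OF p pf, of 0 0] by simp
  have "(\<integral>x. (cmod (p n x - f x))\<^sup>2 \<partial>M) \<le> 4 / Suc n" for n
    using le[of n] nn_integral_eq_integral[OF pfi[of n]] by (simp add: ennreal_le_iff)
  then have "(\<lambda>n. \<integral>x. (cmod (p n x - f x))\<^sup>2 \<partial>M) \<longlonglongrightarrow> 0"
    by (intro Lim_null_comparison[OF _ LIMSEQ_Suc[OF lim_const_over_n[of 4]]]) auto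
  with f show ?thesis by (rule that)
qed

section \<open>Polarization and the Clark kernel identity\<close>

lemma one_minus_mult_bound:
  fixes u w :: complex
  assumes "cmod u \<le> 1" "cmod w < 1"
  shows "1 - u * w \<noteq> 0" "cmod (1 / (1 - u * w)) \<le> 1 / (1 - cmod w)"
proof -
  have "cmod (u * w) \<le> cmod w" using assms by (simp add: norm_mult mult_left_le_one_le)
  then have *: "1 - cmod w \<le> cmod (1 - u * w)"
    using norm_triangle_ineq2[of 1 "u * w"] by simp
  then show "1 - u * w \<noteq> 0" using assms by auto
  show "cmod (1 / (1 - u * w)) \<le> 1 / (1 - cmod w)"
    using * assms by (simp add: norm_divide frac_le)
qed

text \<open>Expanding the geometric series exhibits the integral as a power series in z whose
  coefficients are the moments of v against \<kappa>. With M and v abstract it serves for either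
  coordinate of the torus.\<close>

lemma holomorphic_integral_geometric:
  fixes \<kappa> v :: "'a \<Rightarrow> complex"
  assumes \<kappa>: "integrable M \<kappa>" and v[measurable]: "v \<in> borel_measurable M"
    and v1: "\<And>x. x \<in> space M \<Longrightarrow> cmod (v x) \<le> 1"
  shows "(\<lambda>z. \<integral>x. \<kappa> x * (1 / (1 - z * v x)) \<partial>M) holomorphic_on ball 0 1"
proof (rule power_series_holomorphic)
  fix z :: complex assume "z \<in> ball 0 1"
  then have z: "cmod z < 1" by simp
  have [measurable]: "\<kappa> \<in> borel_measurable M" using \<kappa> by auto
  have zv: "cmod (z * v x) \<le> cmod z" if "x \<in> space M" for x
    using v1[OF that] by (simp add: norm_mult mult_left_le)
  have le: "norm (\<kappa> x * (z * v x) ^ n) \<le> cmod (\<kappa> x) * cmod z ^ n" if "x \<in> space M" for x n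
    using zv[OF that] unfolding norm_mult[of "\<kappa> x"] norm_power
    by (intro mult_left_mono power_mono) auto
  have i: "integrable M (\<lambda>x. \<kappa> x * (z * v x) ^ n)" for n
  proof (rule Bochner_Integration.integrable_bound[OF \<kappa>])
    show "AE x in M. norm (\<kappa> x * (z * v x) ^ n) \<le> norm (\<kappa> x)"
    proof (rule AE_I2)
      fix x assume x: "x \<in> space M"
      have "cmod (\<kappa> x) * cmod z ^ n \<le> cmod (\<kappa> x)"
        using z by (simp add: mult_left_le power_le_one)
      then show "norm (\<kappa> x * (z * v x) ^ n) \<le> norm (\<kappa> x)" using le[OF x, of n] by simp
    qed
  qed measurable
  have "(\<lambda>n. \<integral>x. \<kappa> x * (z * v x) ^ n \<partial>M) sums (\<integral>x. (\<Sum>n. \<kappa> x * (z * v x) ^ n) \<partial>M)"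
  proof (rule sums_integral[OF i])
    have sg: "summable (\<lambda>n. cmod (\<kappa> x) * cmod z ^ n)" for x
      using z by (intro summable_mult summable_geometric) auto
    show "AE x in M. summable (\<lambda>n. norm (\<kappa> x * (z * v x) ^ n))"
      using le by (intro AE_I2 summable_comparison_test'[OF sg, where N=0]) auto
    show "summable (\<lambda>n. \<integral>x. norm (\<kappa> x * (z * v x) ^ n) \<partial>M)"
    proof (rule summable_comparison_test'[where g="\<lambda>n. (\<integral>x. norm (\<kappa> x) \<partial>M) * cmod z ^ n" and N=0])
      show "summable (\<lambda>n. (\<integral>x. norm (\<kappa> x) \<partial>M) * cmod z ^ n)"
        using z by (intro summable_mult summable_geometric) auto
      fix n
      have "norm (\<integral>x. norm (\<kappa> x * (z * v x) ^ n) \<partial>M) = (\<integral>x. norm (\<kappa> x * (z * v x) ^ n) \<partial>M)"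
        unfolding real_norm_def by (intro abs_of_nonneg Bochner_Integration.integral_nonneg norm_ge_zero)
      also have "\<dots> \<le> (\<integral>x. norm (\<kappa> x) * cmod z ^ n \<partial>M)"
        using le by (intro integral_mono integrable_norm i integrable_mult_left \<kappa>)
      also have "\<dots> = (\<integral>x. norm (\<kappa> x) \<partial>M) * cmod z ^ n" by (rule integral_mult_left_zero)
      finally show "norm (\<integral>x. norm (\<kappa> x * (z * v x) ^ n) \<partial>M) \<le> (\<integral>x. norm (\<kappa> x) \<partial>M) * cmod z ^ n" .
    qed
  qed
  also have "(\<integral>x. (\<Sum>n. \<kappa> x * (z * v x) ^ n) \<partial>M) = (\<integral>x. \<kappa> x * (1 / (1 - z * v x)) \<partial>M)"
  proof (rule Bochner_Integration.integral_cong[OF refl])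
    fix x assume "x \<in> space M"
    then have "cmod (z * v x) < 1" using zv z by fastforce
    then have "(\<lambda>n. (z * v x) ^ n) sums (1 / (1 - z * v x))" by (rule geometric_sums)
    then show "(\<Sum>n. \<kappa> x * (z * v x) ^ n) = \<kappa> x * (1 / (1 - z * v x))"
      by (intro sums_unique[symmetric] sums_mult)
  qed
  also have "(\<lambda>n. \<integral>x. \<kappa> x * (z * v x) ^ n \<partial>M) = (\<lambda>n. (\<integral>x. \<kappa> x * v x ^ n \<partial>M) * (z - 0) ^ n)"
  proof
    fix n
    have "(\<integral>x. \<kappa> x * (z * v x) ^ n \<partial>M) = (\<integral>x. (\<kappa> x * v x ^ n) * z ^ n \<partial>M)"
      by (simp add: power_mult_distrib mult_ac)
    then show "(\<integral>x. \<kappa> x * (z * v x) ^ n \<partial>M) = (\<integral>x. \<kappa> x * v x ^ n \<partial>M) * (z - 0) ^ n" by simp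
  qed
  finally show "(\<lambda>n. (\<integral>x. \<kappa> x * v x ^ n \<partial>M) * (z - 0) ^ n) sums (\<integral>x. \<kappa> x * (1 / (1 - z * v x)) \<partial>M)" .
qed

text \<open>On the disc A = - cnj B, so the derivative is both complex linear and antilinear, hence
  zero. Thus B is constant and may be evaluated at a second point.\<close>

lemma holomorphic_plus_cnj_holomorphic_zero:
  assumes A: "A holomorphic_on ball 0 1" and B: "B holomorphic_on ball 0 1"
    and AB: "\<And>z. cmod z < 1 \<Longrightarrow> A z + cnj (B z) = 0"
    and z: "cmod z < 1" and w: "cmod w < 1"
  shows "A z + cnj (B w) = 0"
proof -
  have "(B has_field_derivative 0) (at z within ball 0 1)" if z: "z \<in> ball 0 1" for z
  proof -
    obtain a b where a: "(A has_field_derivative a) (at z)" and b: "(B has_field_derivative b) (at z)"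
      using A B z holomorphic_derivI open_ball by metis
    have "((\<lambda>z. - cnj (B z)) has_derivative (\<lambda>h. - cnj (b * h))) (at z)"
      using b[unfolded has_field_derivative_def] by (intro derivative_intros)
    then have "(A has_derivative (\<lambda>h. - cnj (b * h))) (at z)"
      by (rule has_derivative_transform_within_open[OF _ open_ball z])
        (use AB in \<open>auto simp: eq_neg_iff_add_eq_0 neg_eq_iff_add_eq_0 add.commute\<close>)
    then have eq: "(\<lambda>h. a * h) = (\<lambda>h. - cnj (b * h))"
      using a[unfolded has_field_derivative_def] has_derivative_unique by blast
    \<comment> \<open>Evaluation at 1 and at \<i> separates linear from antilinear maps.\<close>
    have "a = - cnj b" using fun_cong[OF eq, of 1] by simp
    moreover have "a = cnj b" using fun_cong[OF eq, of \<i>] by simp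
    ultimately have "b = 0" by simp
    with b show ?thesis by (simp add: has_field_derivative_at_within)
  qed
  then obtain c where "\<And>z. z \<in> ball 0 1 \<Longrightarrow> B z = c"
    using has_field_derivative_zero_constant[of "ball 0 1" B] by auto
  then have "B z = B w" using z w by simp
  then show ?thesis using AB[OF z] by simp
qed

text \<open>Multiplied by \<open>1 - z cnj w\<close>, both sides become a holomorphic function of \<open>z\<close> plus an
  antiholomorphic function of \<open>w\<close>, and such a sum is determined by its values for \<open>z = w\<close>.\<close>

lemma polarization_disc:
  fixes \<kappa> v :: "'a \<Rightarrow> complex"
  assumes \<kappa>: "integrable M \<kappa>" and v[measurable]: "v \<in> borel_measurable M"
    and v1: "\<And>x. x \<in> space M \<Longrightarrow> cmod (v x) = 1"
    and H: "H holomorphic_on ball 0 1" and G: "G holomorphic_on ball 0 1"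
    and diag: "\<And>z. cmod z < 1 \<Longrightarrow>
      (\<integral>x. \<kappa> x * (1 / (1 - z * cnj (v x)) * (1 / (1 - v x * cnj z))) \<partial>M) =
          (H z + cnj (G z)) / (1 - z * cnj z)"
    and z: "cmod z < 1" and w: "cmod w < 1"
  shows "(\<integral>x. \<kappa> x * (1 / (1 - z * cnj (v x)) * (1 / (1 - v x * cnj w))) \<partial>M) =
      (H z + cnj (G w)) / (1 - z * cnj w)"
proof -
  have [measurable]: "\<kappa> \<in> borel_measurable M" using \<kappa> by auto
  define A where "A z = (\<integral>x. \<kappa> x * (1 / (1 - z * cnj (v x))) \<partial>M)" for z
  \<comment> \<open>The subtracted constant accounts for the -1 in the partial fractions 1/(1 - z
    cnj v) + 1/(1 - v cnj w) - 1.\<close>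
  define B where "B z = (\<integral>x. cnj (\<kappa> x) * (1 / (1 - z * cnj (v x))) \<partial>M) - (\<integral>x. cnj (\<kappa> x) \<partial>M)" for z
  have hol: "(\<lambda>z. A z - H z) holomorphic_on ball 0 1" "(\<lambda>z. B z - G z) holomorphic_on ball 0 1"
    unfolding A_def B_def using \<kappa> v1
    by (intro holomorphic_on_diff holomorphic_integral_geometric holomorphic_on_const H G; simp)+
  have int: "integrable M (\<lambda>x. \<kappa> x * (1 / (1 - z * cnj (v x))))" if "cmod z < 1" "integrable M \<kappa>" for z \<kappa>
  proof (rule Bochner_Integration.integrable_bound)
    have [measurable]: "\<kappa> \<in> borel_measurable M" using that by auto
    show "integrable M (\<lambda>x. \<kappa> x * of_real (1 / (1 - cmod z)))" using that by auto
    show "(\<lambda>x. \<kappa> x * (1 / (1 - z * cnj (v x)))) \<in> borel_measurable M" by measurable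
    show "AE x in M. norm (\<kappa> x * (1 / (1 - z * cnj (v x)))) \<le> norm (\<kappa> x * of_real (1 / (1 - cmod z)))"
    proof (rule AE_I2)
      fix x assume "x \<in> space M"
      then have "cmod (1 / (1 - z * cnj (v x))) \<le> 1 / (1 - cmod z)"
        using one_minus_mult_bound(2)[of "cnj (v x)" z] v1 that by (simp add: mult.commute)
      then show "norm (\<kappa> x * (1 / (1 - z * cnj (v x)))) \<le> norm (\<kappa> x * of_real (1 / (1 - cmod z)))"
        unfolding norm_mult norm_of_real using that by (intro mult_left_mono) auto
    qed
  qed
  have split: "(1 - z * cnj w) * (\<integral>x. \<kappa> x * (1 / (1 - z * cnj (v x)) * (1 / (1 - v x * cnj w))) \<partial>M) =
      A z + cnj (B w)"
    if z: "cmod z < 1" and w: "cmod w < 1" for z w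
  proof -
    have "(1 - z * cnj w) * (\<integral>x. \<kappa> x * (1 / (1 - z * cnj (v x)) * (1 / (1 - v x * cnj w))) \<partial>M) =
       (\<integral>x. (1 - z * cnj w) * (\<kappa> x * (1 / (1 - z * cnj (v x)) * (1 / (1 - v x * cnj w)))) \<partial>M)"
      by (rule integral_mult_right_zero[symmetric])
    also have "\<dots> = (\<integral>x. \<kappa> x * (1 / (1 - z * cnj (v x))) + (\<kappa> x * cnj (1 / (1 - w * cnj (v x))) - \<kappa> x) \<partial>M)"
    proof (rule Bochner_Integration.integral_cong[OF refl])
      fix x assume x: "x \<in> space M"
      have n: "1 - z * cnj (v x) \<noteq> 0" "1 - v x * cnj w \<noteq> 0"
        using one_minus_mult_bound(1)[of "cnj (v x)" z] one_minus_mult_bound(1)[of "v x" "cnj w"] v1[OF x] z w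
        by (auto simp: mult.commute)
      have vv: "v x * cnj (v x) = 1" using v1[OF x] by (simp add: complex_norm_square[symmetric])
      \<comment> \<open>Since v cnj v = 1, the factor 1 - z cnj w equals 1 - (z cnj v) (v cnj w);
        this is what separates z from w.\<close>
      have "(1 - z * cnj w) * (1 / (1 - z * cnj (v x)) * (1 / (1 - v x * cnj w))) =
         (1 - (z * cnj w) * (v x * cnj (v x))) / ((1 - z * cnj (v x)) * (1 - v x * cnj w))"
        unfolding vv by simp
      also have "\<dots> = 1 / (1 - z * cnj (v x)) + (1 / (1 - v x * cnj w) - 1)"
        using n by (simp add: divide_simps) (simp add: algebra_simps)
      finally have "\<kappa> x * ((1 - z * cnj w) * (1 / (1 - z * cnj (v x)) * (1 / (1 - v x * cnj w)))) =
         \<kappa> x * (1 / (1 - z * cnj (v x)) + (1 / (1 - v x * cnj w) - 1))" by simp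
      then show "(1 - z * cnj w) * (\<kappa> x * (1 / (1 - z * cnj (v x)) * (1 / (1 - v x * cnj w)))) =
        \<kappa> x * (1 / (1 - z * cnj (v x))) + (\<kappa> x * cnj (1 / (1 - w * cnj (v x))) - \<kappa> x)"
        by (simp add: algebra_simps)
    qed
    also have "\<dots> = A z + ((\<integral>x. cnj (cnj (\<kappa> x) * (1 / (1 - w * cnj (v x)))) \<partial>M) - (\<integral>x. cnj (cnj (\<kappa> x)) \<partial>M))"
    proof -
      have "integrable M (\<lambda>x. cnj (cnj (\<kappa> x) * (1 / (1 - w * cnj (v x)))))"
        using int[OF w, of "\<lambda>x. cnj (\<kappa> x)"] \<kappa> by (simp only: integrable_cnj simp_thms)
      then show ?thesis unfolding A_def using int[OF z \<kappa>] \<kappa>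
        by (simp add: Bochner_Integration.integral_add Bochner_Integration.integral_diff)
    qed
    also have "\<dots> = A z + cnj (B w)"
      unfolding B_def complex_cnj_diff Bochner_Integration.integral_cnj by simp
    finally show ?thesis .
  qed
  have n: "1 - z * cnj w \<noteq> 0" if "cmod z < 1" "cmod w < 1" for z w
    using one_minus_mult_bound(1)[of z "cnj w"] that by auto
  have "(A z - H z) + cnj (B w - G w) = 0"
  proof (rule holomorphic_plus_cnj_holomorphic_zero[OF hol _ z w])
    fix z assume z: "cmod z < 1"
    have "A z + cnj (B z) = (1 - z * cnj z) * ((H z + cnj (G z)) / (1 - z * cnj z))"
      using split[OF z z] unfolding diag[OF z] by (rule sym)
    also have "\<dots> = H z + cnj (G z)" unfolding times_divide_eq_right
      using n[OF z z] by (rule nonzero_mult_div_cancel_left)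
    finally show "(A z - H z) + cnj (B z - G z) = 0" by (simp add: algebra_simps)
  qed
  then have "A z + cnj (B w) = H z + cnj (G w)" by (simp add: algebra_simps)
  with split[OF z w] have eq: "(1 - z * cnj w) * (\<integral>x. \<kappa> x * (1 / (1 - z * cnj (v x)) *
      (1 / (1 - v x * cnj w))) \<partial>M) = H z + cnj (G w)"
    by (rule trans)
  show ?thesis unfolding eq[symmetric] by (rule nonzero_mult_div_cancel_left[OF n[OF z w], symmetric])
qed

section \<open>Clark measures tested against Cauchy kernels\<close>

lemma holomorphic2_slices:
  assumes "holomorphic2_on f bidisc" "cmod c < 1"
  shows "(\<lambda>z. f (z, c)) holomorphic_on ball 0 1" "(\<lambda>z. f (c, z)) holomorphic_on ball 0 1"
proof -
  have op: "open bidisc" unfolding bidisc_def by (intro open_Times open_ball)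
  have 1: "\<exists>a b. (f has_derivative (\<lambda>h. a * fst h + b * snd h)) (at z)" if "z \<in> bidisc" for z
    using assms(1) that at_within_open[OF that op] unfolding holomorphic2_on_def by metis
  show "(\<lambda>z. f (z, c)) holomorphic_on ball 0 1"
    unfolding holomorphic_on_def
  proof
    fix z :: complex assume "z \<in> ball 0 1"
    then have "(z, c) \<in> bidisc" using assms(2) by (auto simp: bidisc_def)
    from 1[OF this] obtain a b where f: "(f has_derivative (\<lambda>h. a * fst h + b * snd h)) (at (z, c))" by blast
    have "((\<lambda>z. (z, c)) has_derivative (\<lambda>h. (h, 0))) (at z within ball 0 1)"
      by (intro derivative_intros)
    from has_derivative_compose[OF this f]
    have "((\<lambda>z. f (z, c)) has_field_derivative a) (at z within ball 0 1)"
      by (simp add: has_field_derivative_def)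
    then show "(\<lambda>z. f (z, c)) field_differentiable at z within ball 0 1"
      by (auto simp: field_differentiable_def)
  qed
  show "(\<lambda>z. f (c, z)) holomorphic_on ball 0 1"
    unfolding holomorphic_on_def
  proof
    fix z :: complex assume "z \<in> ball 0 1"
    then have "(c, z) \<in> bidisc" using assms(2) by (auto simp: bidisc_def)
    from 1[OF this] obtain a b where f: "(f has_derivative (\<lambda>h. a * fst h + b * snd h)) (at (c, z))" by blast
    have "((\<lambda>z. (c, z)) has_derivative (\<lambda>h. (0, h))) (at z within ball 0 1)"
      by (intro derivative_intros)
    from has_derivative_compose[OF this f]
    have "((\<lambda>z. f (c, z)) has_field_derivative b) (at z within ball 0 1)"
      by (simp add: has_field_derivative_def)
    then show "(\<lambda>z. f (c, z)) field_differentiable at z within ball 0 1"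
      by (auto simp: field_differentiable_def)
  qed
qed

lemma open_bidisc: "open bidisc"
  unfolding bidisc_def by (intro open_Times open_ball)

lemma space_torus: "sets \<sigma> = sets torus_borel \<Longrightarrow> space \<sigma> = torus"
  using sets_eq_imp_space_eq[of \<sigma> torus_borel] by (simp add: space_restrict_space)

lemma borel_measurable_torus:
  assumes "sets \<sigma> = sets torus_borel" "f \<in> borel_measurable borel"
  shows "f \<in> borel_measurable \<sigma>"
  using measurable_restrict_space1[OF assms(2)] measurable_cong_sets[OF assms(1) refl] by blast

lemma measurable_fst_torus: "sets \<sigma> = sets torus_borel \<Longrightarrow> fst \<in> borel_measurable \<sigma>"
  and measurable_snd_torus: "sets \<sigma> = sets torus_borel \<Longrightarrow> snd \<in> borel_measurable \<sigma>"
  by (auto intro!: borel_measurable_torus borel_measurable_continuous_onI continuous_on_fst continuous_on_snd)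

lemma measurable_cauchy2 [measurable]:
  assumes "sets \<sigma> = sets torus_borel"
  shows "(\<lambda>\<zeta>. cauchy2 \<zeta> w) \<in> borel_measurable \<sigma>" "(\<lambda>\<zeta>. cauchy2 w \<zeta>) \<in> borel_measurable \<sigma>"
  using measurable_fst_torus[OF assms, measurable] measurable_snd_torus[OF assms, measurable]
  unfolding cauchy2_def by measurable

lemma cnj_cauchy2: "cnj (cauchy2 z w) = cauchy2 w z"
  by (simp add: cauchy2_def mult.commute)

lemma norm_cauchy2_le:
  assumes "\<zeta> \<in> torus" "w \<in> bidisc"
  shows "cmod (cauchy2 \<zeta> w) \<le> 1 / (1 - cmod (fst w)) * (1 / (1 - cmod (snd w)))"
proof -
  have "cmod (1 / (1 - fst \<zeta> * cnj (fst w))) \<le> 1 / (1 - cmod (fst w))"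
    using one_minus_mult_bound(2)[of "fst \<zeta>" "cnj (fst w)"] assms by (auto simp: torus_def bidisc_def)
  moreover have "cmod (1 / (1 - snd \<zeta> * cnj (snd w))) \<le> 1 / (1 - cmod (snd w))"
    using one_minus_mult_bound(2)[of "snd \<zeta>" "cnj (snd w)"] assms by (auto simp: torus_def bidisc_def)
  ultimately show ?thesis unfolding cauchy2_def norm_mult
    using assms by (intro mult_mono) (auto simp: bidisc_def)
qed

text \<open>In each coordinate |\<zeta> - z|^2 = (1 - \<zeta> cnj z) (1 - z cnj \<zeta>) when
  |\<zeta>| = 1. This makes the defining property of a Clark measure the diagonal case z = w of an
  identity that can be polarized.\<close>

lemma poisson2_eq_cauchy2:
  assumes "\<zeta> \<in> torus" "z \<in> bidisc"
  shows "of_real (poisson2 z \<zeta>) * cauchy2 z z = cauchy2 \<zeta> z * cauchy2 z \<zeta>"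
proof -
  have *: "of_real ((1 - (cmod z)\<^sup>2) / (cmod (\<zeta> - z))\<^sup>2) * (1 / (1 - z * cnj z)) =
      1 / (1 - \<zeta> * cnj z) * (1 / (1 - z * cnj \<zeta>))" if "cmod \<zeta> = 1" "cmod z < 1" for z \<zeta> :: complex
  proof -
    have zz: "\<zeta> * cnj \<zeta> = 1" using that by (simp add: complex_norm_square[symmetric])
    have "of_real ((cmod (\<zeta> - z))\<^sup>2) = (\<zeta> - z) * cnj (\<zeta> - z)" by (rule complex_norm_square)
    also have "\<dots> = (\<zeta> * cnj \<zeta> - z * cnj \<zeta>) * (\<zeta> * cnj \<zeta> - \<zeta> * cnj z)"
      using zz by (simp add: algebra_simps)
    finally have 1: "of_real ((cmod (\<zeta> - z))\<^sup>2) = (1 - \<zeta> * cnj z) * (1 - z * cnj \<zeta>)"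
      unfolding zz by (simp add: mult.commute)
    have 2: "of_real (1 - (cmod z)\<^sup>2) = 1 - z * cnj z"
      using complex_norm_square[of z] by simp
    have 3: "1 - z * cnj z \<noteq> 0" using one_minus_mult_bound(1)[of z "cnj z"] that by auto
    show ?thesis unfolding of_real_divide 1 2 using 3 by simp
  qed
  have l: "cmod (fst \<zeta>) = 1" "cmod (snd \<zeta>) = 1" "cmod (fst z) < 1" "cmod (snd z) < 1"
    using assms by (auto simp: torus_def bidisc_def)
  have "of_real (poisson2 z \<zeta>) * cauchy2 z z =
      of_real ((1 - (cmod (fst z))\<^sup>2) / (cmod (fst \<zeta> - fst z))\<^sup>2) * (1 / (1 - fst z * cnj (fst z))) *
      (of_real ((1 - (cmod (snd z))\<^sup>2) / (cmod (snd \<zeta> - snd z))\<^sup>2) * (1 / (1 - snd z * cnj (snd z))))"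
    unfolding poisson2_def cauchy2_def of_real_mult by (simp only: mult_ac)
  also have "\<dots> = cauchy2 \<zeta> z * cauchy2 z \<zeta>"
    unfolding *[OF l(1,3)] *[OF l(2,4)] cauchy2_def by (simp only: mult_ac)
  finally show ?thesis .
qed

lemma integrable_finite_bounded:
  fixes f :: "'a \<Rightarrow> complex"
  assumes "finite_measure M" "f \<in> borel_measurable M" "\<And>x. x \<in> space M \<Longrightarrow> cmod (f x) \<le> B"
  shows "integrable M f"
  using assms(3) by (intro finite_measure.integrable_const_bound[OF assms(1) _ assms(2)] AE_I2)

text \<open>With h half of the Cayley transform (\<alpha> + b)/(\<alpha> - b), the Poisson integral
  of \<sigma> is h + cnj h, a holomorphic plus an antiholomorphic function.
  \<open>polarization_disc\<close> is applied twice: in the first coordinate with the second kept on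
  the diagonal, then in the second coordinate with z1 and w1 frozen.\<close>

theorem clark_measure_cauchy:
  assumes b: "holomorphic2_on b bidisc" "b ` bidisc \<subseteq> ball 0 1" and \<alpha>: "\<alpha> \<in> sphere 0 1"
    and \<sigma>: "clark_measure b \<alpha> \<sigma>" and z: "z \<in> bidisc" and w: "w \<in> bidisc"
  shows "(\<integral>\<zeta>. cauchy2 \<zeta> w * cauchy2 z \<zeta> \<partial>\<sigma>) =
    ((\<alpha> + b z) / (\<alpha> - b z) + cnj ((\<alpha> + b w) / (\<alpha> - b w))) / 2 * cauchy2 z w"
proof -
  define h where "h z = (\<alpha> + b z) / (\<alpha> - b z) / 2" for z
  have fin: "finite_measure \<sigma>" and sets: "sets \<sigma> = sets torus_borel" using \<sigma> by (auto simp: clark_measure_def)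
  note [measurable] = measurable_fst_torus[OF sets] measurable_snd_torus[OF sets]
  have sp: "space \<sigma> = torus" by (rule space_torus[OF sets])
  have b1: "cmod (b z) < 1" if "z \<in> bidisc" for z using b(2) that by auto
  have ne: "\<alpha> - b z \<noteq> 0" if "z \<in> bidisc" for z using b1[OF that] \<alpha> by auto
  have hol: "(\<lambda>u. h (u, c)) holomorphic_on ball 0 1" "(\<lambda>u. h (c, u)) holomorphic_on ball 0 1"
    if "cmod c < 1" for c
    unfolding h_def using holomorphic2_slices[OF b(1) that] ne that
    by (auto intro!: holomorphic_intros simp: bidisc_def)
  have diag: "(\<integral>\<zeta>. cauchy2 \<zeta> z * cauchy2 z \<zeta> \<partial>\<sigma>) = (h z + cnj (h z)) * cauchy2 z z" if z: "z \<in> bidisc" for z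
  proof -
    have "(\<integral>\<zeta>. cauchy2 \<zeta> z * cauchy2 z \<zeta> \<partial>\<sigma>) = (\<integral>\<zeta>. of_real (poisson2 z \<zeta>) * cauchy2 z z \<partial>\<sigma>)"
      using poisson2_eq_cauchy2[OF _ z] by (intro Bochner_Integration.integral_cong) (auto simp: sp)
    also have "\<dots> = of_real (\<integral>\<zeta>. poisson2 z \<zeta> \<partial>\<sigma>) * cauchy2 z z" by simp
    also have "(\<integral>\<zeta>. poisson2 z \<zeta> \<partial>\<sigma>) = (1 - (cmod (b z))\<^sup>2) / (cmod (\<alpha> - b z))\<^sup>2"
      using \<sigma> z by (auto simp: clark_measure_def)
    also have "of_real \<dots> = h z + cnj (h z)"
    proof -
      have a: "\<alpha> * cnj \<alpha> = 1" using \<alpha> by (simp add: complex_norm_square[symmetric])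
      have n: "\<alpha> - b z \<noteq> 0" "cnj \<alpha> - cnj (b z) \<noteq> 0" using ne[OF z] by (auto simp flip: complex_cnj_diff)
      have "h z + cnj (h z) = ((\<alpha> + b z) * (cnj \<alpha> - cnj (b z)) + (cnj \<alpha> + cnj (b z)) * (\<alpha> - b z))
          / (2 * ((\<alpha> - b z) * (cnj \<alpha> - cnj (b z))))"
        unfolding h_def complex_cnj_divide complex_cnj_add complex_cnj_diff complex_cnj_numeral
          add_divide_distrib[symmetric] add_frac_eq[OF n] by simp
      also have "(\<alpha> + b z) * (cnj \<alpha> - cnj (b z)) + (cnj \<alpha> + cnj (b z)) * (\<alpha> - b z) =
          2 * (\<alpha> * cnj \<alpha>) - 2 * (b z * cnj (b z))" by (simp add: algebra_simps)
      also have "\<dots> = 2 * of_real (1 - (cmod (b z))\<^sup>2)" unfolding a using complex_norm_square[of "b z"] by simp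
      also have "(\<alpha> - b z) * (cnj \<alpha> - cnj (b z)) = of_real ((cmod (\<alpha> - b z))\<^sup>2)"
        using complex_norm_square[of "\<alpha> - b z"] by simp
      finally have eq: "h z + cnj (h z) = 2 * of_real (1 -
          (cmod (b z))\<^sup>2) / (2 * of_real ((cmod (\<alpha> - b z))\<^sup>2))" .
      show ?thesis unfolding eq of_real_divide by (rule mult_divide_mult_cancel_left[symmetric]) simp
    qed
    finally show ?thesis .
  qed
  obtain z1 z2 w1 w2 where zw: "z = (z1, z2)" "w = (w1, w2)" by (cases z, cases w)
  have l: "cmod z1 < 1" "cmod z2 < 1" "cmod w1 < 1" "cmod w2 < 1"
    using z w by (auto simp: zw bidisc_def)
  have t1: "cmod (fst x) = 1" "cmod (snd x) = 1" if "x \<in> space \<sigma>" for x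
    using that by (auto simp: sp torus_def)
  have bnd: "cmod (1 / (1 - u * cnj x) * (1 / (1 - x * cnj v))) \<le> 1 / (1 - cmod u) * (1 / (1 - cmod v))"
    if "cmod u < 1" "cmod v < 1" "cmod x = 1" for u v x
    unfolding norm_mult using one_minus_mult_bound(2)[of "cnj x" u] one_minus_mult_bound(2)[of x "cnj v"] that
    by (intro mult_mono) (auto simp: mult.commute)
  have step1: "(\<integral>\<zeta>. cauchy2 \<zeta> (v, c) * cauchy2 (u, c) \<zeta> \<partial>\<sigma>) =
      (h (u, c) + cnj (h (v, c))) * cauchy2 (u, c) (v, c)"
    if u: "cmod u < 1" and v: "cmod v < 1" and c: "cmod c < 1" for u v c
  proof -
    define C where "C = 1 / (1 - c * cnj c)"
    have C: "cnj C = C" unfolding C_def by (simp add: mult.commute)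
    define \<kappa> where "\<kappa> \<zeta> = 1 / (1 - c * cnj (snd \<zeta>)) * (1 / (1 - snd \<zeta> * cnj c))" for \<zeta> :: "complex \<times> complex"
    have \<kappa>: "integrable \<sigma> \<kappa>"
    proof (rule integrable_finite_bounded[OF fin])
      show "\<kappa> \<in> borel_measurable \<sigma>" unfolding \<kappa>_def by measurable
    qed (unfold \<kappa>_def, rule bnd[OF c c t1(2)])
    have eq: "\<kappa> \<zeta> * (1 / (1 - u * cnj (fst \<zeta>)) * (1 / (1 - fst \<zeta> * cnj v))) =
        cauchy2 \<zeta> (v, c) * cauchy2 (u, c) \<zeta>" for \<zeta> u v
      by (simp add: \<kappa>_def cauchy2_def mult_ac)
    have "(\<integral>\<zeta>. \<kappa> \<zeta> * (1 / (1 - u * cnj (fst \<zeta>)) * (1 / (1 - fst \<zeta> * cnj v))) \<partial>\<sigma>) =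
        (h (u, c) * C + cnj (h (v, c) * C)) / (1 - u * cnj v)"
    proof (rule polarization_disc[OF \<kappa> _ _ _ _ _ u v])
      show "(\<lambda>u. h (u, c) * C) holomorphic_on ball 0 1"
        by (intro holomorphic_on_mult hol(1)[OF c] holomorphic_on_const)
      then show "(\<lambda>u. h (u, c) * C) holomorphic_on ball 0 1" .
      fix u :: complex assume "cmod u < 1"
      then have "(u, c) \<in> bidisc" using c by (auto simp: bidisc_def)
      from diag[OF this] show "(\<integral>\<zeta>. \<kappa> \<zeta> * (1 / (1 - u * cnj (fst \<zeta>)) * (1 / (1 - fst \<zeta> * cnj u))) \<partial>\<sigma>) =
          (h (u, c) * C + cnj (h (u, c) * C)) / (1 - u * cnj u)"
        unfolding eq by (simp add: C cauchy2_def C_def[symmetric] algebra_simps add_divide_distrib)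
    qed (use t1 in auto)
    then show ?thesis unfolding eq
      by (simp add: C cauchy2_def C_def[symmetric] algebra_simps add_divide_distrib)
  qed
  have "(\<integral>\<zeta>. cauchy2 \<zeta> (w1, w2) * cauchy2 (z1, z2) \<zeta> \<partial>\<sigma>) =
      (h (z1, z2) + cnj (h (w1, w2))) * cauchy2 (z1, z2) (w1, w2)"
  proof -
    \<comment> \<open>Off the diagonal this factor is no longer real, so the function under the
      conjugation has to carry \<open>cnj C\<close>.\<close>
    define C where "C = 1 / (1 - z1 * cnj w1)"
    define \<kappa> where "\<kappa> \<zeta> = 1 / (1 - z1 * cnj (fst \<zeta>)) * (1 / (1 - fst \<zeta> * cnj w1))"
        for \<zeta> :: "complex \<times> complex"
    have \<kappa>: "integrable \<sigma> \<kappa>"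
    proof (rule integrable_finite_bounded[OF fin])
      show "\<kappa> \<in> borel_measurable \<sigma>" unfolding \<kappa>_def by measurable
    qed (unfold \<kappa>_def, rule bnd[OF l(1,3) t1(1)])
    have eq: "\<kappa> \<zeta> * (1 / (1 - u * cnj (snd \<zeta>)) * (1 / (1 - snd \<zeta> * cnj v))) =
        cauchy2 \<zeta> (w1, v) * cauchy2 (z1, u) \<zeta>" for \<zeta> u v
      by (simp add: \<kappa>_def cauchy2_def mult_ac)
    have "(\<integral>\<zeta>. \<kappa> \<zeta> * (1 / (1 - z2 * cnj (snd \<zeta>)) * (1 / (1 - snd \<zeta> * cnj w2))) \<partial>\<sigma>) =
        (h (z1, z2) * C + cnj (h (w1, w2) * cnj C)) / (1 - z2 * cnj w2)"
    proof (rule polarization_disc[OF \<kappa> _ _ _ _ _ l(2,4)])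
      show "(\<lambda>u. h (z1, u) * C) holomorphic_on ball 0 1"
        by (intro holomorphic_on_mult hol(2)[OF l(1)] holomorphic_on_const)
      show "(\<lambda>u. h (w1, u) * cnj C) holomorphic_on ball 0 1"
        by (intro holomorphic_on_mult hol(2)[OF l(3)] holomorphic_on_const)
      fix c :: complex assume "cmod c < 1"
      from step1[OF l(1,3) this] show "(\<integral>\<zeta>. \<kappa> \<zeta> * (1 / (1 - c * cnj (snd \<zeta>)) *
          (1 / (1 - snd \<zeta> * cnj c))) \<partial>\<sigma>) = (h (z1, c) * C + cnj (h (w1, c) * cnj C)) / (1 - c * cnj c)"
        unfolding eq by (simp add: cauchy2_def C_def[symmetric] algebra_simps add_divide_distrib)
    qed (use t1 in auto)
    then show ?thesis unfolding eq
      by (simp add: cauchy2_def C_def[symmetric] algebra_simps add_divide_distrib)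
  qed
  then show ?thesis unfolding zw h_def by (simp add: add_divide_distrib)
qed

text \<open>The two outer factors clear the denominators of the Cayley transforms, because (\<alpha>
  + b(z)) cnj (\<alpha> - b(w)) + cnj (\<alpha> + b(w)) (\<alpha> - b(z)) = 2 (1 - b(z) cnj
  (b(w))).\<close>

theorem clark_measure_kernel:
  assumes b: "holomorphic2_on b bidisc" "b ` bidisc \<subseteq> ball 0 1" and \<alpha>: "\<alpha> \<in> sphere 0 1"
    and \<sigma>: "clark_measure b \<alpha> \<sigma>" and z: "z \<in> bidisc" and w: "w \<in> bidisc"
  shows "(1 - cnj \<alpha> * b z) * (1 - \<alpha> * cnj (b w)) * (\<integral>\<zeta>. cauchy2 \<zeta> w * cauchy2 z \<zeta> \<partial>\<sigma>) = dbr_kernel b z w"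
proof -
  have a: "\<alpha> * cnj \<alpha> = 1" using \<alpha> by (simp add: complex_norm_square[symmetric])
  have ne: "\<alpha> - b z \<noteq> 0" if "z \<in> bidisc" for z using b that \<alpha> by auto
  have n: "\<alpha> - b z \<noteq> 0" "cnj \<alpha> - cnj (b w) \<noteq> 0" using ne[OF z] ne[OF w] by (auto simp flip: complex_cnj_diff)
  have cancel: "c * p * (a * q) * (x / (p * q) / 2) =
      a * c * x / 2" if "p \<noteq> 0" "q \<noteq> 0" for a c p q x :: complex
    using that by simp
  have e: "1 - cnj \<alpha> * b z = cnj \<alpha> * (\<alpha> - b z)" "1 - \<alpha> * cnj (b w) = \<alpha> * (cnj \<alpha> - cnj (b w))"
    using a by (simp_all add: algebra_simps)
  have "(1 - cnj \<alpha> * b z) * (1 - \<alpha> * cnj (b w)) * (((\<alpha> + b z) / (\<alpha> - b z) + cnj ((\<alpha> +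
      b w) / (\<alpha> - b w))) / 2) =
     (\<alpha> * cnj \<alpha>) * ((\<alpha> + b z) * (cnj \<alpha> - cnj (b w)) + (cnj \<alpha> + cnj (b w)) * (\<alpha> - b z)) / 2"
    unfolding e complex_cnj_divide complex_cnj_add complex_cnj_diff add_frac_eq[OF n] by (rule cancel[OF n])
  also have "(\<alpha> + b z) * (cnj \<alpha> - cnj (b w)) + (cnj \<alpha> + cnj (b w)) * (\<alpha> - b z) =
      2 * (\<alpha> * cnj \<alpha>) - 2 * (b z * cnj (b w))" by (simp add: algebra_simps)
  also have "\<alpha> * cnj \<alpha> * (2 * (\<alpha> * cnj \<alpha>) - 2 * (b z * cnj (b w))) / 2 = 1 - b z * cnj (b w)"
    unfolding a by simp
  finally show ?thesis
    unfolding clark_measure_cauchy[OF assms] dbr_kernel_def by (simp flip: mult.assoc)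
qed

section \<open>The space H(b) as a weighted Cauchy transform\<close>

text \<open>The graph of the isometry \<open>C(\<cdot>, w) \<mapsto> k\<^sub>b(\<cdot>, w) / (1 - \<alpha> cnj (b w))\<close>
  from the span of the Cauchy kernels in \<open>L\<^sup>2(\<sigma>)\<close> onto the span of the reproducing kernels.\<close>

inductive_set clark_pairs ::
  "(complex \<times> complex \<Rightarrow> complex) \<Rightarrow> complex \<Rightarrow>
    ((complex \<times> complex \<Rightarrow> complex) \<times> (complex \<times> complex \<Rightarrow> complex)) set"
  for b \<alpha> where
  zero: "(\<lambda>\<zeta>. 0, \<lambda>z. 0) \<in> clark_pairs b \<alpha>"
| step: "\<lbrakk>(g, G) \<in> clark_pairs b \<alpha>; w \<in> bidisc\<rbrakk> \<Longrightarrow>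
    (\<lambda>\<zeta>. g \<zeta> + c * cauchy2 \<zeta> w,
     \<lambda>z. G z + c * (1 / (1 - \<alpha> * cnj (b w)) * zero_extend bidisc (\<lambda>z. dbr_kernel b z w) z)) \<in> clark_pairs b \<alpha>"

locale clark =
  fixes b :: "complex \<times> complex \<Rightarrow> complex" and \<alpha> :: complex
    and \<sigma> :: "(complex \<times> complex) measure"
  assumes holomorphic: "holomorphic2_on b bidisc" and into_disc: "b ` bidisc \<subseteq> ball 0 1"
    and unimodular: "\<alpha> \<in> sphere 0 1" and clark_measure: "clark_measure b \<alpha> \<sigma>"
begin

lemma finite: "finite_measure \<sigma>" and sets: "sets \<sigma> = sets torus_borel"
  using clark_measure by (auto simp: clark_measure_def)

lemma space: "space \<sigma> = torus"
  by (rule space_torus[OF sets])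

end

locale clark_dbr = clark b \<alpha> \<sigma> for b \<alpha> \<sigma> +
  fixes H :: "(complex \<times> complex \<Rightarrow> complex) set"
    and ip :: "(complex \<times> complex \<Rightarrow> complex) \<Rightarrow> (complex \<times> complex \<Rightarrow> complex) \<Rightarrow> complex"
  assumes dbr: "de_branges_rovnyak b H ip"
begin

lemma rkhs: "rkhs bidisc (dbr_kernel b) H ip"
  using dbr by (simp add: de_branges_rovnyak_def)

sublocale H: semi_inner_product H ip
  by (rule rkhs_semi_inner_product[OF rkhs])

sublocale L2: semi_inner_product "square_integrable \<sigma>" "\<lambda>f g. \<integral>x. f x * cnj (g x) \<partial>\<sigma>"
  by (rule L2_semi_inner_product)

lemma cauchy2_mem: "w \<in> bidisc \<Longrightarrow> (\<lambda>\<zeta>. cauchy2 \<zeta> w) \<in> square_integrable \<sigma>"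
  by (rule square_integrable_bounded[OF finite measurable_cauchy2(1)[OF sets]])
    (rule norm_cauchy2_le, simp_all add: space)

text \<open>The partner of the Cauchy kernel C(\<cdot>, w) under the isometry. Pairing with it is
  evaluation at w up to the nonzero factor 1 - cnj \<alpha> b(w).\<close>

definition e :: "complex \<times> complex \<Rightarrow> complex \<times> complex \<Rightarrow> complex" where
  "e w z = 1 / (1 - \<alpha> * cnj (b w)) * zero_extend bidisc (\<lambda>z. dbr_kernel b z w) z"

lemma kernel_mem: "w \<in> bidisc \<Longrightarrow> zero_extend bidisc (\<lambda>z. dbr_kernel b z w) \<in> H"
  by (rule rkhs.kernel_mem[OF rkhs])

lemma e_mem: "w \<in> bidisc \<Longrightarrow> e w \<in> H"
  using H.scale_mem[OF kernel_mem, of w "1 / (1 - \<alpha> * cnj (b w))"] by (simp add: e_def[abs_def])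

lemma one_minus_nonzero: "w \<in> bidisc \<Longrightarrow> 1 - cnj \<alpha> * b w \<noteq> 0" "w \<in> bidisc \<Longrightarrow> 1 - \<alpha> * cnj (b w) \<noteq> 0"
proof -
  assume "w \<in> bidisc"
  then have "cmod (b w) < 1" using into_disc by auto
  then show "1 - cnj \<alpha> * b w \<noteq> 0" "1 - \<alpha> * cnj (b w) \<noteq> 0"
    using one_minus_mult_bound(1)[of "cnj \<alpha>" "b w"] one_minus_mult_bound(1)[of \<alpha> "cnj (b w)"] unimodular
        by auto
qed

lemma ip_e: "\<lbrakk>G \<in> H; z \<in> bidisc\<rbrakk> \<Longrightarrow> G z = (1 - cnj \<alpha> * b z) * ip G (e z)"
proof -
  assume G: "G \<in> H" and z: "z \<in> bidisc"
  have "ip G (e z) = cnj (1 / (1 - \<alpha> * cnj (b z))) * ip G (zero_extend bidisc (\<lambda>u. dbr_kernel b u z))"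
    unfolding e_def[abs_def] by (rule H.ip_scale_right[OF kernel_mem[OF z] G])
  also have "ip G (zero_extend bidisc (\<lambda>u. dbr_kernel b u z)) = G z"
    by (rule rkhs.reproducing[OF rkhs G z])
  finally show ?thesis using one_minus_nonzero[OF z] by simp
qed

lemma clark_pairs_mem:
  "(g, G) \<in> clark_pairs b \<alpha> \<Longrightarrow> g \<in> square_integrable \<sigma> \<and> G \<in> H"
proof (induction rule: clark_pairs.induct)
  case (step g G w c)
  then show ?case
    using L2.add_mem[OF _ L2.scale_mem[OF cauchy2_mem]] H.add_mem[OF _ H.scale_mem[OF e_mem]]
    unfolding e_def by blast
qed (auto simp: L2.zero_mem H.zero_mem)

text \<open>This is \<open>clark_measure_kernel\<close> read as an equality of Gram matrices: of the
  \<open>e w\<close> in H(b), and of the Cauchy kernels in L^2(\<sigma>).\<close>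

lemma ip_e_e: "\<lbrakk>w \<in> bidisc; z \<in> bidisc\<rbrakk> \<Longrightarrow> ip (e w) (e z) = (\<integral>\<zeta>. cauchy2 \<zeta> w * cnj (cauchy2 \<zeta> z) \<partial>\<sigma>)"
proof -
  assume w: "w \<in> bidisc" and z: "z \<in> bidisc"
  have "(1 - cnj \<alpha> * b z) * ip (e w) (e z) = 1 / (1 - \<alpha> * cnj (b w)) * dbr_kernel b z w"
    using ip_e[OF e_mem[OF w] z] z unfolding e_def by (simp add: zero_extend_def)
  also have "\<dots> = (1 - cnj \<alpha> * b z) * (\<integral>\<zeta>. cauchy2 \<zeta> w * cauchy2 z \<zeta> \<partial>\<sigma>)"
    unfolding clark_measure_kernel[OF holomorphic into_disc unimodular clark_measure z w, symmetric]
    using one_minus_nonzero(2)[OF w] by simp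
  finally show ?thesis using one_minus_nonzero(1)[OF z] by (simp add: cnj_cauchy2)
qed

lemma clark_pairs_ip_e:
  "(g, G) \<in> clark_pairs b \<alpha> \<Longrightarrow> z \<in> bidisc \<Longrightarrow> ip G (e z) = (\<integral>\<zeta>. g \<zeta> * cnj (cauchy2 \<zeta> z) \<partial>\<sigma>)"
proof (induction rule: clark_pairs.induct)
  case zero
  show ?case using H.ip_scale[OF H.zero_mem e_mem[OF zero], of 0] by simp
next
  case (step g G w c)
  note m = clark_pairs_mem[OF step.hyps(1)]
  have "ip (\<lambda>z. G z + c * e w z) (e z) = ip G (e z) + c * ip (e w) (e z)"
    using m H.ip_add[OF _ H.scale_mem[OF e_mem[OF step.hyps(2)]] e_mem[OF step.prems], of G c]
      H.ip_scale[OF e_mem[OF step.hyps(2)] e_mem[OF step.prems]] by simp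
  also have "\<dots> = (\<integral>\<zeta>. g \<zeta> * cnj (cauchy2 \<zeta> z) \<partial>\<sigma>) + c * (\<integral>\<zeta>. cauchy2 \<zeta> w * cnj (cauchy2 \<zeta> z) \<partial>\<sigma>)"
    using step ip_e_e by simp
  also have "\<dots> = (\<integral>\<zeta>. (g \<zeta> + c * cauchy2 \<zeta> w) * cnj (cauchy2 \<zeta> z) \<partial>\<sigma>)"
    using m L2.ip_add[OF _ L2.scale_mem[OF cauchy2_mem[OF step.hyps(2)]] cauchy2_mem[OF step.prems], of g c]
      L2.ip_scale[OF cauchy2_mem[OF step.hyps(2)] cauchy2_mem[OF step.prems]] by simp
  finally show ?case unfolding e_def .
qed

text \<open>Induction over the pair (g', G') reduces the claim to pairings with a single kernel,
  which \<open>clark_pairs_ip_e\<close> settles. Distances agree on both sides of the graph, so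
  Cauchy sequences can be transferred in either direction.\<close>

lemma clark_pairs_ip:
  "(g', G') \<in> clark_pairs b \<alpha> \<Longrightarrow> (g, G) \<in> clark_pairs b \<alpha> \<Longrightarrow> ip G G' = (\<integral>\<zeta>. g \<zeta> * cnj (g' \<zeta>) \<partial>\<sigma>)"
proof (induction rule: clark_pairs.induct)
  case zero
  then have "G \<in> H" using clark_pairs_mem by blast
  then show ?case using H.ip_scale_right[OF H.zero_mem, of G 0] by simp
next
  case (step g' G' w c)
  note m = clark_pairs_mem[OF step.hyps(1)] clark_pairs_mem[OF step.prems]
  have "ip G (\<lambda>z. G' z + c * e w z) = ip G G' + cnj c * ip G (e w)"
    using m H.ip_add_right[OF _ H.scale_mem[OF e_mem[OF step.hyps(2)]], of G' G c]
      H.ip_scale_right[OF e_mem[OF step.hyps(2)], of G] by simp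
  also have "\<dots> = (\<integral>\<zeta>. g \<zeta> * cnj (g' \<zeta>) \<partial>\<sigma>) + cnj c * (\<integral>\<zeta>. g \<zeta> * cnj (cauchy2 \<zeta> w) \<partial>\<sigma>)"
    using step clark_pairs_ip_e by simp
  also have "\<dots> = (\<integral>\<zeta>. g \<zeta> * cnj (g' \<zeta> + c * cauchy2 \<zeta> w) \<partial>\<sigma>)"
    using m L2.ip_add_right[OF _ L2.scale_mem[OF cauchy2_mem[OF step.hyps(2)]], of g' g c]
      L2.ip_scale_right[OF cauchy2_mem[OF step.hyps(2)], of g c] by simp
  finally show ?case unfolding e_def .
qed

lemma clark_pairs_scale:
  "(g, G) \<in> clark_pairs b \<alpha> \<Longrightarrow> (\<lambda>\<zeta>. a * g \<zeta>, \<lambda>z. a * G z) \<in> clark_pairs b \<alpha>"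
proof (induction rule: clark_pairs.induct)
  case zero
  then show ?case using clark_pairs.zero by simp
next
  case (step g G w c)
  from clark_pairs.step[OF step.IH step.hyps(2), of "a * c"] show ?case
    by (simp only: distrib_left mult.assoc)
qed

lemma clark_pairs_add:
  "(g', G') \<in> clark_pairs b \<alpha> \<Longrightarrow> (g, G) \<in> clark_pairs b \<alpha> \<Longrightarrow>
    (\<lambda>\<zeta>. g \<zeta> + g' \<zeta>, \<lambda>z. G z + G' z) \<in> clark_pairs b \<alpha>"
proof (induction rule: clark_pairs.induct)
  case zero
  then show ?case by simp
next
  case (step g' G' w c)
  from clark_pairs.step[OF step.IH[OF step.prems] step.hyps(2), of c] show ?case
    by (simp only: add.assoc)
qed

lemma clark_pairs_diff:
  assumes "(g, G) \<in> clark_pairs b \<alpha>" "(g', G') \<in> clark_pairs b \<alpha>"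
  shows "(\<lambda>\<zeta>. g \<zeta> - g' \<zeta>, \<lambda>z. G z - G' z) \<in> clark_pairs b \<alpha>"
  using clark_pairs_add[OF clark_pairs_scale[OF assms(2), of "-1"] assms(1)] by simp

lemma clark_pairs_isometry:
  assumes "(g, G) \<in> clark_pairs b \<alpha>" "(g', G') \<in> clark_pairs b \<alpha>"
  shows "ip (\<lambda>z. G z - G' z) (\<lambda>z. G z - G' z) = (\<integral>\<zeta>. (g \<zeta> - g' \<zeta>) * cnj (g \<zeta> - g' \<zeta>) \<partial>\<sigma>)"
  using clark_pairs_ip[OF clark_pairs_diff clark_pairs_diff, OF assms assms] .

lemma clark_pairs_cauchy2: "w \<in> bidisc \<Longrightarrow> (\<lambda>\<zeta>. cauchy2 \<zeta> w, e w) \<in> clark_pairs b \<alpha>"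
  using clark_pairs.step[OF clark_pairs.zero, where c=1] by (simp add: e_def[abs_def])

text \<open>A minimizing sequence approximates \<phi> from the span of the Cauchy kernels, and its
  partners converge in H by completeness. The approximants tend to the projection of \<phi> rather
  than to \<phi> itself, but the residual is asymptotically orthogonal to every Cauchy kernel, and
  the transform sees nothing else.\<close>

theorem weighted_cauchy_transform_mem:
  assumes \<phi>: "\<phi> \<in> square_integrable \<sigma>"
  shows "zero_extend bidisc (\<lambda>z. (1 - cnj \<alpha> * b z) * (\<integral>\<zeta>. \<phi> \<zeta> * cnj (cauchy2 \<zeta> z) \<partial>\<sigma>)) \<in> H"
proof -
  let ?P = "fst ` clark_pairs b \<alpha>"
  obtain p where p: "\<And>n::nat. p n \<in> ?P"
    and cau: "\<And>m n. Re (\<integral>x. (p m x - p n x) * cnj (p m x - p n x) \<partial>\<sigma>) \<le> 2 / Suc m + 2 / Suc n"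
    and orth: "\<And>q. q \<in> ?P \<Longrightarrow> (\<lambda>n. \<integral>x. (\<phi> x - p n x) * cnj (q x) \<partial>\<sigma>) \<longlonglongrightarrow> 0"
  proof (rule L2.minimizing_sequence[OF _ _ _ _ \<phi>, of ?P])
    show "?P \<subseteq> square_integrable \<sigma>" using clark_pairs_mem by auto
    show "(\<lambda>z. 0) \<in> ?P" using clark_pairs.zero by force
    show "(\<lambda>z. f z + g z) \<in> ?P" if "f \<in> ?P" "g \<in> ?P" for f g
      using that clark_pairs_add by force
    show "(\<lambda>z. c * f z) \<in> ?P" if "f \<in> ?P" for c f
      using that clark_pairs_scale by force
  qed blast
  have "\<exists>G. (p n, G) \<in> clark_pairs b \<alpha>" for n using p[of n] by auto
  then obtain G where G: "\<And>n. (p n, G n) \<in> clark_pairs b \<alpha>" by metis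
  have GH: "G n \<in> H" for n using clark_pairs_mem[OF G] by blast
  have dist: "Re (ip (\<lambda>z. G m z - G n z) (\<lambda>z. G m z - G n z)) \<le> 2 / Suc m + 2 / Suc n" for m n
    unfolding clark_pairs_isometry[OF G G] by (rule cau)
  have "\<forall>\<epsilon>>0. \<exists>N. \<forall>m\<ge>N. \<forall>n\<ge>N. sqrt (Re (ip (\<lambda>z. G m z - G n z) (\<lambda>z. G m z - G n z))) < \<epsilon>"
  proof (intro allI impI)
    fix \<epsilon> :: real assume \<epsilon>: "\<epsilon> > 0"
    then have "\<epsilon>\<^sup>2 / 4 > 0" by simp
    then obtain N where N: "inverse (real (Suc N)) < \<epsilon>\<^sup>2 / 4" using reals_Archimedean by blast
    show "\<exists>N. \<forall>m\<ge>N. \<forall>n\<ge>N. sqrt (Re (ip (\<lambda>z. G m z - G n z) (\<lambda>z. G m z - G n z))) < \<epsilon>"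
    proof (intro exI[of _ N] allI impI)
      fix m n assume mn: "N \<le> m" "N \<le> n"
      have i: "inverse (real (Suc k)) \<le> inverse (real (Suc N))" if "N \<le> k" for k
        using that by (intro le_imp_inverse_le) auto
      have "Re (ip (\<lambda>z. G m z - G n z) (\<lambda>z. G m z - G n z)) \<le>
          2 * inverse (real (Suc m)) + 2 * inverse (real (Suc n))"
        using dist[of m n] by (simp add: divide_inverse)
      then have "Re (ip (\<lambda>z. G m z - G n z) (\<lambda>z. G m z - G n z)) < \<epsilon>\<^sup>2"
        using i[OF mn(1)] i[OF mn(2)] N by linarith
      then show "sqrt (Re (ip (\<lambda>z. G m z - G n z) (\<lambda>z. G m z - G n z))) < \<epsilon>"
        using \<epsilon> by (intro real_less_lsqrt) auto
    qed
  qed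
  with rkhs.complete[OF rkhs, of G] GH obtain F where F: "F \<in> H"
    and lim: "(\<lambda>n. sqrt (Re (ip (\<lambda>z. G n z - F z) (\<lambda>z. G n z - F z)))) \<longlonglongrightarrow> 0" by blast
  have "F z = (1 - cnj \<alpha> * b z) * (\<integral>\<zeta>. \<phi> \<zeta> * cnj (cauchy2 \<zeta> z) \<partial>\<sigma>)" if z: "z \<in> bidisc" for z
  proof -
    have 1: "(\<lambda>n. ip (\<lambda>z. G n z - F z) (e z)) \<longlonglongrightarrow> 0"
    proof (rule Lim_null_comparison)
      show "(\<lambda>n. sqrt (Re (ip (\<lambda>z. G n z - F z) (\<lambda>z. G n z - F z))) * sqrt (Re (ip (e z) (e z)))) \<longlonglongrightarrow> 0"
        using tendsto_mult_right[OF lim] by simp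
      have "cmod (ip (\<lambda>z. G n z - F z) (e z)) \<le>
          sqrt (Re (ip (\<lambda>z. G n z - F z) (\<lambda>z. G n z - F z)) * Re (ip (e z) (e z)))" for n
        using H.cauchy_schwarz[OF H.diff_mem[OF GH F] e_mem[OF z]] by (rule real_le_rsqrt)
      then show "\<forall>\<^sub>F n in sequentially. cmod (ip (\<lambda>z. G n z - F z) (e z)) \<le>
         sqrt (Re (ip (\<lambda>z. G n z - F z) (\<lambda>z. G n z - F z))) * sqrt (Re (ip (e z) (e z)))"
        by (simp add: real_sqrt_mult)
    qed
    have 2: "(\<lambda>n. \<integral>x. (\<phi> x - p n x) * cnj (cauchy2 x z) \<partial>\<sigma>) \<longlonglongrightarrow> 0"
      using clark_pairs_cauchy2[OF z] by (intro orth) force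
    \<comment> \<open>The sum of the two null sequences does not depend on n, since pairing
      \<open>G n\<close> with \<open>e z\<close> equals pairing \<open>p n\<close> with the Cauchy
      kernel at z. So this constant is 0.\<close>
    have 3: "ip (\<lambda>z. G n z - F z) (e z) + (\<integral>x. (\<phi> x - p n x) * cnj (cauchy2 x z) \<partial>\<sigma>) =
        (\<integral>x. \<phi> x * cnj (cauchy2 x z) \<partial>\<sigma>) - ip F (e z)" for n
      using H.ip_diff[OF GH F e_mem[OF z], of n] clark_pairs_ip_e[OF G[of n] z]
        L2.ip_diff[OF \<phi> conjunct1[OF clark_pairs_mem[OF G[of n]]] cauchy2_mem[OF z]] by simp
    have "(\<lambda>n. (\<integral>x. \<phi> x * cnj (cauchy2 x z) \<partial>\<sigma>) - ip F (e z)) \<longlonglongrightarrow> 0"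
      using tendsto_add[OF 1 2] unfolding 3 by simp
    then have "ip F (e z) = (\<integral>x. \<phi> x * cnj (cauchy2 x z) \<partial>\<sigma>)" by (simp add: LIMSEQ_const_iff)
    then show ?thesis using ip_e[OF F z] by simp
  qed
  then have "zero_extend bidisc (\<lambda>z. (1 - cnj \<alpha> * b z) * (\<integral>\<zeta>. \<phi> \<zeta> * cnj (cauchy2 \<zeta> z) \<partial>\<sigma>)) = F"
    using rkhs.vanish_outside[OF rkhs F] by (auto simp: zero_extend_def)
  with F show ?thesis by simp
qed

text \<open>The mirror image of \<open>weighted_cauchy_transform_mem\<close>: F is approximated from
  the span of the reproducing kernels, and completeness of L^2(\<sigma>) supplies f as the limit of
  the partners. Pairing with \<open>e z\<close> is point evaluation up to a factor, so asymptotic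
  orthogonality recovers every value of F.\<close>

theorem weighted_cauchy_transform_surj:
  assumes F: "F \<in> H"
  obtains f where "f \<in> square_integrable \<sigma>"
    "\<And>z. z \<in> bidisc \<Longrightarrow> F z = (1 - cnj \<alpha> * b z) * (\<integral>\<zeta>. f \<zeta> * cnj (cauchy2 \<zeta> z) \<partial>\<sigma>)"
proof -
  let ?P = "snd ` clark_pairs b \<alpha>"
  obtain G where p: "\<And>n::nat. G n \<in> ?P"
    and cau: "\<And>m n. Re (ip (\<lambda>x. G m x - G n x) (\<lambda>x. G m x - G n x)) \<le> 2 / Suc m + 2 / Suc n"
    and orth: "\<And>q. q \<in> ?P \<Longrightarrow> (\<lambda>n. ip (\<lambda>x. F x - G n x) q) \<longlonglongrightarrow> 0"
  proof (rule H.minimizing_sequence[OF _ _ _ _ F, of ?P])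
    show "?P \<subseteq> H" using clark_pairs_mem by auto
    show "(\<lambda>z. 0) \<in> ?P" using clark_pairs.zero by force
    show "(\<lambda>z. f z + g z) \<in> ?P" if "f \<in> ?P" "g \<in> ?P" for f g
      using that clark_pairs_add by force
    show "(\<lambda>z. c * f z) \<in> ?P" if "f \<in> ?P" for c f
      using that clark_pairs_scale by force
  qed blast
  have "\<exists>g. (g, G n) \<in> clark_pairs b \<alpha>" for n using p[of n] by auto
  then obtain g where G: "\<And>n. (g n, G n) \<in> clark_pairs b \<alpha>" by metis
  have GH: "G n \<in> H" and gL: "g n \<in> square_integrable \<sigma>" for n using clark_pairs_mem[OF G] by blast+
  have "(\<integral>x. (cmod (g m x - g n x))\<^sup>2 \<partial>\<sigma>) \<le> 2 / Suc m + 2 / Suc n" for m n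
    using cau[of m n] unfolding clark_pairs_isometry[OF G G] L2_self .
  from L2_complete[OF finite gL this] obtain f where f: "f \<in> square_integrable \<sigma>"
    and lim: "(\<lambda>n. \<integral>x. (cmod (g n x - f x))\<^sup>2 \<partial>\<sigma>) \<longlonglongrightarrow> 0" by blast
  have "F z = (1 - cnj \<alpha> * b z) * (\<integral>\<zeta>. f \<zeta> * cnj (cauchy2 \<zeta> z) \<partial>\<sigma>)" if z: "z \<in> bidisc" for z
  proof -
    have "(\<lambda>n. sqrt ((\<integral>x. (cmod (g n x - f x))\<^sup>2 \<partial>\<sigma>) * (\<integral>x. (cmod (cauchy2 x z))\<^sup>2 \<partial>\<sigma>))) \<longlonglongrightarrow> 0"
      using tendsto_real_sqrt[OF tendsto_mult_right[OF lim]] by simp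
    then have 1: "(\<lambda>n. \<integral>x. (g n x - f x) * cnj (cauchy2 x z) \<partial>\<sigma>) \<longlonglongrightarrow> 0"
    proof (rule Lim_null_comparison[rotated])
      have "cmod (\<integral>x. (g n x - f x) * cnj (cauchy2 x z) \<partial>\<sigma>) \<le>
          sqrt ((\<integral>x. (cmod (g n x - f x))\<^sup>2 \<partial>\<sigma>) * (\<integral>x. (cmod (cauchy2 x z))\<^sup>2 \<partial>\<sigma>))" for n
        using L2.cauchy_schwarz[OF L2.diff_mem[OF gL f] cauchy2_mem[OF z]] unfolding L2_self
            by (rule real_le_rsqrt)
      then show "\<forall>\<^sub>F n in sequentially. cmod (\<integral>x. (g n x - f x) * cnj (cauchy2 x z) \<partial>\<sigma>) \<le>
         sqrt ((\<integral>x. (cmod (g n x - f x))\<^sup>2 \<partial>\<sigma>) * (\<integral>x. (cmod (cauchy2 x z))\<^sup>2 \<partial>\<sigma>))" by simp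
    qed
    have 2: "(\<lambda>n. ip (\<lambda>x. F x - G n x) (e z)) \<longlonglongrightarrow> 0"
      using clark_pairs_cauchy2[OF z] by (intro orth) force
    have 3: "(\<integral>x. (g n x - f x) * cnj (cauchy2 x z) \<partial>\<sigma>) + ip (\<lambda>x. F x - G n x) (e z) =
        ip F (e z) - (\<integral>x. f x * cnj (cauchy2 x z) \<partial>\<sigma>)" for n
      using H.ip_diff[OF F GH e_mem[OF z], of n] clark_pairs_ip_e[OF G[of n] z]
        L2.ip_diff[OF gL f cauchy2_mem[OF z], of n] by simp
    have "(\<lambda>n. ip F (e z) - (\<integral>x. f x * cnj (cauchy2 x z) \<partial>\<sigma>)) \<longlonglongrightarrow> 0"
      using tendsto_add[OF 1 2] unfolding 3 by simp
    then have "ip F (e z) = (\<integral>x. f x * cnj (cauchy2 x z) \<partial>\<sigma>)" by (simp add: LIMSEQ_const_iff)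
    then show ?thesis using ip_e[OF F z] by simp
  qed
  with f show ?thesis by (rule that)
qed

end

section \<open>The theorem of F. and M. Riesz\<close>

lemma measurable_cis_circle:
  "(\<lambda>t. cis (2 * pi * t)) \<in> uniform_measure lborel {0..1} \<rightarrow>\<^sub>M circle_borel"
proof (intro measurable_restrict_space2)
  have "(\<lambda>t. cis (2 * pi * t)) \<in> borel_measurable borel"
    by (intro borel_measurable_continuous_onI continuous_intros)
  then show "(\<lambda>t. cis (2 * pi * t)) \<in> borel_measurable (uniform_measure lborel {0..1})"
    by (simp cong: measurable_cong_sets)
qed auto

lemma emeasure_circle_lebesgue:
  assumes "K \<in> sets circle_borel"
  shows "emeasure circle_lebesgue K = emeasure lborel {t \<in> {0..1}. cis (2 * pi * t) \<in> K}"
proof -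
  note c = measurable_cis_circle
  have m: "(\<lambda>t. cis (2 * pi * t)) -` K \<in> sets lborel"
    using measurable_sets[OF c assms] by simp
  have "emeasure circle_lebesgue K = emeasure (uniform_measure lborel {0..1}) ((\<lambda>t. cis (2 * pi * t)) -` K)"
    unfolding circle_lebesgue_def using emeasure_distr[OF c assms] by simp
  also have "\<dots> = emeasure lborel ({0..1} \<inter> (\<lambda>t. cis (2 * pi * t)) -` K)"
    using m by (subst emeasure_uniform_measure) (auto simp: divide_ennreal_def)
  also have "{0..1} \<inter> (\<lambda>t. cis (2 * pi * t)) -` K = {t \<in> {0..1}. cis (2 * pi * t) \<in> K}" by auto
  finally show ?thesis .
qed

lemma norm_cis_diff_le: "cmod (cis x - cis y) \<le> \<bar>x - y\<bar>"
proof -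
  have "cis x - cis y = cis y * (exp (\<i> * of_real (x - y)) - 1)"
    unfolding cis_conv_exp[symmetric] by (simp add: right_diff_distrib cis_mult)
  then have "cmod (cis x - cis y) = 2 * \<bar>sin ((x - y) / 2)\<bar>"
    by (simp add: norm_mult dist_exp_i_1 del: of_real_diff)
  then show ?thesis using abs_sin_x_le_abs_x[of "(x - y) / 2"] by simp
qed

text \<open>These are the estimates for the factor (z - a)/(z - (1+s) a): its pole has distance at
  least s from the closed disc, and each point of the disc is at least as close to a as to the pole,
  so the modulus is at most 1.\<close>

lemma circle_outer_point:
  assumes "cmod z \<le> 1" "cmod a = 1" "0 \<le> s"
  shows "s \<le> cmod (z - (1 + of_real s) * a)" "cmod (z - a) \<le> cmod (z - (1 + of_real s) * a)"
proof -
  have "1 + complex_of_real s = of_real (1 + s)" by simp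
  then have "cmod ((1 + of_real s) * a) = 1 + s"
    using assms by (simp only: norm_mult norm_of_real) simp
  then show "s \<le> cmod (z - (1 + of_real s) * a)"
    using norm_triangle_ineq2[of "(1 + of_real s) * a" z] assms(1) by (simp add: norm_minus_commute)
  \<comment> \<open>Rotating a to 1 reduces the comparison to Re w \<le> 1 \<le> 1 + s.\<close>
  define w where "w = z * cnj a"
  have aa: "a * cnj a = 1" using assms by (simp add: complex_norm_square[symmetric])
  have r: "cmod (z - c * a) = cmod (w - c)" for c
  proof -
    have "w - c = (z - c * a) * cnj a" using aa by (simp add: w_def algebra_simps)
    then show ?thesis using assms by (simp add: norm_mult)
  qed
  have "cmod w \<le> 1" using assms by (simp add: w_def norm_mult)
  then have "Re w \<le> 1" using complex_Re_le_cmod[of w] by simp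
  then have "(Re w - 1)\<^sup>2 \<le> (Re w - (1 + s))\<^sup>2"
    using assms(3) by (subst abs_le_square_iff[symmetric]) linarith
  then have "cmod (w - 1) \<le> cmod (w - (1 + of_real s))"
    by (simp add: cmod_def)
  then show "cmod (z - a) \<le> cmod (z - (1 + of_real s) * a)"
    using r[of 1] r[of "1 + of_real s"] by simp
qed

text \<open>Of N+1 equal arcs keep those that meet K. In the parameter interval they lie in the
  1/(N+1)-neighbourhood of the preimage of K; since that preimage is closed and null, the measures
  of the neighbourhoods, and with them the fraction of arcs kept, tend to 0.\<close>

lemma thin_arcs:
  assumes K: "compact K" "K \<subseteq> sphere 0 1" "K \<noteq> {}" and null: "emeasure circle_lebesgue K = 0"
  obtains J :: "nat \<Rightarrow> nat set" and a :: "nat \<Rightarrow> nat \<Rightarrow> complex"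
  where "\<And>N. finite (J N)" "\<And>N j. j \<in> J N \<Longrightarrow> a N j \<in> K"
    "\<And>N z. z \<in> K \<Longrightarrow> \<exists>j\<in>J N. cmod (z - a N j) \<le> 2 * pi / Suc N"
    "(\<lambda>N. card (J N) / Suc N) \<longlonglongrightarrow> 0"
proof -
  define c where "c t = cis (2 * pi * t)" for t :: real
  define S where "S = {t \<in> {0..1}. c t \<in> K}"
  have contc: "continuous_on UNIV c" unfolding c_def by (intro continuous_intros)
  have Sc: "closed S"
    using continuous_closed_preimage[OF continuous_on_subset[OF contc subset_UNIV] _
        compact_imp_closed[OF K(1)], of "{0..1}"]
    by (simp add: S_def vimage_def Int_def)
  \<comment> \<open>The parameter 1 is excluded so that the arc index obtained by rounding down
    stays below N+1.\<close>
  have par: "\<exists>t. 0 \<le> t \<and> t < 1 \<and> z = c t" if "z \<in> K" for z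
  proof -
    have "cmod z = 1" using that K(2) by auto
    then have z: "cis (Arg2pi z) = z"
      using Arg2pi_eq[of z] unfolding cis_conv_exp by (metis mult.left_neutral of_real_1)
    show ?thesis
    proof (intro exI conjI)
      show "0 \<le> Arg2pi z / (2 * pi)" using Arg2pi_ge_0[of z] by simp
      show "Arg2pi z / (2 * pi) < 1" using Arg2pi_lt_2pi[of z] by simp
      show "z = c (Arg2pi z / (2 * pi))" unfolding c_def using z by simp
    qed
  qed
  then have Sne: "S \<noteq> {}" using K(3) by (fastforce simp: S_def)
  have S0: "emeasure lborel S = 0"
  proof -
    have "K \<in> sets circle_borel" using K compact_imp_closed[OF K(1)] by (auto simp: sets_restrict_space)
    from emeasure_circle_lebesgue[OF this] null show ?thesis by (simp add: S_def c_def)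
  qed
  \<comment> \<open>Closed neighbourhoods decreasing to S, so that continuity from above
    applies.\<close>
  define T where "T N = {t \<in> {0..1::real}. infdist t S \<le> 1 / Suc N}" for N :: nat
  have Tcl: "closed (T N)" for N
  proof -
    have "T N = {0..1} \<inter> {t. infdist t S \<le> 1 / Suc N}" unfolding T_def by auto
    then show ?thesis
      by (simp only:) (intro closed_Int closed_atLeastAtMost closed_Collect_le continuous_intros)
  qed
  have Tm: "T N \<in> sets lborel" for N using Tcl by simp
  have Tfin: "emeasure lborel (T N) \<noteq> \<infinity>" for N
  proof -
    have "emeasure lborel (T N) \<le> emeasure lborel {0..1::real}" by (intro emeasure_mono) (auto simp: T_def)
    also have "\<dots> < \<infinity>" by simp
    finally show ?thesis by simp
  qed
  have "decseq T"
  proof (intro decseq_SucI subsetI)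
    fix N t assume "t \<in> T (Suc N)"
    then have "t \<in> {0..1}" "infdist t S \<le> 1 / Suc (Suc N)" by (auto simp: T_def)
    moreover have "1 / real (Suc (Suc N)) \<le> 1 / real (Suc N)" by (intro divide_left_mono) auto
    ultimately show "t \<in> T N" unfolding T_def by force
  qed
  have "(\<Inter>N. T N) = S"
  proof (intro equalityI subsetI)
    fix t assume t: "t \<in> (\<Inter>N. T N)"
    have "infdist t S \<le> 1 / Suc N" for N using t by (auto simp: T_def)
    moreover have "(\<lambda>N. 1 / real (Suc N)) \<longlonglongrightarrow> 0" by (rule LIMSEQ_Suc[OF lim_const_over_n])
    ultimately have "infdist t S \<le> 0" by (intro LIMSEQ_le_const) auto
    then have "infdist t S = 0" using infdist_nonneg[of t S] by simp
    then show "t \<in> S" using in_closed_iff_infdist_zero[OF Sc Sne] by simp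
  qed (auto simp: T_def S_def[symmetric], auto simp: S_def)
  with Lim_emeasure_decseq[of T lborel] Tm \<open>decseq T\<close> Tfin S0
  have limT: "(\<lambda>N. emeasure lborel (T N)) \<longlonglongrightarrow> 0" by auto
  \<comment> \<open>Half-open intervals are disjoint, so the measure of their union counts the arcs
    that are kept.\<close>
  define I where "I N j = {real j / Suc N ..< real (Suc j) / Suc N}" for N j :: nat
  define J where "J N = {j. j < Suc N \<and> (\<exists>t\<in>I N j. c t \<in> K)}" for N
  have finJ: "finite (J N)" for N unfolding J_def by simp
  define \<tau> where "\<tau> N j = (SOME t. t \<in> I N j \<and> c t \<in> K)" for N j
  have \<tau>: "\<tau> N j \<in> I N j" "c (\<tau> N j) \<in> K" if "j \<in> J N" for N j
  proof -
    have "\<exists>t. t \<in> I N j \<and> c t \<in> K" using that by (auto simp: J_def)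
    from someI_ex[OF this] show "\<tau> N j \<in> I N j" "c (\<tau> N j) \<in> K" by (auto simp: \<tau>_def)
  qed
  have close: "\<bar>s - t\<bar> \<le> 1 / Suc N" if "s \<in> I N j" "t \<in> I N j" for s t N j
  proof -
    have "real (Suc j) / Suc N - real j / Suc N = 1 / Suc N" by (simp add: diff_divide_distrib[symmetric])
    then show ?thesis using that unfolding I_def by auto
  qed
  have Isub: "I N j \<subseteq> {0..1}" if "j < Suc N" for N j
  proof -
    have "real (Suc j) / Suc N \<le> 1" using that by (simp add: divide_le_eq)
    moreover have "0 \<le> real j / Suc N" by simp
    ultimately show ?thesis
      unfolding I_def by (intro subsetI) (simp only: atLeastLessThan_iff atLeastAtMost_iff, linarith)
  qed
  have cover: "\<exists>j\<in>J N. cmod (z - c (\<tau> N j)) \<le> 2 * pi / Suc N" if z: "z \<in> K" for z N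
  proof -
    obtain t where t: "0 \<le> t" "t < 1" "z = c t" using par[OF z] by blast
    define j where "j = nat \<lfloor>t * Suc N\<rfloor>"
    have j0: "real j = of_int \<lfloor>t * Suc N\<rfloor>" using t unfolding j_def by simp
    have 1: "real j \<le> t * Suc N" "t * Suc N < real (Suc j)" unfolding j0 of_nat_Suc by linarith+
    then have tI: "t \<in> I N j" unfolding I_def by (simp add: field_simps)
    have "t * Suc N < real (Suc N)" using mult_strict_right_mono[OF t(2), of "real (Suc N)"] by simp
    then have "real j < real (Suc N)" using 1 by linarith
    then have jJ: "j \<in> J N" using tI t z unfolding J_def by auto
    have "cmod (z - c (\<tau> N j)) \<le> \<bar>2 * pi * t - 2 * pi * \<tau> N j\<bar>"
      unfolding t(3) c_def by (rule norm_cis_diff_le)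
    also have "\<dots> = 2 * pi * \<bar>t - \<tau> N j\<bar>" by (simp add: abs_mult flip: right_diff_distrib)
    also have "\<dots> \<le> 2 * pi * (1 / Suc N)" using close[OF tI \<tau>(1)[OF jJ]] by (intro mult_left_mono) auto
    finally show ?thesis using jJ by (intro bexI[of _ j]) auto
  qed
  have cardle: "ennreal (card (J N) / Suc N) \<le> emeasure lborel (T N)" for N
  proof -
    have disj: "disjoint_family_on (I N) (J N)"
    proof (unfold disjoint_family_on_def, intro ballI impI)
      fix i j :: nat assume "i \<noteq> j"
      then consider "Suc i \<le> j" | "Suc j \<le> i" by linarith
      then show "I N i \<inter> I N j = {}"
      proof cases
        case 1
        then have "real (Suc i) / Suc N \<le> real j / Suc N" by (intro divide_right_mono of_nat_mono) auto
        then show ?thesis by (auto simp: I_def)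
      next
        case 2
        then have "real (Suc j) / Suc N \<le> real i / Suc N" by (intro divide_right_mono of_nat_mono) auto
        then show ?thesis by (auto simp: I_def)
      qed
    qed
    have Ie: "emeasure lborel (I N j) = ennreal (1 / Suc N)" for j
    proof -
      have "real j / Suc N \<le> real (Suc j) / Suc N" by (intro divide_right_mono) auto
      then show ?thesis unfolding I_def by (simp add: diff_divide_distrib[symmetric])
    qed
    have "ennreal (card (J N) / Suc N) = (\<Sum>j\<in>J N. ennreal (1 / Suc N))"
      by (simp add: ennreal_of_nat_eq_real_of_nat ennreal_mult[symmetric])
    also have "\<dots> = (\<Sum>j\<in>J N. emeasure lborel (I N j))" by (simp only: Ie)
    also have "\<dots> = emeasure lborel (\<Union>j\<in>J N. I N j)"
      by (rule sum_emeasure[OF _ disj finJ]) (auto simp: I_def)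
    also have "\<dots> \<le> emeasure lborel (T N)"
    proof (rule emeasure_mono[OF _ Tm], rule UN_least)
      fix j assume j: "j \<in> J N"
      then have jN: "j < Suc N" by (simp add: J_def)
      have "\<tau> N j \<in> S" using \<tau>[OF j] Isub[OF jN] by (auto simp: S_def)
      then have "infdist t S \<le> 1 / Suc N" if "t \<in> I N j" for t
        using infdist_le[of "\<tau> N j" S t] close[OF that \<tau>(1)[OF j]] by (simp add: dist_real_def)
      then show "I N j \<subseteq> T N" using Isub[OF jN] by (auto simp: T_def)
    qed
    finally show ?thesis .
  qed
  have "(\<lambda>N. ennreal (card (J N) / Suc N)) \<longlonglongrightarrow> 0"
    using cardle by (intro tendsto_sandwich[OF _ _ tendsto_const limT]) auto
  then have "(\<lambda>N. ennreal (card (J N) / Suc N)) \<longlonglongrightarrow> ennreal 0" by simp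
  then have "(\<lambda>N. card (J N) / Suc N) \<longlonglongrightarrow> 0"
    by (subst (asm) tendsto_ennreal_iff) auto
  then show ?thesis
    using that[of J "\<lambda>N j. c (\<tau> N j)"] finJ \<tau>(2) cover by blast
qed

text \<open>Oksendal's functions: products of Moebius factors with zeros on the null set and poles
  slightly outside the disc.\<close>

lemma peak_functions:
  assumes K: "compact K" "K \<subseteq> sphere 0 1" and null: "emeasure circle_lebesgue K = 0"
  obtains g :: "nat \<Rightarrow> complex \<Rightarrow> complex" where
    "\<And>n. continuous_on (cball 0 1) (g n)" "\<And>n. g n holomorphic_on ball 0 1"
    "\<And>n z. cmod z \<le> 1 \<Longrightarrow> cmod (g n z) \<le> 1"
    "\<And>z. cmod z = 1 \<Longrightarrow> (\<lambda>n. g n z) \<longlonglongrightarrow> 1 - indicator K z"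
proof (cases "K = {}")
  case True
  then show ?thesis by (intro that[of "\<lambda>n z. 1"]) auto
next
  case False
  obtain J a where finJ: "\<And>N::nat. finite (J N :: nat set)"
    and aK: "\<And>N j. j \<in> J N \<Longrightarrow> a N j \<in> K"
    and cov: "\<And>N z. z \<in> K \<Longrightarrow> \<exists>j\<in>J N. cmod (z - a N j) \<le> 2 * pi / Suc N"
    and lim: "(\<lambda>N. card (J N) / Suc N) \<longlonglongrightarrow> 0"
    by (rule thin_arcs[OF K False null]) blast
  define \<epsilon> where "\<epsilon> N = real (card (J N)) / Suc N" for N
  have "card (J N) > 0" for N
    using cov[of _ N] False finJ[of N] by (auto simp: card_gt_0_iff)
  then have \<epsilon>0: "\<epsilon> N > 0" for N by (simp add: \<epsilon>_def)
  have lims: "(\<lambda>N. sqrt (\<epsilon> N)) \<longlonglongrightarrow> 0" using tendsto_real_sqrt[OF lim] by (simp add: \<epsilon>_def)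
  \<comment> \<open>This s balances two demands. At a point of K one factor is at most 2 pi / ((N+1)
    s) = sqrt \<epsilon>; away from K the product differs from 1 by at most card (J N) s / dist = 2
    pi sqrt \<epsilon> / dist. Both tend to 0.\<close>
  define s where "s N = 2 * pi / Suc N / sqrt (\<epsilon> N)" for N
  have s0: "s N > 0" for N using \<epsilon>0 by (simp add: s_def)
  define f where "f N j z = (z - a N j) / (z - (1 + of_real (s N)) * a N j)" for N j z
  define g where "g N z = (\<Prod>j\<in>J N. f N j z)" for N z
  have a1: "cmod (a N j) = 1" if "j \<in> J N" for N j using aK[OF that] K(2) by auto
  have ge: "s N \<le> cmod (z - (1 + of_real (s N)) * a N j)"
    "cmod (z - a N j) \<le> cmod (z - (1 + of_real (s N)) * a N j)" if "j \<in> J N" "cmod z \<le> 1" for N j z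
    using circle_outer_point[OF that(2) a1[OF that(1)], of "s N"] s0[of N] by auto
  have ne: "z - (1 + of_real (s N)) * a N j \<noteq> 0" if "j \<in> J N" "cmod z \<le> 1" for N j z
    using ge(1)[OF that] s0[of N] by auto
  have f1: "cmod (f N j z) \<le> 1" if "j \<in> J N" "cmod z \<le> 1" for N j z
    using ge(2)[OF that] ne[OF that] unfolding f_def norm_divide by (simp add: divide_le_eq_1)
  have g1: "cmod (g N z) \<le> 1" if "cmod z \<le> 1" for N z
    unfolding g_def prod_norm[symmetric] using f1[OF _ that] by (intro prod_le_1) auto
  have cont: "continuous_on (cball 0 1) (g N)" for N
    unfolding g_def f_def using ne[of _ N] by (intro continuous_intros) auto
  have hol: "g N holomorphic_on ball 0 1" for N
    unfolding g_def f_def using ne[of _ N] by (intro holomorphic_intros) auto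
  have to0: "(\<lambda>N. g N z) \<longlonglongrightarrow> 0" if z: "z \<in> K" for z
  proof (rule Lim_null_comparison[OF _ lims], rule always_eventually, rule allI)
    fix N
    have z1: "cmod z \<le> 1" using z K(2) by auto
    obtain j where j: "j \<in> J N" "cmod (z - a N j) \<le> 2 * pi / Suc N" using cov[OF z] by blast
    have "cmod (f N j z) \<le> (2 * pi / Suc N) / s N"
      unfolding f_def norm_divide using j(2) ge(1)[OF j(1) z1] s0[of N] by (intro frac_le) auto
    also have "\<dots> = sqrt (\<epsilon> N)" using \<epsilon>0[of N] by (simp add: s_def)
    finally have 1: "cmod (f N j z) \<le> sqrt (\<epsilon> N)" .
    have 2: "(\<Prod>i\<in>J N - {j}. cmod (f N i z)) \<le> 1" using f1[OF _ z1] by (intro prod_le_1) auto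
    have "cmod (g N z) = cmod (f N j z) * (\<Prod>i\<in>J N - {j}. cmod (f N i z))"
      unfolding g_def prod.remove[OF finJ j(1)] norm_mult prod_norm[symmetric] ..
    also have "\<dots> \<le> sqrt (\<epsilon> N) * 1" using 1 2 \<epsilon>0[of N] by (intro mult_mono prod_nonneg) auto
    finally show "cmod (g N z) \<le> sqrt (\<epsilon> N)" by simp
  qed
  have to1: "(\<lambda>N. g N z) \<longlonglongrightarrow> 1" if z: "z \<notin> K" "cmod z = 1" for z
  proof -
    have d: "infdist z K > 0"
      using infdist_pos_not_in_closed[OF compact_imp_closed[OF K(1)] False z(1)] .
    have "cmod (g N z - 1) \<le> sqrt (\<epsilon> N) * (2 * pi / infdist z K)" for N
    proof -
      \<comment> \<open>A product of numbers in the closed unit disc differs from 1 by at most the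
        sum of the differences of its factors from 1.\<close>
      have "cmod (g N z - (\<Prod>j\<in>J N. 1)) \<le> (\<Sum>j\<in>J N. cmod (f N j z - 1))"
        unfolding g_def by (rule norm_prod_diff) (use f1 z in auto)
      also have "\<dots> \<le> (\<Sum>j\<in>J N. s N / infdist z K)"
      proof (rule sum_mono)
        fix j assume j: "j \<in> J N"
        have "f N j z - 1 = of_real (s N) * a N j / (z - (1 + of_real (s N)) * a N j)"
        proof -
          define q where "q = z - (1 + of_real (s N)) * a N j"
          have "q \<noteq> 0" using ne[OF j, of z] z by (simp add: q_def)
          then have "f N j z - 1 = ((z - a N j) - q) / q"
            unfolding f_def q_def[symmetric] by (simp add: diff_divide_distrib)
          also have "(z - a N j) - q = of_real (s N) * a N j" unfolding q_def by (simp add: algebra_simps)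
          finally show ?thesis unfolding q_def .
        qed
        then have "cmod (f N j z - 1) = s N / cmod (z - (1 + of_real (s N)) * a N j)"
          using a1[OF j] s0[of N] by (simp add: norm_divide norm_mult)
        also have "\<dots> \<le> s N / infdist z K"
        proof (rule divide_left_mono)
          have "infdist z K \<le> cmod (z - a N j)"
            using infdist_le[OF aK[OF j], of z] by (simp add: dist_norm)
          then show "infdist z K \<le> cmod (z - (1 + of_real (s N)) * a N j)"
            using ge(2)[OF j, of z] z by simp
        qed (use s0[of N] d ne[OF j, of z] z in auto)
        finally show "cmod (f N j z - 1) \<le> s N / infdist z K" .
      qed
      also have "\<dots> = (real (card (J N)) / Suc N / sqrt (\<epsilon> N)) * (2 * pi / infdist z K)"
        by (simp add: s_def)
      also have "real (card (J N)) / Suc N / sqrt (\<epsilon> N) = sqrt (\<epsilon> N)"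
        unfolding \<epsilon>_def[symmetric] using \<epsilon>0[of N] by (simp add: real_div_sqrt)
      finally show ?thesis by simp
    qed
    moreover have "(\<lambda>N. sqrt (\<epsilon> N) * (2 * pi / infdist z K)) \<longlonglongrightarrow> 0"
      using tendsto_mult_right[OF lims, of "2 * pi / infdist z K"] by (simp only: mult_zero_left)
    ultimately have "(\<lambda>N. g N z - 1) \<longlonglongrightarrow> 0"
      by (rule Lim_null_comparison[OF always_eventually[OF allI]])
    then show ?thesis by (rule LIM_zero_cancel)
  qed
  show ?thesis
    by (rule that[of g, OF cont hol g1]) (use to0 to1 in \<open>auto simp: indicator_def\<close>)
qed

text \<open>Stated for the push-forward of F dM by u, so that it applies to a single coordinate of
  the torus. For compact K the functions of \<open>peak_functions\<close> tend boundedly to 1 -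
  indicator of K on the circle, and the integral of F vanishes because constants are admissible test
  functions. Inner regularity passes from compact subsets to Z.\<close>

theorem F_and_M_Riesz:
  fixes F u :: "'a \<Rightarrow> complex"
  assumes F: "integrable M F" and u[measurable]: "u \<in> borel_measurable M"
    and u1: "\<And>x. x \<in> space M \<Longrightarrow> cmod (u x) = 1"
    and ann: "\<And>g. \<lbrakk>continuous_on (cball 0 1) g; g holomorphic_on ball 0 1\<rbrakk> \<Longrightarrow> (\<integral>x. g (u x) * F x \<partial>M) = 0"
    and Z: "Z \<in> sets circle_borel" "emeasure circle_lebesgue Z = 0"
  shows "(\<integral>x. indicator Z (u x) * F x \<partial>M) = 0"
proof -
  have Fm[measurable]: "F \<in> borel_measurable M" using F by auto
  have Zb: "Z \<in> sets borel" "Z \<subseteq> sphere 0 1"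
    using Z(1) by (auto simp: sets_restrict_space)
  have Fi: "integrable M (\<lambda>x. indicator A (u x) * F x)" if [measurable]: "A \<in> sets borel" for A
    by (rule Bochner_Integration.integrable_bound[OF F]) (auto simp: indicator_def)
  have comp: "(\<integral>x. indicator K (u x) * F x \<partial>M) = 0" if K: "compact K" "K \<subseteq> Z" for K
  proof -
    have "emeasure circle_lebesgue K \<le> emeasure circle_lebesgue Z"
      using K(2) Z(1) by (intro emeasure_mono) (auto simp: circle_lebesgue_def)
    then have K0: "emeasure circle_lebesgue K = 0" using Z(2) by simp
    have [measurable]: "K \<in> sets borel" using compact_imp_closed[OF K(1)] by simp
    from peak_functions[OF K(1) order_trans[OF K(2) Zb(2)] K0] obtain g :: "nat \<Rightarrow> complex \<Rightarrow> complex"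
      where g: "\<And>n. continuous_on (cball 0 1) (g n)" "\<And>n. g n holomorphic_on ball 0 1"
      "\<And>n z. cmod z \<le> 1 \<Longrightarrow> cmod (g n z) \<le> 1"
      "\<And>z. cmod z = 1 \<Longrightarrow> (\<lambda>n. g n z) \<longlonglongrightarrow> 1 - indicator K z" by metis
    have gm: "(\<lambda>x. g n (u x)) \<in> borel_measurable M" for n
    proof -
      have "u \<in> M \<rightarrow>\<^sub>M restrict_space borel (cball 0 1)"
        using u1 by (intro measurable_restrict_space2 u) auto
      then show ?thesis
        using measurable_compose borel_measurable_continuous_on_restrict[OF g(1)] by blast
    qed
    have "(\<lambda>n. \<integral>x. g n (u x) * F x \<partial>M) \<longlonglongrightarrow> (\<integral>x. (1 - indicator K (u x)) * F x \<partial>M)"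
    proof (rule integral_dominated_convergence[where w="\<lambda>x. norm (F x)"])
      show "(\<lambda>x. (1 - indicator K (u x)) * F x) \<in> borel_measurable M" by measurable
      show "(\<lambda>x. g n (u x) * F x) \<in> borel_measurable M" for n using gm by measurable
      show "integrable M (\<lambda>x. norm (F x))" using F by simp
      show "AE x in M. (\<lambda>n. g n (u x) * F x) \<longlonglongrightarrow> (1 - indicator K (u x)) * F x"
        using g(4) u1 by (intro AE_I2 tendsto_mult_right) auto
      show "AE x in M. norm (g n (u x) * F x) \<le> norm (F x)" for n
        using g(3) u1 by (intro AE_I2) (auto simp: norm_mult intro!: mult_left_le_one_le)
    qed
    then have "(\<integral>x. (1 - indicator K (u x)) * F x \<partial>M) = 0"
      using ann[OF g(1,2)] by (simp add: LIMSEQ_const_iff)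
    moreover have "(\<integral>x. (1 - indicator K (u x)) * F x \<partial>M) = (\<integral>x. F x \<partial>M) - (\<integral>x. indicator K (u x) * F x \<partial>M)"
      using F Fi[of K] by (simp add: left_diff_distrib)
    moreover have "(\<integral>x. F x \<partial>M) = 0" using ann[of "\<lambda>_. 1"] by simp
    ultimately show ?thesis by simp
  qed
  \<comment> \<open>The push-forward of |F| dM is positive and dominates the complex one; its mass
    on Z - K bounds the error of replacing Z by K.\<close>
  define \<nu> where "\<nu> = distr (density M (\<lambda>x. ennreal (norm (F x)))) borel u"
  have \<nu>: "emeasure \<nu> A = ennreal (\<integral>x. indicator A (u x) * norm (F x) \<partial>M)"
      if [measurable]: "A \<in> sets borel" for A
  proof -
    have i: "integrable M (\<lambda>x. indicator A (u x) * norm (F x))"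
      using that by (intro Bochner_Integration.integrable_bound[OF F]) (auto simp: indicator_def)
    have "emeasure \<nu> A = (\<integral>\<^sup>+x. ennreal (norm (F x)) * indicator (u -` A \<inter> space M) x \<partial>M)"
      unfolding \<nu>_def by (simp add: emeasure_distr emeasure_density)
    also have "\<dots> = (\<integral>\<^sup>+x. ennreal (indicator A (u x) * norm (F x)) \<partial>M)"
      by (intro nn_integral_cong) (auto simp: indicator_def)
    also have "\<dots> = ennreal (\<integral>x. indicator A (u x) * norm (F x) \<partial>M)"
      by (rule nn_integral_eq_integral[OF i]) auto
    finally show ?thesis .
  qed
  have sets\<nu>: "sets \<nu> = sets borel" by (simp add: \<nu>_def)
  have fin\<nu>: "emeasure \<nu> A \<noteq> \<infinity>" if "A \<in> sets borel" for A using \<nu>[OF that] by simp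
  have "cmod (\<integral>x. indicator Z (u x) * F x \<partial>M) \<le> e" if e: "e > 0" for e
  proof -
    have reg: "emeasure \<nu> Z = (SUP K \<in> {K. K \<subseteq> Z \<and> compact K}. emeasure \<nu> K)"
      using fin\<nu>[of UNIV] by (intro inner_regular sets\<nu> Zb) (simp add: \<nu>_def)
    have "\<exists>K\<in>{K. K \<subseteq> Z \<and> compact K}. emeasure \<nu> Z \<le> emeasure \<nu> K + ennreal e"
    proof (rule ccontr)
      assume "\<not> ?thesis"
      then have "emeasure \<nu> K + ennreal e \<le> emeasure \<nu> Z" if "K \<subseteq> Z" "compact K" for K
        using that by (auto simp: not_le intro: less_imp_le)
      then have "(SUP K \<in> {K. K \<subseteq> Z \<and> compact K}. emeasure \<nu> K + ennreal e) \<le> emeasure \<nu> Z"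
        by (intro SUP_least) auto
      then have "(SUP K \<in> {K. K \<subseteq> Z \<and> compact K}. emeasure \<nu> K) + ennreal e \<le> emeasure \<nu> Z"
        by (subst ennreal_SUP_add_left[symmetric]) (auto intro: exI[of _ "{}"])
      then have "emeasure \<nu> Z + ennreal e \<le> emeasure \<nu> Z" unfolding reg[symmetric] .
      then show False using fin\<nu>[OF Zb(1)] e
        by (cases "emeasure \<nu> Z") (auto simp: ennreal_plus[symmetric] ennreal_le_iff simp del: ennreal_plus)
    qed
    then obtain K where K: "K \<subseteq> Z" "compact K" "emeasure \<nu> Z \<le> emeasure \<nu> K + ennreal e" by auto
    have Kb[measurable]: "K \<in> sets borel" using compact_imp_closed[OF K(2)] by simp
    note Zb(1)[measurable]
    have ZK: "indicator Z y - indicator K y = (indicator (Z - K) y :: 'b :: ring_1)" for y :: complex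
      using K(1) by (auto simp: indicator_def)
    have i: "integrable M (\<lambda>x. indicator A (u x) * norm (F x))" if "A \<in> sets borel" for A
      using that by (intro Bochner_Integration.integrable_bound[OF F]) (auto simp: indicator_def)
    have "(\<integral>x. indicator Z (u x) * F x \<partial>M) = (\<integral>x. indicator Z (u x) * F x \<partial>M) -
        (\<integral>x. indicator K (u x) * F x \<partial>M)"
      using comp[OF K(2,1)] by simp
    also have "\<dots> = (\<integral>x. indicator Z (u x) * F x - indicator K (u x) * F x \<partial>M)"
      by (rule Bochner_Integration.integral_diff[symmetric]) (intro Fi Zb Kb)+
    finally have "cmod (\<integral>x. indicator Z (u x) * F x \<partial>M) \<le>
        (\<integral>x. cmod (indicator Z (u x) * F x - indicator K (u x) * F x) \<partial>M)"
      by simp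
    also have "\<dots> = (\<integral>x. indicator Z (u x) * cmod (F x) - indicator K (u x) * cmod (F x) \<partial>M)"
      unfolding left_diff_distrib[symmetric] ZK norm_mult
      by (intro Bochner_Integration.integral_cong) (auto simp: indicator_def)
    also have "\<dots> = (\<integral>x. indicator Z (u x) * cmod (F x) \<partial>M) - (\<integral>x. indicator K (u x) * cmod (F x) \<partial>M)"
      by (rule Bochner_Integration.integral_diff) (intro i Zb Kb)+
    also have "\<dots> \<le> e"
    proof -
      have n: "0 \<le> (\<integral>x. indicator A (u x) * cmod (F x) \<partial>M)" for A
        by (intro Bochner_Integration.integral_nonneg) auto
      show ?thesis
        using K(3) e n[of K] unfolding \<nu>[OF Zb(1)] \<nu>[OF Kb]
        by (simp add: ennreal_plus[symmetric] ennreal_le_iff del: ennreal_plus)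
    qed
    finally show ?thesis .
  qed
  then have "cmod (\<integral>x. indicator Z (u x) * F x \<partial>M) \<le> 0" by (rule field_le_epsilon[of _ 0, simplified])
  then show ?thesis by simp
qed

text \<open>The assumption says that the push-forward of F dM by u vanishes. For real F this is an
  equality between the push-forwards of the positive and the negative part, and equal positive
  measures integrate \<psi> equally.\<close>

lemma integral_multiplier_zero:
  fixes F :: "'a \<Rightarrow> complex" and \<psi> :: "'b \<Rightarrow> complex"
  assumes F: "integrable M F" and u[measurable]: "u \<in> M \<rightarrow>\<^sub>M N"
    and zero: "\<And>E. E \<in> sets N \<Longrightarrow> (\<integral>x. indicator E (u x) * F x \<partial>M) = 0"
    and \<psi>[measurable]: "\<psi> \<in> borel_measurable N" and B: "\<And>y. y \<in> space N \<Longrightarrow> cmod (\<psi> y) \<le> B"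
  shows "(\<integral>x. \<psi> (u x) * F x \<partial>M) = 0"
proof -
  have bi: "integrable M (\<lambda>x. \<psi> (u x) * G x)" if "integrable M G" for G :: "'a \<Rightarrow> complex"
  proof (rule Bochner_Integration.integrable_bound)
    have [measurable]: "G \<in> borel_measurable M" using that by auto
    show "integrable M (\<lambda>x. of_real B * G x)" using that by simp
    show "(\<lambda>x. \<psi> (u x) * G x) \<in> borel_measurable M" by measurable
    show "AE x in M. norm (\<psi> (u x) * G x) \<le> norm (of_real B * G x)"
    proof (rule AE_I2)
      fix x assume "x \<in> space M"
      then have "cmod (\<psi> (u x)) \<le> \<bar>B\<bar>" using B[of "u x"] measurable_space[OF u] by fastforce
      then show "norm (\<psi> (u x) * G x) \<le> norm (of_real B * G x)"
        unfolding norm_mult norm_of_real by (intro mult_right_mono) auto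
    qed
  qed
  have real: "(\<integral>x. \<psi> (u x) * of_real (G x) \<partial>M) = 0"
    if G: "integrable M G" and zero: "\<And>E. E \<in> sets N \<Longrightarrow>
        (\<integral>x. indicator E (u x) * G x \<partial>M) = 0" for G :: "'a \<Rightarrow> real"
  proof -
    have Gm[measurable]: "G \<in> borel_measurable M" using G by auto
    define p where "p x = max 0 (G x)" for x
    define n where "n x = max 0 (- G x)" for x
    have pn: "G x = p x - n x" "0 \<le> p x" "0 \<le> n x" for x by (auto simp: p_def n_def)
    have p: "integrable M p" and n: "integrable M n" unfolding p_def n_def using G by auto
    have [measurable]: "p \<in> borel_measurable M" "n \<in> borel_measurable M" using p n by auto
    have ii: "integrable M (\<lambda>x. indicator E (u x) * q x)"
        if [measurable]: "E \<in> sets N" and "integrable M q" for E and q :: "'a \<Rightarrow> real"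
    proof -
      have [measurable]: "q \<in> borel_measurable M" using that by auto
      show ?thesis by (rule Bochner_Integration.integrable_bound[OF that(2)]) (auto simp: indicator_def)
    qed
    have em: "emeasure (distr (density M (\<lambda>x. ennreal (q x))) N u) E =
        ennreal (\<integral>x. indicator E (u x) * q x \<partial>M)"
      if [measurable]: "E \<in> sets N" and q: "integrable M q" "\<And>x. 0 \<le> q x" for E and q :: "'a \<Rightarrow> real"
    proof -
      have [measurable]: "q \<in> borel_measurable M" using q by auto
      have "emeasure (distr (density M (\<lambda>x. ennreal (q x))) N u) E =
          (\<integral>\<^sup>+x. ennreal (q x) * indicator (u -` E \<inter> space M) x \<partial>M)"
        by (simp add: emeasure_distr emeasure_density)
      also have "\<dots> = (\<integral>\<^sup>+x. ennreal (indicator E (u x) * q x) \<partial>M)"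
        by (intro nn_integral_cong) (auto simp: indicator_def)
      also have "\<dots> = ennreal (\<integral>x. indicator E (u x) * q x \<partial>M)"
        using q(2) by (intro nn_integral_eq_integral ii that) auto
      finally show ?thesis .
    qed
    have eq: "distr (density M (\<lambda>x. ennreal (p x))) N u = distr (density M (\<lambda>x. ennreal (n x))) N u"
    proof (rule measure_eqI)
      fix E assume "E \<in> sets (distr (density M (\<lambda>x. ennreal (p x))) N u)"
      then have E: "E \<in> sets N" by simp
      have "0 = (\<integral>x. indicator E (u x) * p x - indicator E (u x) * n x \<partial>M)"
        using zero[OF E] unfolding pn(1) by (simp add: right_diff_distrib)
      also have "\<dots> = (\<integral>x. indicator E (u x) * p x \<partial>M) - (\<integral>x. indicator E (u x) * n x \<partial>M)"
        by (rule Bochner_Integration.integral_diff) (intro ii E p n)+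
      finally show "emeasure (distr (density M (\<lambda>x. ennreal (p x))) N u) E =
          emeasure (distr (density M (\<lambda>x. ennreal (n x))) N u) E"
        using em[OF E p pn(2)] em[OF E n pn(3)] by simp
    qed simp
    have iq: "(\<integral>y. \<psi> y \<partial>distr (density M (\<lambda>x. ennreal (q x))) N u) = (\<integral>x. \<psi> (u x) * of_real (q x) \<partial>M)"
      if [measurable]: "q \<in> borel_measurable M" and "\<And>x. 0 \<le> q x" for q :: "'a \<Rightarrow> real"
      using that by (simp add: integral_distr integral_density scaleR_conv_of_real mult.commute)
    have "(\<integral>x. \<psi> (u x) * of_real (p x) \<partial>M) = (\<integral>x. \<psi> (u x) * of_real (n x) \<partial>M)"
      using iq[of p] iq[of n] pn(2,3) unfolding eq by simp
    moreover have "(\<integral>x. \<psi> (u x) * of_real (G x) \<partial>M) =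
        (\<integral>x. \<psi> (u x) * of_real (p x) - \<psi> (u x) * of_real (n x) \<partial>M)"
      unfolding pn(1) by (simp add: right_diff_distrib)
    moreover have "\<dots> = (\<integral>x. \<psi> (u x) * of_real (p x) \<partial>M) - (\<integral>x. \<psi> (u x) * of_real (n x) \<partial>M)"
      using p n by (intro Bochner_Integration.integral_diff bi) auto
    ultimately show ?thesis by simp
  qed
  have cF: "integrable M (\<lambda>x. Re (F x))" "integrable M (\<lambda>x. Im (F x))" using F by auto
  have zF: "(\<integral>x. indicator E (u x) * Re (F x) \<partial>M) = 0" "(\<integral>x. indicator E (u x) * Im (F x) \<partial>M) = 0"
    if [measurable]: "E \<in> sets N" for E
  proof -
    have [measurable]: "F \<in> borel_measurable M" using F by auto
    have i: "integrable M (\<lambda>x. indicator E (u x) * F x)"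
      by (rule Bochner_Integration.integrable_bound[OF F]) (auto simp: indicator_def)
    have "(\<lambda>x. indicator E (u x) * Re (F x)) = (\<lambda>x. Re (indicator E (u x) * F x))"
      "(\<lambda>x. indicator E (u x) * Im (F x)) = (\<lambda>x. Im (indicator E (u x) * F x))"
      by (auto simp: indicator_def)
    then show "(\<integral>x. indicator E (u x) * Re (F x) \<partial>M) = 0" "(\<integral>x. indicator E (u x) * Im (F x) \<partial>M) = 0"
      using zero[OF that] integral_Re[OF i] integral_Im[OF i] by simp_all
  qed
  have "(\<integral>x. \<psi> (u x) * F x \<partial>M) = (\<integral>x. \<psi> (u x) * of_real (Re (F x)) + \<i> * (\<psi> (u x) * of_real (Im (F x))) \<partial>M)"
  proof (intro Bochner_Integration.integral_cong refl)
    fix x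
    have "\<psi> (u x) * F x = \<psi> (u x) * (of_real (Re (F x)) + \<i> * of_real (Im (F x)))"
      using complex_eq[of "F x"] by simp
    then show "\<psi> (u x) * F x = \<psi> (u x) * of_real (Re (F x)) + \<i> * (\<psi> (u x) * of_real (Im (F x)))"
      by (simp add: algebra_simps)
  qed
  also have "\<dots> = (\<integral>x. \<psi> (u x) * of_real (Re (F x)) \<partial>M) + \<i> * (\<integral>x. \<psi> (u x) * of_real (Im (F x)) \<partial>M)"
    using bi[of "\<lambda>x. of_real (Re (F x))"] bi[of "\<lambda>x. of_real (Im (F x))"] cF by simp
  also have "\<dots> = 0" using real[OF cF(1) zF(1)] real[OF cF(2) zF(2)] by simp
  finally show ?thesis .
qed

section \<open>Measures annihilating the bidisc algebra\<close>

lemma uniform_measure_01: "uniform_measure lborel {0..1::real} =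
    density lborel (\<lambda>t. ennreal (indicator {0..1} t))"
  unfolding uniform_measure_def by (intro density_cong) (auto simp: divide_ennreal_def indicator_def)

lemma sets_circle_lebesgue: "sets circle_lebesgue = sets circle_borel"
  by (simp add: circle_lebesgue_def)

lemma space_circle_lebesgue: "space circle_lebesgue = sphere 0 1"
  by (simp add: circle_lebesgue_def space_restrict_space)

lemma prob_space_circle_lebesgue: "prob_space circle_lebesgue"
  unfolding circle_lebesgue_def
  by (intro prob_space.prob_space_distr prob_space_uniform_measure measurable_cis_circle) auto

lemma integral_circle_lebesgue:
  fixes f :: "complex \<Rightarrow> complex"
  assumes f: "continuous_on (sphere 0 1) f"
  shows "(\<integral>\<zeta>. f \<zeta> \<partial>circle_lebesgue) = integral {0..1} (\<lambda>t. f (cis (2 * pi * t)))"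
proof -
  have c: "continuous_on {0..1} (\<lambda>t. f (cis (2 * pi * t)))"
    by (rule continuous_on_compose2[OF f]) (auto intro!: continuous_intros)
  have fm: "f \<in> borel_measurable circle_borel"
    by (rule borel_measurable_continuous_on_restrict[OF f])
  have m: "(\<lambda>t. f (cis (2 * pi * t))) \<in> borel_measurable lborel"
    using measurable_compose[OF measurable_cis_circle fm] by (simp cong: measurable_cong_sets)
  have "(\<integral>\<zeta>. f \<zeta> \<partial>circle_lebesgue) = (\<integral>t. f (cis (2 * pi * t)) \<partial>uniform_measure lborel {0..1})"
    unfolding circle_lebesgue_def by (rule integral_distr[OF measurable_cis_circle fm])
  also have "\<dots> = (\<integral>t. indicator {0..1} t *\<^sub>R f (cis (2 * pi * t)) \<partial>lborel)"
    unfolding uniform_measure_01 by (rule integral_density[OF m]) auto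
  also have "\<dots> = integral {0..1} (\<lambda>t. f (cis (2 * pi * t)))"
    using set_borel_integral_eq_integral(2)[OF borel_integrable_atLeastAtMost'[OF c]]
    by (simp add: set_lebesgue_integral_def)
  finally show ?thesis .
qed

text \<open>On the circle \<zeta> - w = \<zeta> (1 - w cnj \<zeta>), which cancels the factor
  \<zeta> in d\<zeta> = 2 pi \<i> \<zeta> dt of Cauchy's integral formula.\<close>

lemma cauchy_mean_formula:
  assumes g: "continuous_on (cball 0 1) g" "g holomorphic_on ball 0 1" and w: "cmod w < 1"
  shows "(\<integral>\<zeta>. g \<zeta> * (1 / (1 - w * cnj \<zeta>)) \<partial>circle_lebesgue) = g w"
proof -
  have ne: "1 - w * cnj \<zeta> \<noteq> 0" if "cmod \<zeta> = 1" for \<zeta>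
    using one_minus_mult_bound(1)[of "cnj \<zeta>" w] w that by (simp add: mult.commute)
  have c: "continuous_on (sphere 0 1) (\<lambda>\<zeta>. g \<zeta> * (1 / (1 - w * cnj \<zeta>)))"
    using ne by (intro continuous_intros continuous_on_subset[OF g(1)]) auto
  have "((\<lambda>u. g u / (u - w)) has_contour_integral (2 * of_real pi * \<i> * g w)) (circlepath 0 1)"
    by (rule Cauchy_integral_circlepath[OF g]) (use w in simp)
  then have "((\<lambda>t. g (circlepath 0 1 t) / (circlepath 0 1 t - w) * vector_derivative (circlepath 0 1) (at t))
      has_integral (2 * of_real pi * \<i> * g w)) {0..1}"
    unfolding has_contour_integral .
  then have *: "((\<lambda>t. 2 * of_real pi * \<i> * (g (cis (2 * pi * t)) * (1 / (1 - w * cnj (cis (2 * pi * t))))))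
      has_integral (2 * of_real pi * \<i> * g w)) {0..1}"
  proof (rule has_integral_eq[rotated])
    fix t :: real
    define \<zeta> where "\<zeta> = cis (2 * pi * t)"
    have e: "exp (2 * of_real pi * \<i> * of_real t) = \<zeta>"
      unfolding \<zeta>_def cis_conv_exp by (simp add: mult_ac)
    have z1: "cmod \<zeta> = 1" unfolding \<zeta>_def by simp
    have zz: "\<zeta> * cnj \<zeta> = 1" using z1 by (simp add: complex_norm_square[symmetric])
    have "\<zeta> - w = \<zeta> * (1 - w * cnj \<zeta>)" using zz by (simp add: algebra_simps)
    moreover have "\<zeta> \<noteq> 0" using z1 by auto
    ultimately have "g \<zeta> / (\<zeta> - w) * \<zeta> = g \<zeta> * (1 / (1 - w * cnj \<zeta>))" by simp
    then have "2 * of_real pi * \<i> * (g \<zeta> / (\<zeta> - w) * \<zeta>) = 2 * of_real pi * \<i> * (g \<zeta> * (1 / (1 - w * cnj \<zeta>)))"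
      by (rule arg_cong)
    moreover have "circlepath 0 1 t = \<zeta>" by (simp add: circlepath e)
    moreover have "vector_derivative (circlepath 0 1) (at t) = 2 * of_real pi * \<i> * \<zeta>"
      by (simp add: vector_derivative_circlepath e)
    ultimately show "g (circlepath 0 1 t) / (circlepath 0 1 t - w) * vector_derivative (circlepath 0 1)
        (at t) =
        2 * of_real pi * \<i> * (g (cis (2 * pi * t)) * (1 / (1 - w * cnj (cis (2 * pi * t)))))"
      unfolding \<zeta>_def[symmetric] by (simp only: mult_ac)
  qed
  have pi0: "2 * of_real pi * \<i> \<noteq> (0::complex)" by simp
  have "((\<lambda>t. g (cis (2 * pi * t)) * (1 / (1 - w * cnj (cis (2 * pi * t))))) has_integral g w) {0..1}"
    using has_integral_mult_right[OF *, of "1 / (2 * of_real pi * \<i>)"] by simp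
  then show ?thesis
    unfolding integral_circle_lebesgue[OF c] by (rule integral_unique)
qed

text \<open>The dominating function depends on x alone, which admits an integrand with an unbounded
  but integrable factor in x.\<close>

lemma iterated_integral_swap:
  fixes f :: "'a \<Rightarrow> 'b \<Rightarrow> complex"
  assumes M: "finite_measure M" and N: "finite_measure N"
    and f[measurable]: "(\<lambda>(x, y). f x y) \<in> borel_measurable (M \<Otimes>\<^sub>M N)"
    and g: "integrable M g" and le: "\<And>x y. \<lbrakk>x \<in> space M; y \<in> space N\<rbrakk> \<Longrightarrow> cmod (f x y) \<le> g x"
  shows "(\<integral>x. (\<integral>y. f x y \<partial>N) \<partial>M) = (\<integral>y. (\<integral>x. f x y \<partial>M) \<partial>N)"
proof -
  interpret M: finite_measure M by fact
  interpret N: finite_measure N by fact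
  interpret pair_sigma_finite M N ..
  have fx: "f x \<in> borel_measurable N" if "x \<in> space M" for x
    using measurable_Pair2[OF f that] by simp
  have "integrable (M \<Otimes>\<^sub>M N) (case_prod f)"
  proof (rule Fubini_integrable)
    show "AE x in M. integrable N (\<lambda>y. case_prod f (x, y))"
      using fx le by (intro AE_I2 N.integrable_const_bound[where B="g _"]) auto
    show "integrable M (\<lambda>x. \<integral>y. norm (case_prod f (x, y)) \<partial>N)"
    proof (rule Bochner_Integration.integrable_bound)
      show "integrable M (\<lambda>x. g x * measure N (space N))" using g by simp
      show "(\<lambda>x. \<integral>y. norm (case_prod f (x, y)) \<partial>N) \<in> borel_measurable M" by measurable
      show "AE x in M. norm (\<integral>y. norm (case_prod f (x, y)) \<partial>N) \<le> norm (g x * measure N (space N))"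
      proof (rule AE_I2)
        fix x assume x: "x \<in> space M"
        have i: "integrable N (\<lambda>y. norm (f x y))"
          using fx[OF x] le[OF x] by (intro N.integrable_const_bound[where B="g x"] AE_I2) auto
        have "norm (\<integral>y. norm (f x y) \<partial>N) = (\<integral>y. norm (f x y) \<partial>N)" by (simp add: abs_of_nonneg)
        also have "\<dots> \<le> (\<integral>y. g x \<partial>N)" using le[OF x] i by (intro integral_mono) auto
        also have "\<dots> = g x * measure N (space N)" by (simp add: mult.commute)
        finally show "norm (\<integral>y. norm (case_prod f (x, y)) \<partial>N) \<le> norm (g x * measure N (space N))" by simp
      qed
    qed
  qed measurable
  from Fubini_integral[OF this] show ?thesis by simp
qed

lemma measurable_closed_bidisc:
  fixes p :: "complex \<times> complex \<Rightarrow> complex"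
  assumes "continuous_on closed_bidisc p" "a \<in> borel_measurable M" "b \<in> borel_measurable M"
    and "\<And>x. x \<in> space M \<Longrightarrow> cmod (a x) \<le> 1" "\<And>x. x \<in> space M \<Longrightarrow> cmod (b x) \<le> 1"
  shows "(\<lambda>x. p (a x, b x)) \<in> borel_measurable M"
proof -
  have "(\<lambda>x. (a x, b x)) \<in> M \<rightarrow>\<^sub>M restrict_space borel closed_bidisc"
    using assms by (intro measurable_restrict_space2 borel_measurable_Pair) (auto simp: closed_bidisc_def)
  from measurable_compose[OF this borel_measurable_continuous_on_restrict[OF assms(1)]] show ?thesis .
qed

lemma measurable_circle_borel_ident: "(\<lambda>x. x) \<in> borel_measurable circle_lebesgue"
  using measurable_restrict_space1[OF measurable_ident] sets_circle_lebesgue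
  by (simp add: id_def cong: measurable_cong_sets)

text \<open>The double Cauchy formula exhibits dilates of functions in the bidisc algebra as averages
  of Cauchy kernels.\<close>

theorem annihilates_bidisc_algebra:
  fixes u1 u2 F :: "'a \<Rightarrow> complex"
  assumes M: "finite_measure M" and F: "integrable M F"
    and u[measurable]: "u1 \<in> borel_measurable M" "u2 \<in> borel_measurable M"
    and u_norm: "\<And>x. x \<in> space M \<Longrightarrow> cmod (u1 x) = 1" "\<And>x. x \<in> space M \<Longrightarrow> cmod (u2 x) = 1"
    and kernels: "\<And>z. \<lbrakk>z \<in> bidisc; fst z \<noteq> 0; snd z \<noteq> 0\<rbrakk> \<Longrightarrow> (\<integral>x. cauchy2 (u1 x, u2 x) z * F x \<partial>M) = 0"
    and p: "p \<in> bidisc_algebra"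
  shows "(\<integral>x. p (u1 x, u2 x) * F x \<partial>M) = 0"
proof -
  have Fm[measurable]: "F \<in> borel_measurable M" using F by auto
  have pc: "continuous_on closed_bidisc p" and ph: "holomorphic2_on p bidisc"
    using p by (auto simp: bidisc_algebra_def)
  have "compact closed_bidisc" unfolding closed_bidisc_def by (intro compact_Times compact_cball)
  then have "bounded (p ` closed_bidisc)" by (intro compact_imp_bounded compact_continuous_image pc)
  then obtain B where B: "\<And>z. z \<in> closed_bidisc \<Longrightarrow> cmod (p z) \<le> B" by (auto simp: bounded_iff)
  have B': "cmod (p (a, b)) \<le> B" if "cmod a \<le> 1" "cmod b \<le> 1" for a b
    using B[of "(a, b)"] that by (simp add: closed_bidisc_def)
  have B0: "0 \<le> B" by (rule order_trans[OF norm_ge_zero B'[of 0 0]]) auto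
  have cl: "finite_measure circle_lebesgue"
    using prob_space_circle_lebesgue by (simp add: prob_space_def)
  note [measurable] = measurable_circle_borel_ident
  have dilate: "(\<integral>x. p (of_real r * of_real r * u1 x, of_real r * of_real r * u2 x) * F x \<partial>M) = 0"
    if r: "0 < r" "r < 1" for r :: real
  proof -
    \<comment> \<open>A one-variable Cauchy kernel at the interior point r \<omega>. The mean
      formula at r s, applied to the function p(r \<omega>) of \<omega>, gives p at r^2 s, whence
      the squared radius. The product of two such kernels is \<open>cauchy2\<close> at a point of
      the open bidisc.\<close>
    define k where "k s \<omega> = 1 / (1 - s * cnj (of_real r * \<omega>))" for s \<omega> :: complex
    have r1: "cmod (of_real r * \<omega>) < 1" if "cmod \<omega> \<le> 1" for \<omega>
    proof -
      have "cmod (of_real r * \<omega>) \<le> r" using that r by (simp add: norm_mult mult_left_le)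
      then show ?thesis using r by linarith
    qed
    have kb: "cmod (k s \<omega>) \<le> 1 / (1 - r)" if "cmod s = 1" "cmod \<omega> = 1" for s \<omega>
      using one_minus_mult_bound(2)[of s "cnj (of_real r * \<omega>)"] that r1[of \<omega>] r
      by (simp add: k_def norm_mult)
    have mean1: "(\<integral>\<omega>. p (of_real r * \<omega>, c) * k s \<omega> \<partial>circle_lebesgue) = p (of_real r * of_real r * s, c)"
      and mean2: "(\<integral>\<omega>. p (c, of_real r * \<omega>) * k s \<omega> \<partial>circle_lebesgue) = p (c, of_real r * of_real r * s)"
      if s: "cmod s = 1" and c: "cmod c < 1" for s c
    proof -
      note sl = holomorphic2_slices[OF ph c]
      have rs: "cmod (of_real r * s) < 1" using r1 s by simp
      have keq: "k s \<omega> = 1 / (1 - of_real r * s * cnj \<omega>)" for \<omega> by (simp add: k_def mult_ac)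
      have sub: "(\<lambda>\<omega>::complex. of_real r * \<omega>) ` cball 0 1 \<subseteq> ball 0 1"
        by (rule image_subsetI) (simp only: mem_ball_0 mem_cball_0 r1)
      have ct: "continuous_on (cball 0 1) (\<lambda>\<omega>::complex. of_real r * \<omega>)" by (intro continuous_intros)
      have hl: "(\<lambda>\<omega>::complex. of_real r * \<omega>) holomorphic_on ball 0 1" by (intro holomorphic_intros)
      have sub': "(\<lambda>\<omega>::complex. of_real r * \<omega>) ` ball 0 1 \<subseteq> ball 0 1"
        by (rule image_subsetI) (simp only: mem_ball_0 r1 less_imp_le)
      have "(\<integral>\<omega>. p (of_real r * \<omega>, c) * (1 / (1 - of_real r * s * cnj \<omega>)) \<partial>circle_lebesgue) =
          p (of_real r * (of_real r * s), c)"
      proof (rule cauchy_mean_formula[OF _ _ rs])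
        show "continuous_on (cball 0 1) (\<lambda>\<omega>. p (of_real r * \<omega>, c))"
          by (rule continuous_on_compose2[OF holomorphic_on_imp_continuous_on[OF sl(1)] ct sub])
        show "(\<lambda>\<omega>. p (of_real r * \<omega>, c)) holomorphic_on ball 0 1"
          using holomorphic_on_compose_gen[OF hl sl(1) sub'] by (simp add: o_def)
      qed
      then show "(\<integral>\<omega>. p (of_real r * \<omega>, c) * k s \<omega> \<partial>circle_lebesgue) = p (of_real r * of_real r * s, c)"
        by (simp only: keq mult.assoc)
      have "(\<integral>\<omega>. p (c, of_real r * \<omega>) * (1 / (1 - of_real r * s * cnj \<omega>)) \<partial>circle_lebesgue) =
          p (c, of_real r * (of_real r * s))"
      proof (rule cauchy_mean_formula[OF _ _ rs])
        show "continuous_on (cball 0 1) (\<lambda>\<omega>. p (c, of_real r * \<omega>))"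
          by (rule continuous_on_compose2[OF holomorphic_on_imp_continuous_on[OF sl(2)] ct sub])
        show "(\<lambda>\<omega>. p (c, of_real r * \<omega>)) holomorphic_on ball 0 1"
          using holomorphic_on_compose_gen[OF hl sl(2) sub'] by (simp add: o_def)
      qed
      then show "(\<integral>\<omega>. p (c, of_real r * \<omega>) * k s \<omega> \<partial>circle_lebesgue) = p (c, of_real r * of_real r * s)"
        by (simp only: keq mult.assoc)
    qed
    have rr: "cmod (of_real r * of_real r * s) < 1" if "cmod s = 1" for s
    proof -
      have "cmod (of_real r * s) \<le> 1" using r1[of s] that by simp
      from r1[OF this] show ?thesis by (simp add: mult.assoc)
    qed
    have inner: "(\<integral>x. p (of_real r * of_real r * u1 x, of_real r * \<omega>2) * k (u2 x) \<omega>2 * F x \<partial>M) = 0"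
      if \<omega>2: "cmod \<omega>2 = 1" for \<omega>2
    proof -
      have "(\<integral>x. p (of_real r * of_real r * u1 x, of_real r * \<omega>2) * k (u2 x) \<omega>2 * F x \<partial>M) =
          (\<integral>x. (\<integral>\<omega>1. p (of_real r * \<omega>1, of_real r * \<omega>2) * k (u1 x) \<omega>1 *
              (k (u2 x) \<omega>2 * F x) \<partial>circle_lebesgue) \<partial>M)"
      proof (rule Bochner_Integration.integral_cong[OF refl])
        fix x assume x: "x \<in> space M"
        show "p (of_real r * of_real r * u1 x, of_real r * \<omega>2) * k (u2 x) \<omega>2 * F x =
          (\<integral>\<omega>1. p (of_real r * \<omega>1, of_real r * \<omega>2) * k (u1 x) \<omega>1 * (k (u2 x) \<omega>2 * F x) \<partial>circle_lebesgue)"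
          unfolding integral_mult_left_zero mean1[OF u_norm(1)[OF x] r1[OF order.eq_iff[THEN iffD1, THEN
              conjunct1, OF \<omega>2]]]
          by (simp only: mult.assoc)
      qed
      also have "\<dots> = (\<integral>\<omega>1. (\<integral>x. p (of_real r * \<omega>1, of_real r * \<omega>2) * k (u1 x) \<omega>1 *
          (k (u2 x) \<omega>2 * F x) \<partial>M) \<partial>circle_lebesgue)"
      proof (rule iterated_integral_swap[OF M cl])
        have "(\<lambda>z. p (of_real r * snd z, of_real r * \<omega>2)) \<in> borel_measurable (M \<Otimes>\<^sub>M circle_lebesgue)"
          using r1 \<omega>2 by (intro measurable_closed_bidisc[OF pc]) (auto simp: space_pair_measure
              space_circle_lebesgue less_imp_le simp del: norm_mult)
        then show "(\<lambda>(x, \<omega>1). p (of_real r * \<omega>1, of_real r * \<omega>2) * k (u1 x) \<omega>1 *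
            (k (u2 x) \<omega>2 * F x)) \<in> borel_measurable (M \<Otimes>\<^sub>M circle_lebesgue)"
          unfolding split_beta k_def by measurable
        show "integrable M (\<lambda>x. B * (1 / (1 - r)) * ((1 / (1 - r)) * cmod (F x)))"
          using F by (intro integrable_mult_right integrable_norm)
        fix x \<omega>1 assume x: "x \<in> space M" and "\<omega>1 \<in> space circle_lebesgue"
        then have \<omega>1: "cmod \<omega>1 = 1" by (simp add: space_circle_lebesgue)
        show "cmod (p (of_real r * \<omega>1, of_real r * \<omega>2) * k (u1 x) \<omega>1 * (k (u2 x) \<omega>2 * F x)) \<le>
            B * (1 / (1 - r)) * ((1 / (1 - r)) * cmod (F x))"
          unfolding norm_mult[of "_ * _"] norm_mult[of "p _"] norm_mult[of "k _ _"]
          using kb[OF u_norm(1)[OF x] \<omega>1] kb[OF u_norm(2)[OF x] \<omega>2] B0 r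
            B'[OF less_imp_le[OF r1] less_imp_le[OF r1], of \<omega>1 \<omega>2] \<omega>1 \<omega>2
          by (intro mult_mono mult_nonneg_nonneg) auto
      qed
      also have "\<dots> = (\<integral>\<omega>1. 0 \<partial>circle_lebesgue)"
      proof (rule Bochner_Integration.integral_cong[OF refl])
        fix \<omega>1 assume "\<omega>1 \<in> space circle_lebesgue"
        then have \<omega>1: "cmod \<omega>1 = 1" by (simp add: space_circle_lebesgue)
        have "(\<integral>x. p (of_real r * \<omega>1, of_real r * \<omega>2) * k (u1 x) \<omega>1 * (k (u2 x) \<omega>2 * F x) \<partial>M) =
            (\<integral>x. p (of_real r * \<omega>1, of_real r * \<omega>2) *
                (cauchy2 (u1 x, u2 x) (of_real r * \<omega>1, of_real r * \<omega>2) * F x) \<partial>M)"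
          unfolding k_def cauchy2_def fst_conv snd_conv by (simp only: mult.assoc)
        also have "\<dots> = p (of_real r * \<omega>1, of_real r * \<omega>2) *
            (\<integral>x. cauchy2 (u1 x, u2 x) (of_real r * \<omega>1, of_real r * \<omega>2) * F x \<partial>M)"
          by (rule integral_mult_right_zero)
        \<comment> \<open>Both r \<omega>1 and r \<omega>2 are nonzero, as \<open>kernels\<close>
          demands; \<open>mixed_kernel\<close>, which is to be fed in there, divides by the
          coordinates.\<close>
        also have "(\<integral>x. cauchy2 (u1 x, u2 x) (of_real r * \<omega>1, of_real r * \<omega>2) * F x \<partial>M) = 0"
          using r1[of \<omega>1] r1[of \<omega>2] \<omega>1 \<omega>2 r by (intro kernels) (auto simp: bidisc_def)
        finally show "(\<integral>x. p (of_real r * \<omega>1, of_real r * \<omega>2) * k (u1 x) \<omega>1 * (k (u2 x) \<omega>2 * F x) \<partial>M) = 0"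
          by simp
      qed
      finally show ?thesis by simp
    qed
    have "(\<integral>x. p (of_real r * of_real r * u1 x, of_real r * of_real r * u2 x) * F x \<partial>M) =
        (\<integral>x. (\<integral>\<omega>2. p (of_real r * of_real r * u1 x, of_real r * \<omega>2) * k (u2 x) \<omega>2 * F x \<partial>circle_lebesgue) \<partial>M)"
    proof (rule Bochner_Integration.integral_cong[OF refl])
      fix x assume x: "x \<in> space M"
      show "p (of_real r * of_real r * u1 x, of_real r * of_real r * u2 x) * F x =
        (\<integral>\<omega>2. p (of_real r * of_real r * u1 x, of_real r * \<omega>2) * k (u2 x) \<omega>2 * F x \<partial>circle_lebesgue)"
        unfolding integral_mult_left_zero mean2[OF u_norm(2)[OF x] rr[OF u_norm(1)[OF x]]] ..
    qed
    also have "\<dots> = (\<integral>\<omega>2. (\<integral>x. p (of_real r * of_real r * u1 x, of_real r * \<omega>2) * k (u2 x) \<omega>2 * F x \<partial>M)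
        \<partial>circle_lebesgue)"
    proof (rule iterated_integral_swap[OF M cl])
      have "(\<lambda>z. p (of_real r * of_real r * u1 (fst z), of_real r * snd z)) \<in> borel_measurable (M \<Otimes>\<^sub>M
          circle_lebesgue)"
        using r1 rr u_norm by (intro measurable_closed_bidisc[OF pc])
          (auto simp: space_pair_measure space_circle_lebesgue less_imp_le simp del: norm_mult)
      then show "(\<lambda>(x, \<omega>2). p (of_real r * of_real r * u1 x, of_real r * \<omega>2) * k (u2 x) \<omega>2 * F x) \<in>
          borel_measurable (M \<Otimes>\<^sub>M circle_lebesgue)"
        unfolding split_beta k_def by measurable
      show "integrable M (\<lambda>x. B * (1 / (1 - r)) * cmod (F x))"
        using F by (intro integrable_mult_right integrable_norm)
      fix x \<omega>2 assume x: "x \<in> space M" and "\<omega>2 \<in> space circle_lebesgue"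
      then have \<omega>2: "cmod \<omega>2 = 1" by (simp add: space_circle_lebesgue)
      show "cmod (p (of_real r * of_real r * u1 x, of_real r * \<omega>2) * k (u2 x) \<omega>2 * F x) \<le>
          B * (1 / (1 - r)) * cmod (F x)"
        unfolding norm_mult[of "_ * _" "F x"] norm_mult[of "p _"]
        using kb[OF u_norm(2)[OF x] \<omega>2] B0 r B'[OF less_imp_le[OF rr[OF u_norm(1)[OF x]]] less_imp_le[OF
            r1], of \<omega>2] \<omega>2
        by (intro mult_mono mult_nonneg_nonneg) auto
    qed
    also have "\<dots> = (\<integral>\<omega>2. 0 \<partial>circle_lebesgue)"
      by (rule Bochner_Integration.integral_cong[OF refl]) (rule inner, simp add: space_circle_lebesgue)
    finally show ?thesis by simp
  qed
  \<comment> \<open>Radii increasing from 1/2 to 1; a single Suc would make the first one 0.\<close>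
  define \<rho> where "\<rho> n = 1 - 1 / real (Suc (Suc n))" for n
  have \<rho>: "0 < \<rho> n" "\<rho> n < 1" for n by (auto simp: \<rho>_def field_simps)
  have \<rho>1: "\<rho> \<longlonglongrightarrow> 1"
    unfolding \<rho>_def using tendsto_diff[OF tendsto_const LIMSEQ_Suc[OF LIMSEQ_Suc[OF lim_const_over_n[of
        1]]], of 1] by simp
  have in1: "cmod (of_real (\<rho> n) * of_real (\<rho> n) * s) \<le> 1" if "cmod s = 1" for n s
    using \<rho>[of n] that by (simp add: norm_mult mult_le_one)
  have "(\<lambda>n. \<integral>x. p (of_real (\<rho> n) * of_real (\<rho> n) * u1 x, of_real (\<rho> n) * of_real (\<rho> n) * u2 x) * F x \<partial>M)
      \<longlonglongrightarrow> (\<integral>x. p (u1 x, u2 x) * F x \<partial>M)"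
  proof (rule integral_dominated_convergence[where w="\<lambda>x. B * cmod (F x)"])
    have "(\<lambda>x. p (u1 x, u2 x)) \<in> borel_measurable M"
      using u_norm by (intro measurable_closed_bidisc[OF pc]) auto
    then show "(\<lambda>x. p (u1 x, u2 x) * F x) \<in> borel_measurable M" by measurable
    show "(\<lambda>x. p (of_real (\<rho> n) * of_real (\<rho> n) * u1 x, of_real (\<rho> n) * of_real (\<rho> n) * u2 x) * F x) \<in>
        borel_measurable M" for n
    proof -
      have "(\<lambda>x. p (of_real (\<rho> n) * of_real (\<rho> n) * u1 x, of_real (\<rho> n) * of_real (\<rho> n) * u2 x)) \<in>
          borel_measurable M"
        using u_norm in1 by (intro measurable_closed_bidisc[OF pc]) (auto simp del: norm_mult)
      then show ?thesis by measurable
    qed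
    show "integrable M (\<lambda>x. B * cmod (F x))" using F by (intro integrable_mult_right integrable_norm)
    show "AE x in M. norm (p (of_real (\<rho> n) * of_real (\<rho> n) * u1 x, of_real (\<rho> n) * of_real (\<rho> n) * u2 x)
        * F x) \<le> B * cmod (F x)" for n
      unfolding norm_mult[of "p _"] by (intro AE_I2 mult_right_mono B' in1 u_norm) auto
    show "AE x in M. (\<lambda>n. p (of_real (\<rho> n) * of_real (\<rho> n) * u1 x, of_real (\<rho> n) * of_real (\<rho> n) * u2 x)
        * F x) \<longlonglongrightarrow> p (u1 x, u2 x) * F x"
    proof (rule AE_I2)
      fix x assume x: "x \<in> space M"
      have t: "(\<lambda>n. of_real (\<rho> n) * of_real (\<rho> n) * s) \<longlonglongrightarrow> s" for s :: complex
        using tendsto_mult[OF tendsto_mult[OF tendsto_of_real[OF \<rho>1] tendsto_of_real[OF \<rho>1]]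
            tendsto_const[of s]] by simp
      have "(\<lambda>n. p (of_real (\<rho> n) * of_real (\<rho> n) * u1 x, of_real (\<rho> n) * of_real (\<rho> n) * u2 x)) \<longlonglongrightarrow>
          p (u1 x, u2 x)"
      proof (rule continuous_on_tendsto_compose[OF pc tendsto_Pair[OF t t]])
        show "(u1 x, u2 x) \<in> closed_bidisc" using u_norm x by (auto simp: closed_bidisc_def)
        show "\<forall>\<^sub>F n in sequentially. (of_real (\<rho> n) * of_real (\<rho> n) * u1 x, of_real (\<rho> n) * of_real (\<rho> n)
            * u2 x) \<in> closed_bidisc"
          using in1[OF u_norm(1)[OF x]] in1[OF u_norm(2)[OF x]]
          by (intro always_eventually allI) (simp add: closed_bidisc_def del: norm_mult)
      qed
      then show "(\<lambda>n. p (of_real (\<rho> n) * of_real (\<rho> n) * u1 x, of_real (\<rho> n) * of_real (\<rho> n) * u2 x) * F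
          x) \<longlonglongrightarrow> p (u1 x, u2 x) * F x"
        by (intro tendsto_mult tendsto_const)
    qed
  qed
  then show ?thesis using dilate[OF \<rho>] by (simp add: LIMSEQ_const_iff)
qed

section \<open>Clark measures over null sets of one coordinate\<close>

text \<open>Positivity makes the moments of negative order conjugates of those of positive order, so
  all trigonometric polynomials have equal integrals. Stone-Weierstrass extends this to continuous
  functions, and continuous functions decreasing to the indicator of a closed set give equality on a
  generator stable under intersection.\<close>

theorem circle_measure_eqI:
  fixes M N :: "complex measure"
  assumes M: "finite_measure M" "sets M = sets borel" "AE \<zeta> in M. cmod \<zeta> = 1"
    and N: "finite_measure N" "sets N = sets borel" "AE \<zeta> in N. cmod \<zeta> = 1"
    and moments: "\<And>k. (\<integral>\<zeta>. \<zeta> ^ k \<partial>M) = (\<integral>\<zeta>. \<zeta> ^ k \<partial>N)"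
  shows "M = N"
proof -
  interpret M: finite_measure M by fact
  interpret N: finite_measure N by fact
  have bm: "borel_measurable M = (borel_measurable borel :: (complex \<Rightarrow> 'c::topological_space) set)"
    "borel_measurable N = (borel_measurable borel :: (complex \<Rightarrow> 'c) set)"
    using M(2) N(2) by (auto cong: measurable_cong_sets)
  have sp: "space M = UNIV" "space N = UNIV"
    using sets_eq_imp_space_eq[OF M(2)] sets_eq_imp_space_eq[OF N(2)] by simp_all
  \<comment> \<open>Equality of the integrals of q is strengthened to all products with \<zeta>^j
    cnj \<zeta>^k, which makes the property stable under multiplication by \<zeta> and by cnj
    \<zeta>.\<close>
  define D where "D q \<longleftrightarrow> q \<in> borel_measurable borel \<and> (\<exists>B. \<forall>\<zeta>. cmod \<zeta> = 1 \<longrightarrow> cmod (q \<zeta>) \<le> B) \<and>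
    (\<forall>j k. (\<integral>\<zeta>. \<zeta> ^ j * cnj \<zeta> ^ k * q \<zeta> \<partial>M) = (\<integral>\<zeta>. \<zeta> ^ j * cnj \<zeta> ^ k * q \<zeta> \<partial>N))" for q :: "complex \<Rightarrow> complex"
  have int: "integrable M f \<and> integrable N f"
    if "f \<in> borel_measurable borel" "\<And>\<zeta>. cmod \<zeta> = 1 \<Longrightarrow>
        norm (f \<zeta>) \<le> B" for f :: "complex \<Rightarrow> 'c::{banach,second_countable_topology}" and B
  proof
    show "integrable M f"
      using that bm M(3) by (intro M.integrable_const_bound[where B=B]) auto
    show "integrable N f"
      using that bm N(3) by (intro N.integrable_const_bound[where B=B]) auto
  qed
  have intD: "integrable M (\<lambda>\<zeta>. \<zeta> ^ j * cnj \<zeta> ^ k * q \<zeta>) \<and> integrable N (\<lambda>\<zeta>. \<zeta> ^ j * cnj \<zeta> ^ k * q \<zeta>)"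
      if Dq: "D q" for q j k
  proof -
    obtain B where B: "\<And>\<zeta>. cmod \<zeta> = 1 \<Longrightarrow> cmod (q \<zeta>) \<le> B" using Dq by (auto simp: D_def)
    have [measurable]: "q \<in> borel_measurable borel" using Dq by (simp add: D_def)
    show ?thesis
    proof (rule int)
      show "cmod (\<zeta> ^ j * cnj \<zeta> ^ k * q \<zeta>) \<le> B" if "cmod \<zeta> = 1" for \<zeta>
        using B[OF that] that by (simp add: norm_mult norm_power)
    qed measurable
  qed
  have D1: "D (\<lambda>_. 1)"
    unfolding D_def
  proof (intro conjI allI)
    show "\<exists>B. \<forall>\<zeta>::complex. cmod \<zeta> = 1 \<longrightarrow> cmod 1 \<le> B" by auto
    fix j k :: nat
    \<comment> \<open>On the circle \<zeta>^j cnj \<zeta>^k collapses to a power of \<zeta> or of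
      cnj \<zeta>, depending on the sign of j - k.\<close>
    have *: "(\<integral>\<zeta>. \<zeta> ^ j * cnj \<zeta> ^ k * 1 \<partial>L) =
        (if k \<le> j then (\<integral>\<zeta>. \<zeta> ^ (j - k) \<partial>L) else cnj (\<integral>\<zeta>. \<zeta> ^ (k - j) \<partial>L))"
      if L: "sets L = sets borel" "AE \<zeta> in L. cmod \<zeta> = 1" for L :: "complex measure"
    proof -
      have bl: "borel_measurable L = (borel_measurable borel :: (complex \<Rightarrow> complex) set)"
        using L(1) by (auto cong: measurable_cong_sets)
      have p: "\<zeta> ^ n * cnj \<zeta> ^ n = 1" if "cmod \<zeta> = 1" for \<zeta> n
        using that by (simp add: power_mult_distrib[symmetric] complex_norm_square[symmetric])
      show ?thesis
      proof (cases "k \<le> j")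
        case True
        have "\<zeta> ^ j * cnj \<zeta> ^ k * 1 = \<zeta> ^ (j - k)" if "cmod \<zeta> = 1" for \<zeta>
        proof -
          have "\<zeta> ^ j = \<zeta> ^ (j - k) * \<zeta> ^ k" using True by (simp flip: power_add)
          then show ?thesis using p[OF that, of k] by (simp add: mult.assoc)
        qed
        then have "(\<integral>\<zeta>. \<zeta> ^ j * cnj \<zeta> ^ k * 1 \<partial>L) = (\<integral>\<zeta>. \<zeta> ^ (j - k) \<partial>L)"
          using L(2) by (intro integral_cong_AE) (auto simp: bl)
        then show ?thesis using True by simp
      next
        case False
        have "\<zeta> ^ j * cnj \<zeta> ^ k * 1 = cnj (\<zeta> ^ (k - j))" if "cmod \<zeta> = 1" for \<zeta>
        proof -
          have "cnj \<zeta> ^ k = cnj \<zeta> ^ j * cnj \<zeta> ^ (k - j)" using False by (simp flip: power_add)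
          then show ?thesis using p[OF that, of j] by (simp add: mult.assoc[symmetric])
        qed
        then have "(\<integral>\<zeta>. \<zeta> ^ j * cnj \<zeta> ^ k * 1 \<partial>L) = (\<integral>\<zeta>. cnj (\<zeta> ^ (k - j)) \<partial>L)"
          using L(2) by (intro integral_cong_AE) (auto simp: bl)
        then show ?thesis using False by (simp del: complex_cnj_power)
      qed
    qed
    show "(\<integral>\<zeta>. \<zeta> ^ j * cnj \<zeta> ^ k * 1 \<partial>M) = (\<integral>\<zeta>. \<zeta> ^ j * cnj \<zeta> ^ k * 1 \<partial>N)"
      unfolding *[OF M(2,3)] *[OF N(2,3)] moments ..
  qed simp
  have Dz: "D (\<lambda>\<zeta>. \<zeta> * q \<zeta>)" if "D q" for q
    unfolding D_def
  proof (intro conjI allI)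
    have [measurable]: "q \<in> borel_measurable borel" using that by (simp add: D_def)
    show "(\<lambda>\<zeta>. \<zeta> * q \<zeta>) \<in> borel_measurable borel" by measurable
    show "\<exists>B. \<forall>\<zeta>. cmod \<zeta> = 1 \<longrightarrow> cmod (\<zeta> * q \<zeta>) \<le> B" using that by (auto simp: D_def norm_mult)
    fix j k
    have "(\<lambda>\<zeta>. \<zeta> ^ j * cnj \<zeta> ^ k * (\<zeta> * q \<zeta>)) = (\<lambda>\<zeta>. \<zeta> ^ Suc j * cnj \<zeta> ^ k * q \<zeta>)" by (auto simp: mult_ac)
    then show "(\<integral>\<zeta>. \<zeta> ^ j * cnj \<zeta> ^ k * (\<zeta> * q \<zeta>) \<partial>M) = (\<integral>\<zeta>. \<zeta> ^ j * cnj \<zeta> ^ k * (\<zeta> * q \<zeta>) \<partial>N)"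
      using that unfolding D_def by metis
  qed
  have Dcnj: "D (\<lambda>\<zeta>. cnj \<zeta> * q \<zeta>)" if "D q" for q
    unfolding D_def
  proof (intro conjI allI)
    have [measurable]: "q \<in> borel_measurable borel" using that by (simp add: D_def)
    show "(\<lambda>\<zeta>. cnj \<zeta> * q \<zeta>) \<in> borel_measurable borel" by measurable
    show "\<exists>B. \<forall>\<zeta>. cmod \<zeta> = 1 \<longrightarrow> cmod (cnj \<zeta> * q \<zeta>) \<le> B" using that by (auto simp: D_def norm_mult)
    fix j k
    have "(\<lambda>\<zeta>. \<zeta> ^ j * cnj \<zeta> ^ k * (cnj \<zeta> * q \<zeta>)) = (\<lambda>\<zeta>. \<zeta> ^ j * cnj \<zeta> ^ Suc k * q \<zeta>)" by (auto simp: mult_ac)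
    then show "(\<integral>\<zeta>. \<zeta> ^ j * cnj \<zeta> ^ k * (cnj \<zeta> * q \<zeta>) \<partial>M) = (\<integral>\<zeta>. \<zeta> ^ j * cnj \<zeta> ^ k * (cnj \<zeta> * q \<zeta>) \<partial>N)"
      using that unfolding D_def by metis
  qed
  have Dlin: "D (\<lambda>\<zeta>. a * q \<zeta> + c * q' \<zeta>)" if Dq: "D q" "D q'" for a c q q'
    unfolding D_def
  proof (intro conjI allI)
    have [measurable]: "q \<in> borel_measurable borel"
        "q' \<in> borel_measurable borel" using Dq by (auto simp: D_def)
    show "(\<lambda>\<zeta>. a * q \<zeta> + c * q' \<zeta>) \<in> borel_measurable borel" by measurable
    obtain B B' where B: "\<And>\<zeta>. cmod \<zeta> = 1 \<Longrightarrow> cmod (q \<zeta>) \<le> B" "\<And>\<zeta>. cmod \<zeta> = 1 \<Longrightarrow> cmod (q' \<zeta>) \<le> B'"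
      using Dq by (auto simp: D_def)
    show "\<exists>B. \<forall>\<zeta>. cmod \<zeta> = 1 \<longrightarrow> cmod (a * q \<zeta> + c * q' \<zeta>) \<le> B"
    proof (intro exI[of _ "cmod a * B + cmod c * B'"] allI impI)
      fix \<zeta> :: complex assume "cmod \<zeta> = 1"
      then show "cmod (a * q \<zeta> + c * q' \<zeta>) \<le> cmod a * B + cmod c * B'"
        using B by (intro norm_triangle_le add_mono) (auto simp: norm_mult intro!: mult_left_mono)
    qed
    fix j k
    have e: "(\<lambda>\<zeta>. \<zeta> ^ j * cnj \<zeta> ^ k * (a * q \<zeta> + c * q' \<zeta>)) =
        (\<lambda>\<zeta>. a * (\<zeta> ^ j * cnj \<zeta> ^ k * q \<zeta>) + c * (\<zeta> ^ j * cnj \<zeta> ^ k * q' \<zeta>))"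
      by (simp add: algebra_simps)
    have *: "(\<integral>\<zeta>. a * (\<zeta> ^ j * cnj \<zeta> ^ k * q \<zeta>) + c * (\<zeta> ^ j * cnj \<zeta> ^ k * q' \<zeta>) \<partial>L) =
        a * (\<integral>\<zeta>. \<zeta> ^ j * cnj \<zeta> ^ k * q \<zeta> \<partial>L) + c * (\<integral>\<zeta>. \<zeta> ^ j * cnj \<zeta> ^ k * q' \<zeta> \<partial>L)"
      if "integrable L (\<lambda>\<zeta>. \<zeta> ^ j * cnj \<zeta> ^ k * q \<zeta>)"
          "integrable L (\<lambda>\<zeta>. \<zeta> ^ j * cnj \<zeta> ^ k * q' \<zeta>)" for L :: "complex measure"
      using that by (subst Bochner_Integration.integral_add) auto
    have "(\<integral>\<zeta>. \<zeta> ^ j * cnj \<zeta> ^ k * q \<zeta> \<partial>M) = (\<integral>\<zeta>. \<zeta> ^ j * cnj \<zeta> ^ k * q \<zeta> \<partial>N)"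
      "(\<integral>\<zeta>. \<zeta> ^ j * cnj \<zeta> ^ k * q' \<zeta> \<partial>M) = (\<integral>\<zeta>. \<zeta> ^ j * cnj \<zeta> ^ k * q' \<zeta> \<partial>N)"
      using Dq unfolding D_def by blast+
    then show "(\<integral>\<zeta>. \<zeta> ^ j * cnj \<zeta> ^ k * (a * q \<zeta> + c * q' \<zeta>) \<partial>M) =
        (\<integral>\<zeta>. \<zeta> ^ j * cnj \<zeta> ^ k * (a * q \<zeta> + c * q' \<zeta>) \<partial>N)"
      unfolding e using *[of M] *[of N] intD[OF Dq(1)] intD[OF Dq(2)] by simp
  qed
  \<comment> \<open>Quantifying over q turns a product of polynomial functions into two successive
    multiplications, so that the product case follows from the induction hypotheses.\<close>
  have poly: "\<forall>q. D q \<longrightarrow> D (\<lambda>\<zeta>. of_real (g \<zeta>) * q \<zeta>)" if "real_polynomial_function g" for g :: "complex \<Rightarrow> real"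
    using that
  proof (induction rule: real_polynomial_function.induct)
    case (linear f)
    show ?case
    proof (intro allI impI)
      fix q assume q: "D q"
      \<comment> \<open>A real linear functional on the plane has the form 2 Re (a \<zeta>); its
        values at 1 and \<i> are 2 Re a and - 2 Im a.\<close>
      define a where "a = (of_real (f 1) - \<i> * of_real (f \<i>)) / 2"
      have f: "of_real (f \<zeta>) = a * \<zeta> + cnj a * cnj \<zeta>" for \<zeta>
      proof -
        have "\<zeta> = Re \<zeta> *\<^sub>R 1 + Im \<zeta> *\<^sub>R \<i>" by (simp add: complex_eq_iff)
        then have "f \<zeta> = f (Re \<zeta> *\<^sub>R 1 + Im \<zeta> *\<^sub>R \<i>)" by (rule arg_cong)
        also have "\<dots> = Re \<zeta> * f 1 + Im \<zeta> * f \<i>"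
          using linear by (simp only: bounded_linear.linear linear_add linear_scale real_scaleR_def)
        finally show ?thesis by (simp add: a_def complex_eq_iff diff_divide_distrib)
      qed
      have "D (\<lambda>\<zeta>. a * (\<zeta> * q \<zeta>) + cnj a * (cnj \<zeta> * q \<zeta>))" by (intro Dlin Dz Dcnj q)
      then show "D (\<lambda>\<zeta>. of_real (f \<zeta>) * q \<zeta>)" unfolding f by (simp only: distrib_right mult.assoc)
    qed
  next
    case (const c)
    show ?case
    proof (intro allI impI)
      fix q assume q: "D q"
      have "D (\<lambda>\<zeta>. of_real c * q \<zeta> + 0 * q \<zeta>)" by (intro Dlin q)
      then show "D (\<lambda>\<zeta>. of_real c * q \<zeta>)" by simp
    qed
  next
    case (add f g)
    show ?case
    proof (intro allI impI)
      fix q assume q: "D q"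
      have "D (\<lambda>\<zeta>. 1 * (of_real (f \<zeta>) * q \<zeta>) + 1 * (of_real (g \<zeta>) * q \<zeta>))" using add q by (intro Dlin) auto
      then show "D (\<lambda>\<zeta>. of_real (f \<zeta> + g \<zeta>) * q \<zeta>)" by (simp add: distrib_right)
    qed
  next
    case (mult f g)
    show ?case
    proof (intro allI impI)
      fix q assume q: "D q"
      have "D (\<lambda>\<zeta>. of_real (f \<zeta>) * (of_real (g \<zeta>) * q \<zeta>))" using mult q by blast
      then show "D (\<lambda>\<zeta>. of_real (f \<zeta> * g \<zeta>) * q \<zeta>)" by (simp add: mult.assoc)
    qed
  qed
  have cont: "(\<integral>\<zeta>. h \<zeta> \<partial>M) = (\<integral>\<zeta>. h \<zeta> \<partial>N)" if h: "continuous_on UNIV h" for h :: "complex \<Rightarrow> real"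
  proof -
    have hm: "h \<in> borel_measurable borel" by (rule borel_measurable_continuous_onI[OF h])
    have "compact (h ` sphere 0 1)" by (intro compact_continuous_image continuous_on_subset[OF h]) auto
    then obtain B where B: "\<And>\<zeta>. cmod \<zeta> = 1 \<Longrightarrow> norm (h \<zeta>) \<le> B"
      using compact_imp_bounded by (fastforce simp: bounded_iff)
    define c where "c = measure M (space M) + measure N (space N)"
    have "\<bar>(\<integral>\<zeta>. h \<zeta> \<partial>M) - (\<integral>\<zeta>. h \<zeta> \<partial>N)\<bar> \<le> e * c" if e: "0 < e" for e
    proof -
      obtain g where g: "real_polynomial_function g" and hg: "\<And>x. x \<in> sphere 0 1 \<Longrightarrow> \<bar>h x - g x\<bar> < e"
        by (rule Stone_Weierstrass_real_polynomial_function[OF compact_sphere[of 0 1]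
            continuous_on_subset[OF h] e]) auto
      have gc: "continuous_on UNIV g"
        using g by (simp add: real_polynomial_function_eq continuous_on_polymonial_function)
      have gm: "g \<in> borel_measurable borel" by (rule borel_measurable_continuous_onI[OF gc])
      have "compact (g ` sphere 0 1)" by (intro compact_continuous_image continuous_on_subset[OF gc]) auto
      then obtain B' where B': "\<And>\<zeta>. cmod \<zeta> = 1 \<Longrightarrow> norm (g \<zeta>) \<le> B'"
        using compact_imp_bounded by (fastforce simp: bounded_iff)
      have "D (\<lambda>\<zeta>. of_real (g \<zeta>) * 1)" using poly[OF g] D1 by blast
      then have "(\<integral>\<zeta>. \<zeta> ^ 0 * cnj \<zeta> ^ 0 * (complex_of_real (g \<zeta>) * 1) \<partial>M) =
          (\<integral>\<zeta>. \<zeta> ^ 0 * cnj \<zeta> ^ 0 * (complex_of_real (g \<zeta>) * 1) \<partial>N)"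
        unfolding D_def by blast
      then have gg: "(\<integral>\<zeta>. g \<zeta> \<partial>M) = (\<integral>\<zeta>. g \<zeta> \<partial>N)" by simp
      have d: "integrable L h \<Longrightarrow> integrable L g \<Longrightarrow> finite_measure L \<Longrightarrow> AE \<zeta> in L. cmod \<zeta> = 1 \<Longrightarrow>
          \<bar>(\<integral>\<zeta>. h \<zeta> \<partial>L) - (\<integral>\<zeta>. g \<zeta> \<partial>L)\<bar> \<le> e * measure L (space L)" for L :: "complex measure"
      proof -
        assume L: "integrable L h" "integrable L g" "finite_measure L" "AE \<zeta> in L. cmod \<zeta> = 1"
        interpret L: finite_measure L by fact
        have "\<bar>(\<integral>\<zeta>. h \<zeta> \<partial>L) - (\<integral>\<zeta>. g \<zeta> \<partial>L)\<bar> = norm (\<integral>\<zeta>. h \<zeta> - g \<zeta> \<partial>L)" using L by simp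
        also have "\<dots> \<le> (\<integral>\<zeta>. norm (h \<zeta> - g \<zeta>) \<partial>L)" by (rule integral_norm_bound)
        also have "\<dots> \<le> (\<integral>\<zeta>. e \<partial>L)"
        proof (rule integral_mono_AE)
          show "AE \<zeta> in L. norm (h \<zeta> - g \<zeta>) \<le> e"
            using L(4) by eventually_elim (use hg in \<open>simp add: less_imp_le\<close>)
        qed (use L in auto)
        finally show ?thesis by (simp add: mult.commute)
      qed
      have "\<bar>(\<integral>\<zeta>. h \<zeta> \<partial>M) - (\<integral>\<zeta>. g \<zeta> \<partial>M)\<bar> \<le> e * measure M (space M)"
        using int[OF hm B] int[OF gm B'] by (intro d M) auto
      moreover have "\<bar>(\<integral>\<zeta>. h \<zeta> \<partial>N) - (\<integral>\<zeta>. g \<zeta> \<partial>N)\<bar> \<le> e * measure N (space N)"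
        using int[OF hm B] int[OF gm B'] by (intro d N) auto
      ultimately show ?thesis unfolding gg c_def distrib_left by linarith
    qed
    moreover have "((\<lambda>n. inverse (real (Suc n)) * c) \<longlonglongrightarrow> 0)"
      using tendsto_mult_right[OF LIMSEQ_inverse_real_of_nat, of c] by simp
    ultimately have "\<bar>(\<integral>\<zeta>. h \<zeta> \<partial>M) - (\<integral>\<zeta>. h \<zeta> \<partial>N)\<bar> \<le> 0"
      by (intro LIMSEQ_le_const[of _ 0]) auto
    then show ?thesis by simp
  qed
  have cl: "emeasure M C = emeasure N C" if C: "closed C" for C
  proof (cases "C = {}")
    case False
    define h where "h n \<zeta> = max 0 (1 - real n * infdist \<zeta> C)" for n \<zeta>
    have hc: "continuous_on UNIV (h n)" for n unfolding h_def by (intro continuous_intros)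
    have h01: "norm (h n \<zeta>) \<le> 1" for n \<zeta> unfolding h_def using infdist_nonneg[of \<zeta> C] by simp
    have hlim: "(\<lambda>n. h n \<zeta>) \<longlonglongrightarrow> indicator C \<zeta>" for \<zeta>
    proof (cases "\<zeta> \<in> C")
      case True
      then show ?thesis by (simp add: h_def)
    next
      case nC: False
      have d: "infdist \<zeta> C > 0" by (rule infdist_pos_not_in_closed[OF C False nC])
      obtain n0 :: nat where n0: "1 < real n0 * infdist \<zeta> C" using reals_Archimedean3[OF d] by blast
      have "h n \<zeta> = 0" if "n0 \<le> n" for n
      proof -
        have "real n0 * infdist \<zeta> C \<le> real n * infdist \<zeta> C" using that d by (intro mult_right_mono) auto
        then show ?thesis using n0 by (simp add: h_def)
      qed
      then show ?thesis using nC by (intro tendsto_eventually eventually_sequentiallyI[of n0]) auto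
    qed
    have lim: "(\<lambda>n. \<integral>\<zeta>. h n \<zeta> \<partial>L) \<longlonglongrightarrow> measure L C" if L: "finite_measure L" "sets L =
        sets borel" for L :: "complex measure"
    proof -
      interpret L: finite_measure L by fact
      have bl: "borel_measurable L = (borel_measurable borel :: (complex \<Rightarrow> real) set)"
        using L(2) by (auto cong: measurable_cong_sets)
      have CL: "C \<in> sets L" using C L by simp
      have "(\<lambda>n. \<integral>\<zeta>. h n \<zeta> \<partial>L) \<longlonglongrightarrow> (\<integral>\<zeta>. indicator C \<zeta> \<partial>L)"
        using h01 hlim borel_measurable_continuous_onI[OF hc] C
        by (intro integral_dominated_convergence[where w="\<lambda>_. 1"]) (auto simp: bl)
      then show ?thesis using CL by simp
    qed
    have "measure M C = measure N C"
      using LIMSEQ_unique[OF lim[OF M(1,2)]] lim[OF N(1,2)] cont[OF hc] by simp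
    then show ?thesis by (simp add: M.emeasure_eq_measure N.emeasure_eq_measure)
  qed simp
  show ?thesis
  proof (rule measure_eqI_generator_eq[where E="Collect closed" and \<Omega>=UNIV and A="\<lambda>_. UNIV"])
    show "Int_stable (Collect closed :: complex set set)" by (auto simp: Int_stable_def)
    have "sets borel = sigma_sets UNIV (Collect closed :: complex set set)"
      by (subst borel_eq_closed) simp
    then show "sets M = sigma_sets UNIV (Collect closed)" "sets N = sigma_sets UNIV (Collect closed)"
      using M(2) N(2) by simp_all
  qed (use cl in auto)
qed

text \<open>These test functions reduce annihilation on the bidisc to the disc algebra in the first
  coordinate; the power selects one frequency in the second.\<close>

lemma bidisc_algebra_mult_power:
  assumes g: "continuous_on (cball 0 1) g" "g holomorphic_on ball 0 1"
  shows "(\<lambda>z. g (fst z) * snd z ^ k) \<in> bidisc_algebra"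
  unfolding bidisc_algebra_def
proof (intro CollectI conjI)
  show "continuous_on closed_bidisc (\<lambda>z. g (fst z) * snd z ^ k)"
    unfolding closed_bidisc_def
    by (intro continuous_intros continuous_on_compose2[OF g(1)]) auto
  show "holomorphic2_on (\<lambda>z. g (fst z) * snd z ^ k) bidisc"
    unfolding holomorphic2_on_def
  proof
    fix z assume "z \<in> bidisc"
    then have "fst z \<in> ball 0 1" by (auto simp: bidisc_def)
    then obtain g' where "(g has_field_derivative g') (at (fst z))"
      using g(2) holomorphic_derivI open_ball by blast
    then have "((\<lambda>z. g (fst z)) has_derivative (\<lambda>h. g' * fst h)) (at z within bidisc)"
      unfolding has_field_derivative_def
      by (rule has_derivative_compose[rotated]) (intro derivative_intros)
    moreover have "((\<lambda>z. snd z ^ k) has_derivative (\<lambda>h. of_nat k * snd h * snd z ^ (k - 1))) (at z within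
        bidisc)"
      by (rule has_derivative_power[OF has_derivative_snd[OF has_derivative_ident]])
    ultimately have "((\<lambda>z. g (fst z) * snd z ^ k) has_derivative
        (\<lambda>h. g (fst z) * (of_nat k * snd h * snd z ^ (k - 1)) + g' * fst h * snd z ^ k)) (at z within bidisc)"
      by (rule has_derivative_mult)
    then show "\<exists>a b. ((\<lambda>z. g (fst z) * snd z ^ k) has_derivative (\<lambda>h. a * fst h +
        b * snd h)) (at z within bidisc)"
      by (intro exI[of _ "g' * snd z ^ k"] exI[of _ "g (fst z) * (of_nat k * snd z ^ (k - 1))"])
        (auto elim!: has_derivative_eq_rhs simp: fun_eq_iff algebra_simps)
  qed
qed

text \<open>The same measure as \<open>circle_lebesgue\<close>, moved to the Borel sets of the whole
  plane, where \<open>circle_measure_eqI\<close> and products of Borel measures apply.\<close>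

abbreviation circle_mean :: "complex measure" where
  "circle_mean \<equiv> distr circle_lebesgue borel (\<lambda>x. x)"

lemma prob_space_circle_mean: "prob_space circle_mean"
  by (rule prob_space.prob_space_distr[OF prob_space_circle_lebesgue measurable_circle_borel_ident])

lemma AE_circle_mean: "AE \<zeta> in circle_mean. cmod \<zeta> = 1"
  by (subst AE_distr_iff[OF measurable_circle_borel_ident]) (auto simp: space_circle_lebesgue intro!: AE_I2)

lemma integral_circle_mean:
  fixes f :: "complex \<Rightarrow> complex"
  assumes "f \<in> borel_measurable borel"
  shows "(\<integral>\<zeta>. f \<zeta> \<partial>circle_mean) = (\<integral>\<zeta>. f \<zeta> \<partial>circle_lebesgue)"
  by (rule integral_distr[OF measurable_circle_borel_ident assms])

section \<open>Mixed Fourier coefficients and product structure of a Clark measure\<close>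

context clark
begin

lemma norm_coords: "\<zeta> \<in> space \<sigma> \<Longrightarrow> cmod (fst \<zeta>) = 1" "\<zeta> \<in> space \<sigma> \<Longrightarrow> cmod (snd \<zeta>) = 1"
  by (auto simp: space torus_def)

lemma measurable_coords [measurable]: "fst \<in> borel_measurable \<sigma>" "snd \<in> borel_measurable \<sigma>"
  by (rule measurable_fst_torus[OF sets] measurable_snd_torus[OF sets])+

lemma integrable_bounded:
  fixes f :: "complex \<times> complex \<Rightarrow> complex"
  assumes "f \<in> borel_measurable \<sigma>" "\<And>\<zeta>. \<zeta> \<in> space \<sigma> \<Longrightarrow> cmod (f \<zeta>) \<le> B"
  shows "integrable \<sigma> f"
  by (rule integrable_finite_bounded[OF finite assms])

text \<open>In the variables \<zeta>1 and cnj \<zeta>2, the factor \<zeta>1 cnj \<zeta>2 shifts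
  analytic functions to the frequencies of mixed sign, which pluriharmonicity excludes. Concretely,
  multiplied by a c the integrand becomes (A - 1) (C - 1), and the integrals of its four terms are
  values of the polarized kernel identity that cancel.\<close>

lemma mixed_kernel:
  assumes z: "z \<in> bidisc" "fst z \<noteq> 0" "snd z \<noteq> 0"
  shows "(\<integral>\<zeta>. cauchy2 (fst \<zeta>, cnj (snd \<zeta>)) z * (fst \<zeta> * cnj (snd \<zeta>)) \<partial>\<sigma>) = 0"
proof -
  define h where "h w = (\<alpha> + b w) / (\<alpha> - b w) / 2" for w
  define a c where "a = cnj (fst z)" and "c = cnj (snd z)"
  have ac: "cmod a < 1" "cmod c < 1" "a \<noteq> 0" "c \<noteq> 0" using z by (auto simp: a_def c_def bidisc_def)
  define A where "A \<zeta> = 1 / (1 - fst \<zeta> * a)" for \<zeta> :: "complex \<times> complex"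
  define C where "C \<zeta> = 1 / (1 - c * cnj (snd \<zeta>))" for \<zeta> :: "complex \<times> complex"
  have [measurable]: "A \<in> borel_measurable \<sigma>" "C \<in> borel_measurable \<sigma>"
    unfolding A_def C_def by measurable
  have Ab: "cmod (A \<zeta>) \<le> 1 / (1 - cmod a)" and Cb: "cmod (C \<zeta>) \<le> 1 / (1 - cmod c)"
    and ne: "1 - fst \<zeta> * a \<noteq> 0" "1 - c * cnj (snd \<zeta>) \<noteq> 0" if "\<zeta> \<in> space \<sigma>" for \<zeta>
    using one_minus_mult_bound[of "fst \<zeta>" a] one_minus_mult_bound[of "cnj (snd \<zeta>)" c] norm_coords[OF that] ac
    by (auto simp: A_def C_def mult.commute)
  have i: "integrable \<sigma> A" "integrable \<sigma> C" "integrable \<sigma> (\<lambda>\<zeta>. A \<zeta> * C \<zeta>)" "integrable \<sigma> (\<lambda>\<zeta>. 1 :: complex)"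
  proof -
    show "integrable \<sigma> A" by (rule integrable_bounded[OF _ Ab]) simp
    show "integrable \<sigma> C" by (rule integrable_bounded[OF _ Cb]) simp
    show "integrable \<sigma> (\<lambda>\<zeta>. A \<zeta> * C \<zeta>)"
    proof (rule integrable_bounded)
      fix \<zeta> assume \<zeta>: "\<zeta> \<in> space \<sigma>"
      show "cmod (A \<zeta> * C \<zeta>) \<le> 1 / (1 - cmod a) * (1 / (1 - cmod c))"
        unfolding norm_mult using Ab[OF \<zeta>] Cb[OF \<zeta>] ac by (intro mult_mono) auto
    qed measurable
    show "integrable \<sigma> (\<lambda>\<zeta>. 1 :: complex)" by (rule integrable_bounded[where B=1]) auto
  qed
  have cl: "(\<integral>\<zeta>. cauchy2 \<zeta> w * cauchy2 v \<zeta> \<partial>\<sigma>) =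
      (h v + cnj (h w)) * cauchy2 v w" if "v \<in> bidisc" "w \<in> bidisc" for v w
    using clark_measure_cauchy[OF holomorphic into_disc unimodular clark_measure that]
    unfolding h_def by (simp add: add_divide_distrib)
  \<comment> \<open>A zero coordinate makes the corresponding one-variable kernel equal to 1. So
    these points give the integrals of A C, A, C and 1, each with Cauchy factor 1 on the
    right.\<close>
  have m: "(cnj a, 0) \<in> bidisc" "(0, c) \<in> bidisc" "(0, 0) \<in> bidisc" using ac by (auto simp: bidisc_def)
  have I1: "(\<integral>\<zeta>. A \<zeta> * C \<zeta> \<partial>\<sigma>) = h (0, c) + cnj (h (cnj a, 0))"
    using cl[OF m(2,1)] by (simp add: cauchy2_def A_def C_def)
  have I2: "(\<integral>\<zeta>. A \<zeta> \<partial>\<sigma>) = h (0, 0) + cnj (h (cnj a, 0))"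
    using cl[OF m(3,1)] by (simp add: cauchy2_def A_def)
  have I3: "(\<integral>\<zeta>. C \<zeta> \<partial>\<sigma>) = h (0, c) + cnj (h (0, 0))"
    using cl[OF m(2,3)] by (simp add: cauchy2_def C_def)
  have I4: "(\<integral>\<zeta>. 1 \<partial>\<sigma>) = h (0, 0) + cnj (h (0, 0))"
    using cl[OF m(3,3)] by (simp add: cauchy2_def)
  have "a * c * (\<integral>\<zeta>. cauchy2 (fst \<zeta>, cnj (snd \<zeta>)) z * (fst \<zeta> * cnj (snd \<zeta>)) \<partial>\<sigma>) =
      (\<integral>\<zeta>. a * c * (cauchy2 (fst \<zeta>, cnj (snd \<zeta>)) z * (fst \<zeta> * cnj (snd \<zeta>))) \<partial>\<sigma>)"
    by (rule integral_mult_right_zero[symmetric])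
  also have "\<dots> = (\<integral>\<zeta>. A \<zeta> * C \<zeta> - A \<zeta> - (C \<zeta> - 1) \<partial>\<sigma>)"
  proof (rule Bochner_Integration.integral_cong[OF refl])
    fix \<zeta> assume \<zeta>: "\<zeta> \<in> space \<sigma>"
    have "A \<zeta> - 1 = A \<zeta> * (fst \<zeta> * a)" "C \<zeta> - 1 = C \<zeta> * (c * cnj (snd \<zeta>))"
      using ne[OF \<zeta>] by (simp_all add: A_def C_def divide_simps)
    then have "(A \<zeta> - 1) * (C \<zeta> - 1) = A \<zeta> * (fst \<zeta> * a) * (C \<zeta> * (c * cnj (snd \<zeta>)))" by simp
    moreover have "cauchy2 (fst \<zeta>, cnj (snd \<zeta>)) z = A \<zeta> * C \<zeta>"
      unfolding cauchy2_def A_def C_def a_def c_def by (simp add: mult.commute)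
    ultimately show "a * c * (cauchy2 (fst \<zeta>, cnj (snd \<zeta>)) z * (fst \<zeta> * cnj (snd \<zeta>))) =
        A \<zeta> * C \<zeta> - A \<zeta> - (C \<zeta> - 1)"
      by (simp add: algebra_simps)
  qed
  also have "\<dots> = (\<integral>\<zeta>. A \<zeta> * C \<zeta> \<partial>\<sigma>) - (\<integral>\<zeta>. A \<zeta> \<partial>\<sigma>) - ((\<integral>\<zeta>. C \<zeta> \<partial>\<sigma>) - (\<integral>\<zeta>. 1 \<partial>\<sigma>))"
    using i by (simp only: Bochner_Integration.integral_diff Bochner_Integration.integrable_diff)
  also have "\<dots> = 0" unfolding I1 I2 I3 I4 by simp
  finally show ?thesis using ac by simp
qed

lemma indicator_integrable:
  assumes "integrable \<sigma> F" "E \<in> sets borel"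
  shows "integrable \<sigma> (\<lambda>\<zeta>. indicator E (fst \<zeta>) * F \<zeta> :: complex)"
proof -
  have [measurable]: "F \<in> borel_measurable \<sigma>" "E \<in> sets borel" using assms by auto
  show ?thesis by (rule Bochner_Integration.integrable_bound[OF assms(1)]) (auto simp: indicator_def)
qed

lemma null_Int:
  assumes "Z \<in> sets circle_borel" "emeasure circle_lebesgue Z = 0" "E \<in> sets borel"
  shows "Z \<inter> E \<in> sets circle_borel" "emeasure circle_lebesgue (Z \<inter> E) = 0"
proof -
  have "Z \<in> sets borel \<and> Z \<subseteq> sphere 0 1"
    using assms(1) by (subst (asm) sets_restrict_space_iff) auto
  with assms(3) show "Z \<inter> E \<in> sets circle_borel"
    by (subst sets_restrict_space_iff) auto
  have "emeasure circle_lebesgue (Z \<inter> E) \<le> emeasure circle_lebesgue Z"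
    using assms(1) by (intro emeasure_mono) (auto simp only: sets_circle_lebesgue)
  then show "emeasure circle_lebesgue (Z \<inter> E) = 0" using assms(2) by simp
qed

text \<open>At (\<zeta>1, cnj \<zeta>2) the function g(z1) z2^k times the density \<zeta>1 cnj
  \<zeta>2 is g(\<zeta>1) F, so the push-forward of F d\<sigma> to the first coordinate annihilates
  the disc algebra and the Riesz theorem applies. As it applies to every Borel subset of Z, the
  factor \<zeta>1 in F can be removed by the multiplier cnj \<zeta>1.\<close>

lemma null_moments:
  assumes Z: "Z \<in> sets circle_borel" "emeasure circle_lebesgue Z = 0"
  shows "(\<integral>\<zeta>. indicator Z (fst \<zeta>) * cnj (snd \<zeta>) ^ Suc k \<partial>\<sigma>) = 0"
proof -
  have Zb: "Z \<in> sets borel" "Z \<subseteq> sphere 0 1" using Z(1) by (auto simp: sets_restrict_space)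
  have F1: "integrable \<sigma> (\<lambda>\<zeta>. fst \<zeta> * cnj (snd \<zeta>))"
    by (rule integrable_bounded[where B=1]) (auto simp: norm_mult norm_coords)
  define F where "F \<zeta> = cnj (snd \<zeta>) ^ k * (fst \<zeta> * cnj (snd \<zeta>))" for \<zeta> :: "complex \<times> complex"
  have F: "integrable \<sigma> F"
  proof (rule integrable_bounded[where B=1])
    show "F \<in> borel_measurable \<sigma>" unfolding F_def by measurable
  qed (auto simp: F_def norm_mult norm_power norm_coords)
  have null: "(\<integral>\<zeta>. indicator Y (fst \<zeta>) * F \<zeta> \<partial>\<sigma>) = 0"
    if Y: "Y \<in> sets circle_borel" "emeasure circle_lebesgue Y = 0" for Y
  proof (rule F_and_M_Riesz[OF F _ _ _ Y])
    fix g assume g: "continuous_on (cball 0 1) g" "g holomorphic_on ball 0 1"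
    have "(\<integral>\<zeta>. (\<lambda>z. g (fst z) * snd z ^ k) (fst \<zeta>, cnj (snd \<zeta>)) * (fst \<zeta> * cnj (snd \<zeta>)) \<partial>\<sigma>) = 0"
      by (rule annihilates_bidisc_algebra[OF finite F1 _ _ _ _ mixed_kernel bidisc_algebra_mult_power[OF g]])
        (auto simp: norm_coords)
    then show "(\<integral>\<zeta>. g (fst \<zeta>) * F \<zeta> \<partial>\<sigma>) = 0" by (simp add: F_def mult.assoc)
  qed (auto simp: norm_coords)
  \<comment> \<open>The indicator makes conjugation a bounded multiplier on the whole plane, as
    \<open>integral_multiplier_zero\<close> requires over \<open>borel\<close>.\<close>
  have "(\<integral>\<zeta>. (indicator (sphere 0 1) (fst \<zeta>) * cnj (fst \<zeta>)) * (indicator Z (fst \<zeta>) * F \<zeta>) \<partial>\<sigma>) = 0"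
  proof (rule integral_multiplier_zero[where u=fst and N=borel and B=1])
    show "integrable \<sigma> (\<lambda>\<zeta>. indicator Z (fst \<zeta>) * F \<zeta>)" by (rule indicator_integrable[OF F Zb(1)])
    have [measurable]: "sphere (0::complex) 1 \<in> sets borel" "cnj \<in> borel_measurable borel"
      by (auto intro!: borel_measurable_continuous_onI continuous_on_cnj continuous_on_id)
    show "(\<lambda>y. indicator (sphere 0 1) y * cnj y) \<in> borel_measurable borel" by measurable
    show "cmod (indicator (sphere 0 1) y * cnj y) \<le> 1" for y by (auto simp: indicator_def)
    fix E :: "complex set" assume E: "E \<in> sets borel"
    have "(\<integral>\<zeta>. indicator (Z \<inter> E) (fst \<zeta>) * F \<zeta> \<partial>\<sigma>) = 0"
      by (rule null[OF null_Int[OF Z E]])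
    then show "(\<integral>\<zeta>. indicator E (fst \<zeta>) * (indicator Z (fst \<zeta>) * F \<zeta>) \<partial>\<sigma>) = 0"
      by (simp add: indicator_inter_arith mult_ac)
  qed measurable
  moreover have "(\<integral>\<zeta>. (indicator (sphere 0 1) (fst \<zeta>) * cnj (fst \<zeta>)) * (indicator Z (fst \<zeta>) * F \<zeta>) \<partial>\<sigma>) =
      (\<integral>\<zeta>. indicator Z (fst \<zeta>) * cnj (snd \<zeta>) ^ Suc k \<partial>\<sigma>)"
  proof (rule Bochner_Integration.integral_cong[OF refl])
    fix \<zeta> assume \<zeta>: "\<zeta> \<in> space \<sigma>"
    have "fst \<zeta> * cnj (fst \<zeta>) = 1"
      using norm_coords(1)[OF \<zeta>] complex_norm_square[of "fst \<zeta>"] by simp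
    then have "cnj (fst \<zeta>) * F \<zeta> = cnj (snd \<zeta>) ^ Suc k"
      unfolding F_def by (simp add: mult_ac)
    then show "(indicator (sphere 0 1) (fst \<zeta>) * cnj (fst \<zeta>)) * (indicator Z (fst \<zeta>) * F \<zeta>) =
        indicator Z (fst \<zeta>) * cnj (snd \<zeta>) ^ Suc k"
      using norm_coords(1)[OF \<zeta>] by (simp add: mult.left_commute)
  qed
  ultimately show ?thesis by simp
qed

text \<open>By the F. and M. Riesz theorem, over a null set of the first coordinate a Clark measure
  has no mixed Fourier coefficients, so that it is a product with Lebesgue measure there.\<close>

lemma slice_over_null_set:
  assumes Z: "Z \<in> sets circle_borel" "emeasure circle_lebesgue Z = 0"
  shows "distr (density \<sigma> (\<lambda>\<zeta>. ennreal (indicator Z (fst \<zeta>)))) borel snd =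
    density circle_mean (\<lambda>_. ennreal (\<integral>\<zeta>. indicator Z (fst \<zeta>) \<partial>\<sigma>))"
proof (rule circle_measure_eqI)
  interpret finite_measure \<sigma> by (rule finite)
  have Zb[measurable]: "Z \<in> sets borel" using Z(1) by (auto simp: sets_restrict_space)
  define c where "c = (\<integral>\<zeta>. indicator Z (fst \<zeta>) \<partial>\<sigma> :: real)"
  have c0: "0 \<le> c" unfolding c_def by (rule Bochner_Integration.integral_nonneg) auto
  define D where "D = density \<sigma> (\<lambda>\<zeta>. ennreal (indicator Z (fst \<zeta>)))"
  have sD: "snd \<in> D \<rightarrow>\<^sub>M borel" unfolding D_def by measurable
  have fD: "finite_measure D"
  proof
    have "emeasure D (space D) \<le> (\<integral>\<^sup>+\<zeta>. 1 \<partial>\<sigma>)"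
      unfolding D_def by (subst emeasure_density) (simp, simp, rule nn_integral_mono, simp add: indicator_def)
    also have "\<dots> < \<infinity>" using emeasure_finite[of "space \<sigma>"] by (simp add: less_top[symmetric])
    finally show "emeasure D (space D) \<noteq> \<infinity>" by simp
  qed
  show "finite_measure (distr D borel snd)"
    using finite_measure.finite_measure_distr[OF fD sD] .
  show "AE \<zeta> in distr D borel snd. cmod \<zeta> = 1"
    unfolding D_def by (subst AE_distr_iff) (auto simp: AE_density norm_coords)
  interpret C: prob_space circle_mean by (rule prob_space_circle_mean)
  show "finite_measure (density circle_mean (\<lambda>_. ennreal c))"
    by (rule finite_measureI) (simp add: emeasure_density_const C.emeasure_space_1 ennreal_mult_eq_top_iff)
  show "AE \<zeta> in density circle_mean (\<lambda>_. ennreal c). cmod \<zeta> = 1"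
    using AE_circle_mean by (subst AE_density) (auto elim: eventually_mono)
  fix k
  have 1: "(\<integral>\<zeta>. \<zeta> ^ k \<partial>distr D borel snd) = (\<integral>\<zeta>. indicator Z (fst \<zeta>) * snd \<zeta> ^ k \<partial>\<sigma>)"
    unfolding D_def by (subst integral_distr, simp, simp, subst integral_density)
      (auto simp: indicator_def scaleR_conv_of_real intro!: Bochner_Integration.integral_cong)
  \<comment> \<open>With 0 ^ 0 = 1, one formula covers the total mass c and the vanishing moments of
    higher order.\<close>
  have 2: "(\<integral>\<zeta>. \<zeta> ^ k \<partial>density circle_mean (\<lambda>_. ennreal c)) = of_real c * 0 ^ k"
  proof -
    have "(\<integral>\<zeta>. \<zeta> ^ k \<partial>density circle_mean (\<lambda>_. ennreal c)) = (\<integral>\<zeta>. c *\<^sub>R \<zeta> ^ k \<partial>circle_mean)"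
      using c0 by (intro integral_density) auto
    also have "\<dots> = of_real c * (\<integral>\<zeta>. \<zeta> ^ k \<partial>circle_mean)" by (simp add: scaleR_conv_of_real)
    also have "(\<integral>\<zeta>. \<zeta> ^ k \<partial>circle_mean) = 0 ^ k"
    proof -
      have "(\<integral>\<zeta>. \<zeta> ^ k * (1 / (1 - 0 * cnj \<zeta>)) \<partial>circle_lebesgue) = 0 ^ k"
        by (rule cauchy_mean_formula) (auto intro!: continuous_intros holomorphic_intros)
      then show ?thesis by (subst integral_circle_mean) auto
    qed
    finally show ?thesis .
  qed
  show "(\<integral>\<zeta>. \<zeta> ^ k \<partial>distr D borel snd) = (\<integral>\<zeta>. \<zeta> ^ k \<partial>density circle_mean (\<lambda>_. ennreal c))"
  proof (cases k)
    case 0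
    have "(\<integral>\<zeta>. indicator Z (fst \<zeta>) \<partial>\<sigma>) = complex_of_real c"
    proof -
      have "(\<integral>\<zeta>. indicator Z (fst \<zeta>) \<partial>\<sigma>) = (\<integral>\<zeta>. complex_of_real (indicator Z (fst \<zeta>)) \<partial>\<sigma>)"
        by (intro Bochner_Integration.integral_cong) (auto simp: indicator_def)
      then show ?thesis unfolding c_def integral_complex_of_real .
    qed
    then show ?thesis unfolding 1 2 using 0 by simp
  next
    case (Suc n)
    have "(\<integral>\<zeta>. indicator Z (fst \<zeta>) * snd \<zeta> ^ Suc n \<partial>\<sigma>) =
        (\<integral>\<zeta>. cnj (indicator Z (fst \<zeta>) * cnj (snd \<zeta>) ^ Suc n) \<partial>\<sigma>)"
      by (intro Bochner_Integration.integral_cong) (auto simp: indicator_def)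
    also have "\<dots> = 0" unfolding Bochner_Integration.integral_cnj null_moments[OF Z] by simp
    finally have "(\<integral>\<zeta>. indicator Z (fst \<zeta>) * snd \<zeta> ^ k \<partial>\<sigma>) = 0" by (simp only: Suc)
    then show ?thesis unfolding 1 2 using Suc by simp
  qed
qed simp_all

text \<open>Applied to the null sets Z \<inter> A for arbitrary Borel A,
  \<open>slice_over_null_set\<close> evaluates the restricted measure on all rectangles A \<times>
  B. Hence the restriction is the product of its first marginal with Lebesgue measure, and Tonelli's
  theorem applies.\<close>

lemma nn_integral_over_null_set:
  assumes Z: "Z \<in> sets circle_borel" "emeasure circle_lebesgue Z = 0"
    and \<phi>[measurable]: "\<phi> \<in> borel_measurable borel"
  shows "(\<integral>\<^sup>+\<zeta>. indicator Z (fst \<zeta>) * \<phi> \<zeta> \<partial>\<sigma>) =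
    (\<integral>\<^sup>+\<zeta>. indicator Z (fst \<zeta>) * (\<integral>\<^sup>+v. \<phi> (fst \<zeta>, v) \<partial>circle_mean) \<partial>\<sigma>)"
proof -
  interpret finite_measure \<sigma> by (rule finite)
  interpret C: prob_space circle_mean by (rule prob_space_circle_mean)
  have Zb[measurable]: "Z \<in> sets borel" using Z(1) by (auto simp: sets_restrict_space)
  define D where "D = density \<sigma> (\<lambda>\<zeta>. ennreal (indicator Z (fst \<zeta>)))"
  have setsD: "sets D = sets \<sigma>" by (simp add: D_def)
  have sD[measurable]: "fst \<in> D \<rightarrow>\<^sub>M borel" unfolding D_def by measurable
  have iD[measurable]: "(\<lambda>x. x) \<in> D \<rightarrow>\<^sub>M borel"
    by (rule borel_measurable_torus) (simp_all add: setsD sets)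
  have i\<sigma>[measurable]: "(\<lambda>x. x) \<in> \<sigma> \<rightarrow>\<^sub>M borel"
    by (rule borel_measurable_torus) (simp_all add: sets)
  have emD: "emeasure D (space D) < \<infinity>"
  proof -
    have "emeasure D (space D) \<le> (\<integral>\<^sup>+\<zeta>. 1 \<partial>\<sigma>)"
      unfolding D_def by (subst emeasure_density) (simp, simp, rule nn_integral_mono, simp add: indicator_def)
    also have "\<dots> < \<infinity>" using emeasure_finite[of "space \<sigma>"] by (simp add: less_top[symmetric])
    finally show ?thesis .
  qed
  then have fD: "finite_measure D" by (intro finite_measureI) auto
  have \<tau>: "emeasure (distr D borel fst) A = ennreal (\<integral>\<zeta>. indicator (Z \<inter> A) (fst \<zeta>) \<partial>\<sigma>)"
      if [measurable]: "A \<in> sets borel" for A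
  proof -
    have "emeasure (distr D borel fst) A = emeasure D (fst -` A \<inter> space D)"
        by (rule emeasure_distr) measurable
    also have "\<dots> = (\<integral>\<^sup>+\<zeta>. ennreal (indicator Z (fst \<zeta>)) * indicator (fst -` A \<inter> space D) \<zeta> \<partial>\<sigma>)"
      unfolding D_def by (rule emeasure_density) (auto intro!: measurable_sets[OF measurable_coords(1)])
    also have "\<dots> = (\<integral>\<^sup>+\<zeta>. ennreal (indicator (Z \<inter> A) (fst \<zeta>)) \<partial>\<sigma>)"
      by (intro nn_integral_cong) (auto simp: indicator_def D_def)
    also have "\<dots> = ennreal (\<integral>\<zeta>. indicator (Z \<inter> A) (fst \<zeta>) \<partial>\<sigma>)"
      by (intro nn_integral_eq_integral integrable_const_bound[where B=1]) (auto simp: indicator_def)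
    finally show ?thesis .
  qed
  have eq: "distr D borel fst \<Otimes>\<^sub>M circle_mean = distr D borel (\<lambda>x. x)"
  proof (rule pair_measure_eqI)
    show "sigma_finite_measure (distr D borel fst)"
      using finite_measure.finite_measure_distr[OF fD sD] by (simp add: finite_measure_def)
    show "sigma_finite_measure circle_mean" ..
    show "sets (distr D borel fst \<Otimes>\<^sub>M circle_mean) = sets (distr D borel (\<lambda>x. x))"
      by (simp add: borel_prod[symmetric] cong: sets_pair_measure_cong)
    fix A B assume "A \<in> sets (distr D borel fst)" "B \<in> sets circle_mean"
    then have [measurable]: "A \<in> sets borel" "B \<in> sets borel" by simp_all
    have AB[measurable]: "A \<times> B \<in> sets borel" by (simp add: borel_prod[symmetric])
    have "emeasure (distr D borel (\<lambda>x. x)) (A \<times> B) = emeasure D ((A \<times> B) \<inter> space D)"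
      by (subst emeasure_distr) (auto simp: vimage_def Int_def)
    also have "\<dots> = (\<integral>\<^sup>+\<zeta>. ennreal (indicator Z (fst \<zeta>)) * indicator ((A \<times> B) \<inter> space D) \<zeta> \<partial>\<sigma>)"
      unfolding D_def using measurable_sets[OF i\<sigma> AB]
          by (intro emeasure_density) (auto simp: vimage_def Int_def)
    also have "\<dots> = (\<integral>\<^sup>+\<zeta>. ennreal (indicator (Z \<inter> A) (fst \<zeta>)) * indicator (snd -` B \<inter> space \<sigma>) \<zeta> \<partial>\<sigma>)"
      by (intro nn_integral_cong) (auto simp: indicator_def D_def)
    also have "\<dots> = emeasure (density \<sigma> (\<lambda>\<zeta>. ennreal (indicator (Z \<inter> A) (fst \<zeta>)))) (snd -` B \<inter> space \<sigma>)"
      by (rule emeasure_density[symmetric]) (auto intro!: measurable_sets[OF measurable_coords(2)])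
    also have "\<dots> = emeasure (distr (density \<sigma> (\<lambda>\<zeta>. ennreal (indicator (Z \<inter> A) (fst \<zeta>)))) borel snd) B"
      by (subst emeasure_distr) auto
    also have "\<dots> = emeasure (density circle_mean (\<lambda>_. ennreal (\<integral>\<zeta>. indicator (Z \<inter> A) (fst \<zeta>) \<partial>\<sigma>))) B"
      using slice_over_null_set[OF null_Int[OF Z, of A]] by simp
    also have "\<dots> = ennreal (\<integral>\<zeta>. indicator (Z \<inter> A) (fst \<zeta>) \<partial>\<sigma>) * emeasure circle_mean B"
      by (rule emeasure_density_const) simp
    finally show "emeasure (distr D borel fst) A * emeasure circle_mean B =
        emeasure (distr D borel (\<lambda>x. x)) (A \<times> B)"
      by (simp only: \<tau>[OF \<open>A \<in> sets borel\<close>])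
  qed
  have \<phi>': "\<phi> \<in> borel_measurable (distr D borel fst \<Otimes>\<^sub>M circle_mean)"
    using \<phi> by (simp add: borel_prod[symmetric] eq cong: measurable_cong_sets)
  have \<psi>[measurable]: "(\<lambda>a. \<integral>\<^sup>+v. \<phi> (a, v) \<partial>circle_mean) \<in> borel_measurable borel"
    using C.borel_measurable_nn_integral_fst[OF \<phi>'] by simp
  have "(\<integral>\<^sup>+\<zeta>. indicator Z (fst \<zeta>) * \<phi> \<zeta> \<partial>\<sigma>) = (\<integral>\<^sup>+\<zeta>. \<phi> \<zeta> \<partial>distr D borel (\<lambda>x. x))"
  proof -
    have [measurable]: "\<phi> \<in> borel_measurable \<sigma>" by (rule borel_measurable_torus[OF sets \<phi>])
    show ?thesis
      by (simp add: nn_integral_distr D_def nn_integral_density ennreal_indicator del: distr_id2)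
  qed
  also have "\<dots> = (\<integral>\<^sup>+a. (\<integral>\<^sup>+v. \<phi> (a, v) \<partial>circle_mean) \<partial>distr D borel fst)"
    unfolding C.nn_integral_fst[OF \<phi>'] eq ..
  also have "\<dots> = (\<integral>\<^sup>+\<zeta>. (\<integral>\<^sup>+v. \<phi> (fst \<zeta>, v) \<partial>circle_mean) \<partial>D)"
    by (rule nn_integral_distr) measurable
  also have "\<dots> = (\<integral>\<^sup>+\<zeta>. indicator Z (fst \<zeta>) * (\<integral>\<^sup>+v. \<phi> (fst \<zeta>, v) \<partial>circle_mean) \<partial>\<sigma>)"
    unfolding D_def by (subst nn_integral_density) (auto simp: ennreal_indicator)
  finally show ?thesis .
qed

text \<open>By \<open>slice_over_null_set\<close>, replacing c by its mean K leaves the integral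
  over every cylinder above a Borel subset of Z unchanged. So the difference has zero push-forward
  to the first coordinate, and a bounded factor X in that coordinate may be inserted.\<close>

lemma integral_over_null_set:
  fixes X c :: "complex \<Rightarrow> complex"
  assumes Z: "Z \<in> sets circle_borel" "emeasure circle_lebesgue Z = 0"
    and X[measurable]: "X \<in> borel_measurable borel" and XB: "\<And>a. cmod (X a) \<le> B"
    and c[measurable]: "c \<in> borel_measurable borel" and cB: "\<And>v. cmod v = 1 \<Longrightarrow> cmod (c v) \<le> B'"
  shows "(\<integral>\<zeta>. X (fst \<zeta>) * (indicator Z (fst \<zeta>) * c (snd \<zeta>)) \<partial>\<sigma>) =
    (\<integral>v. c v \<partial>circle_lebesgue) * (\<integral>\<zeta>. X (fst \<zeta>) * indicator Z (fst \<zeta>) \<partial>\<sigma>)"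
proof -
  have Zb[measurable]: "Z \<in> sets borel" using Z(1) by (auto simp: sets_restrict_space)
  define K where "K = (\<integral>v. c v \<partial>circle_lebesgue)"
  have ci: "integrable \<sigma> (\<lambda>\<zeta>. c (snd \<zeta>))"
    by (rule integrable_bounded[where B=B']) (auto simp: cB norm_coords)
  have i: "integrable \<sigma> (\<lambda>\<zeta>. indicator E (fst \<zeta>) * c (snd \<zeta>))" "integrable \<sigma> (\<lambda>\<zeta>. indicator E (fst \<zeta>) * K)"
    if "E \<in> sets borel" for E
    by (rule indicator_integrable[OF ci that], rule indicator_integrable[OF integrable_bounded that]) auto
  have slice: "(\<integral>\<zeta>. indicator E (fst \<zeta>) * c (snd \<zeta>) \<partial>\<sigma>) = (\<integral>\<zeta>. indicator E (fst \<zeta>) * K \<partial>\<sigma>)"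
    if E: "E \<in> sets circle_borel" "emeasure circle_lebesgue E = 0" for E
  proof -
    have Eb[measurable]: "E \<in> sets borel" using E(1) by (auto simp: sets_restrict_space)
    have "(\<integral>\<zeta>. indicator E (fst \<zeta>) * c (snd \<zeta>) \<partial>\<sigma>) = (\<integral>\<zeta>. indicator E (fst \<zeta>) *\<^sub>R c (snd \<zeta>) \<partial>\<sigma>)"
      by (intro Bochner_Integration.integral_cong) (auto simp: indicator_def)
    also have "\<dots> = (\<integral>v. c v \<partial>distr (density \<sigma> (\<lambda>\<zeta>. ennreal (indicator E (fst \<zeta>)))) borel snd)"
      by (subst integral_distr, simp, simp, subst integral_density) auto
    also have "\<dots> = (\<integral>v. c v \<partial>density circle_mean (\<lambda>_. ennreal (\<integral>\<zeta>. indicator E (fst \<zeta>) \<partial>\<sigma>)))"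
      unfolding slice_over_null_set[OF E] ..
    also have "\<dots> = (\<integral>v. (\<integral>\<zeta>. indicator E (fst \<zeta>) \<partial>\<sigma>) *\<^sub>R c v \<partial>circle_mean)"
      by (rule integral_density) (auto intro!: Bochner_Integration.integral_nonneg)
    also have "\<dots> = of_real (\<integral>\<zeta>. indicator E (fst \<zeta>) \<partial>\<sigma>) * K"
      unfolding K_def integral_circle_mean[OF c, symmetric] by (simp add: scaleR_conv_of_real)
    also have "of_real (\<integral>\<zeta>. indicator E (fst \<zeta>) \<partial>\<sigma>) = (\<integral>\<zeta>. complex_of_real (indicator E (fst \<zeta>)) \<partial>\<sigma>)"
      by (rule integral_complex_of_real[symmetric])
    also have "\<dots> * K = (\<integral>\<zeta>. complex_of_real (indicator E (fst \<zeta>)) * K \<partial>\<sigma>)"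
      by (rule integral_mult_left_zero[symmetric])
    also have "\<dots> = (\<integral>\<zeta>. indicator E (fst \<zeta>) * K \<partial>\<sigma>)"
      by (intro Bochner_Integration.integral_cong) (auto simp: indicator_def)
    finally show ?thesis .
  qed
  have "(\<integral>\<zeta>. X (fst \<zeta>) * (indicator Z (fst \<zeta>) * c (snd \<zeta>) - indicator Z (fst \<zeta>) * K) \<partial>\<sigma>) = 0"
  proof (rule integral_multiplier_zero[where u=fst and N=borel, OF _ _ _ X XB])
    show "integrable \<sigma> (\<lambda>\<zeta>. indicator Z (fst \<zeta>) * c (snd \<zeta>) - indicator Z (fst \<zeta>) * K)"
      using i[OF Zb] by (rule Bochner_Integration.integrable_diff)
    fix E :: "complex set" assume E: "E \<in> sets borel"
    have "(\<integral>\<zeta>. indicator E (fst \<zeta>) * (indicator Z (fst \<zeta>) * c (snd \<zeta>) - indicator Z (fst \<zeta>) * K) \<partial>\<sigma>) =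
        (\<integral>\<zeta>. indicator (Z \<inter> E) (fst \<zeta>) * c (snd \<zeta>) - indicator (Z \<inter> E) (fst \<zeta>) * K \<partial>\<sigma>)"
      by (intro Bochner_Integration.integral_cong) (auto simp: indicator_def)
    also have "\<dots> = 0"
      using i[of "Z \<inter> E"] slice[OF null_Int[OF Z E]] E Zb by (subst Bochner_Integration.integral_diff) auto
    finally show "(\<integral>\<zeta>. indicator E (fst \<zeta>) * (indicator Z (fst \<zeta>) * c (snd \<zeta>) - indicator Z (fst \<zeta>) * K)
        \<partial>\<sigma>) = 0" .
  qed measurable
  moreover have "(\<integral>\<zeta>. X (fst \<zeta>) * (indicator Z (fst \<zeta>) * c (snd \<zeta>) - indicator Z (fst \<zeta>) * K) \<partial>\<sigma>) =
      (\<integral>\<zeta>. X (fst \<zeta>) * (indicator Z (fst \<zeta>) * c (snd \<zeta>)) - K * (X (fst \<zeta>) * indicator Z (fst \<zeta>)) \<partial>\<sigma>)"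
    by (simp add: algebra_simps)
  moreover have "\<dots> = (\<integral>\<zeta>. X (fst \<zeta>) * (indicator Z (fst \<zeta>) * c (snd \<zeta>)) \<partial>\<sigma>) -
      (\<integral>\<zeta>. K * (X (fst \<zeta>) * indicator Z (fst \<zeta>)) \<partial>\<sigma>)"
  proof (rule Bochner_Integration.integral_diff)
    have B0: "0 \<le> B" using order_trans[OF norm_ge_zero XB[of 0]] .
    show "integrable \<sigma> (\<lambda>\<zeta>. X (fst \<zeta>) * (indicator Z (fst \<zeta>) * c (snd \<zeta>)))"
    proof (rule integrable_bounded[where B="B * B'"])
      fix \<zeta> assume \<zeta>: "\<zeta> \<in> space \<sigma>"
      have "cmod (indicator Z (fst \<zeta>) * c (snd \<zeta>)) \<le> B'"
        using cB[OF norm_coords(2)[OF \<zeta>]] norm_ge_zero[of "c (snd \<zeta>)"]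
            by (auto simp: indicator_def simp del: norm_ge_zero)
      then show "cmod (X (fst \<zeta>) * (indicator Z (fst \<zeta>) * c (snd \<zeta>))) \<le> B * B'"
        unfolding norm_mult[of "X _"] using XB B0 by (intro mult_mono) auto
    qed measurable
    have "integrable \<sigma> (\<lambda>\<zeta>. X (fst \<zeta>) * indicator Z (fst \<zeta>))"
      by (rule integrable_bounded[where B=B]) (use XB B0 in \<open>auto simp: indicator_def\<close>)
    then show "integrable \<sigma> (\<lambda>\<zeta>. K * (X (fst \<zeta>) * indicator Z (fst \<zeta>)))" by (rule integrable_mult_right)
  qed
  ultimately show ?thesis by (simp add: K_def)
qed

end

section \<open>Complex measures given by densities\<close>

text \<open>Both measures are absolutely continuous with respect to their sum. With a common
  reference measure, a combination of two Clark measures becomes a single complex density.\<close>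

lemma common_density:
  fixes M1 M2 :: "'a measure"
  assumes fin: "finite_measure M1" "finite_measure M2" and sets: "sets M2 = sets M1"
  obtains M h1 h2 where "finite_measure M" "sets M = sets M1"
    "h1 \<in> borel_measurable M" "h2 \<in> borel_measurable M" "\<And>x. 0 \<le> h1 x" "\<And>x. 0 \<le> (h2 x :: real)"
    "M1 = density M (\<lambda>x. ennreal (h1 x))" "M2 = density M (\<lambda>x. ennreal (h2 x))"
proof -
  interpret M1: finite_measure M1 by fact
  interpret M2: finite_measure M2 by fact
  define M where "M = measure_of (space M1) (sets M1) (\<lambda>A. emeasure M1 A + emeasure M2 A)"
  have setsM: "sets M = sets M1" and spaceM: "space M = space M1" by (simp_all add: M_def)
  have em: "emeasure M A = emeasure M1 A + emeasure M2 A" if "A \<in> sets M1" for A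
  proof (rule emeasure_measure_of[OF M_def])
    show "countably_additive (sets M) (\<lambda>A. emeasure M1 A + emeasure M2 A)"
    proof (rule countably_additiveI)
      fix A :: "nat \<Rightarrow> 'a set" assume A: "range A \<subseteq> sets M" "disjoint_family A"
      have "(\<Sum>i. emeasure M1 (A i) + emeasure M2 (A i)) = (\<Sum>i. emeasure M1 (A i)) + (\<Sum>i. emeasure M2 (A i))"
        by (rule suminf_add[symmetric]) auto
      also have "\<dots> = emeasure M1 (\<Union>i. A i) + emeasure M2 (\<Union>i. A i)"
        using A setsM sets by (simp add: suminf_emeasure)
      finally show "(\<Sum>i. emeasure M1 (A i) + emeasure M2 (A i)) =
          emeasure M1 (\<Union>i. A i) + emeasure M2 (\<Union>i. A i)" .
    qed
  qed (use that sets.space_closed setsM in \<open>auto simp: positive_def\<close>)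
  have finM: "finite_measure M"
  proof (rule finite_measureI)
    have "space M1 \<in> sets M1" by auto
    then show "emeasure M (space M) \<noteq> \<infinity>"
      using M1.emeasure_finite M2.emeasure_finite by (simp add: em spaceM)
  qed
  interpret M: finite_measure M by fact
  have ac: "absolutely_continuous M M1" "absolutely_continuous M M2"
    using em sets setsM by (auto simp: absolutely_continuous_def null_sets_def)
  have s: "sets M1 = sets M" "sets M2 = sets M" using setsM sets by auto
  obtain h1 where h1: "h1 \<in> borel_measurable M" "AE x in M. RN_deriv M M1 x = ennreal (h1 x)" "\<And>x. 0 \<le> h1 x"
    using M.real_RN_deriv[OF fin(1) ac(1) s(1)] by metis
  obtain h2 where h2: "h2 \<in> borel_measurable M" "AE x in M. RN_deriv M M2 x = ennreal (h2 x)" "\<And>x. 0 \<le> h2 x"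
    using M.real_RN_deriv[OF fin(2) ac(2) s(2)] by metis
  have "M1 = density M (\<lambda>x. ennreal (h1 x))"
    using M.density_RN_deriv[OF ac(1) s(1)] h1 density_cong[of "RN_deriv M M1" M "\<lambda>x. ennreal (h1 x)"] by simp
  moreover have "M2 = density M (\<lambda>x. ennreal (h2 x))"
    using M.density_RN_deriv[OF ac(2) s(2)] h2 density_cong[of "RN_deriv M M2" M "\<lambda>x. ennreal (h2 x)"] by simp
  ultimately show ?thesis using that finM setsM h1 h2 by blast
qed

text \<open>The supremum over subsets of E is attained at the part of E where G \<ge> 0, a Hahn set
  of the signed measure G dM.\<close>

lemma positive_variation_density:
  fixes G :: "'a \<Rightarrow> real"
  assumes G: "integrable M G" and sets: "sets M = sets T"
    and \<phi>: "\<And>A. A \<in> sets T \<Longrightarrow> \<phi> A = (\<integral>x. indicator A x * G x \<partial>M)"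
  shows "positive_variation T \<phi> = density M (\<lambda>x. ennreal (max 0 (G x)))"
proof -
  have [measurable]: "G \<in> borel_measurable M" using G by auto
  have sp: "space T = space M" using sets by (metis sets_eq_imp_space_eq)
  define D where "D = density M (\<lambda>x. ennreal (max 0 (G x)))"
  have i: "integrable M (\<lambda>x. indicator A x * max 0 (G x))" "integrable M (\<lambda>x. indicator A x * G x)"
    if [measurable]: "A \<in> sets M" for A
    by (rule Bochner_Integration.integrable_bound[OF G]; auto simp: indicator_def)+
  have emD: "emeasure D E = ennreal (\<integral>x. indicator E x * max 0 (G x) \<partial>M)" if [measurable]: "E \<in> sets M" for E
  proof -
    have "emeasure D E = (\<integral>\<^sup>+x. ennreal (indicator E x * max 0 (G x)) \<partial>M)"
      unfolding D_def by (subst emeasure_density) (auto intro!: nn_integral_cong simp: indicator_def)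
    also have "\<dots> = ennreal (\<integral>x. indicator E x * max 0 (G x) \<partial>M)"
      by (rule nn_integral_eq_integral[OF i(1)]) auto
    finally show ?thesis .
  qed
  have "(SUP F \<in> {F \<in> sets M. F \<subseteq> E}. ennreal (\<phi> F)) = emeasure D E" if E[measurable]: "E \<in> sets M" for E
  proof (rule antisym)
    show "(SUP F \<in> {F \<in> sets M. F \<subseteq> E}. ennreal (\<phi> F)) \<le> emeasure D E"
    proof (rule SUP_least)
      fix F assume "F \<in> {F \<in> sets M. F \<subseteq> E}"
      then have F: "F \<in> sets M" "F \<subseteq> E" by auto
      have "\<phi> F \<le> (\<integral>x. indicator E x * max 0 (G x) \<partial>M)"
        using F \<phi>[of F] sets i(2)[OF F(1)] i(1)[OF E]
        by (auto intro!: integral_mono simp: indicator_def)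
      then show "ennreal (\<phi> F) \<le> emeasure D E" unfolding emD[OF E] by (rule ennreal_leI)
    qed
    define F where "F = {x \<in> space M. x \<in> E \<and> 0 \<le> G x}"
    have F: "F \<in> sets M" unfolding F_def by measurable
    have FE: "F \<subseteq> E" unfolding F_def by auto
    have "(\<integral>x. indicator E x * max 0 (G x) \<partial>M) = \<phi> F"
      using \<phi>[of F] F sets by (auto intro!: Bochner_Integration.integral_cong simp: indicator_def F_def)
    then show "emeasure D E \<le> (SUP F \<in> {F \<in> sets M. F \<subseteq> E}. ennreal (\<phi> F))"
      unfolding emD[OF E] using F FE by (auto intro!: SUP_upper2[of F])
  qed
  then have "positive_variation T \<phi> = measure_of (space M) (sets M) (emeasure D)"
    unfolding positive_variation_def sets[symmetric] sp
    by (intro measure_of_eq sets.space_closed) (simp add: sets.sigma_sets_eq)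
  also have "\<dots> = D" using measure_of_of_measure[of D] by (simp add: D_def)
  finally show ?thesis unfolding D_def .
qed

text \<open>The four variations in \<open>cm_integral\<close> become the densities given by the
  positive parts of Re F, - Re F, Im F and - Im F, which recombine to F; boundedness of f makes each
  piece integrable.\<close>

lemma cm_integral_density:
  fixes F f :: "'a \<Rightarrow> complex"
  assumes F: "integrable M F" and sets: "sets M = sets T"
    and f[measurable]: "f \<in> borel_measurable M" and B: "\<And>x. x \<in> space M \<Longrightarrow> cmod (f x) \<le> B"
  shows "cm_integral T (\<lambda>A. \<integral>x. indicator A x * F x \<partial>M) f = (\<integral>x. f x * F x \<partial>M)"
proof -
  have Fm[measurable]: "F \<in> borel_measurable M" using F by auto
  have iA: "integrable M (\<lambda>x. indicator A x * F x)" if [measurable]: "A \<in> sets M" for A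
    by (rule Bochner_Integration.integrable_bound[OF F]) (auto simp: indicator_def)
  have re: "Re (\<integral>x. indicator A x * F x \<partial>M) = (\<integral>x. indicator A x * Re (F x) \<partial>M)"
    and im: "Im (\<integral>x. indicator A x * F x \<partial>M) = (\<integral>x. indicator A x * Im (F x) \<partial>M)" if "A \<in> sets M" for A
  proof -
    have "(\<lambda>x. indicator A x * Re (F x)) = (\<lambda>x. Re (indicator A x * F x))"
      "(\<lambda>x. indicator A x * Im (F x)) = (\<lambda>x. Im (indicator A x * F x))" by (auto simp: indicator_def)
    then show "Re (\<integral>x. indicator A x * F x \<partial>M) = (\<integral>x. indicator A x * Re (F x) \<partial>M)"
      "Im (\<integral>x. indicator A x * F x \<partial>M) = (\<integral>x. indicator A x * Im (F x) \<partial>M)"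
      using integral_Re[OF iA[OF that]] integral_Im[OF iA[OF that]] by simp_all
  qed
  have rF: "integrable M (\<lambda>x. Re (F x))" "integrable M (\<lambda>x. Im (F x))" using F by auto
  have dens: "integral\<^sup>L (positive_variation T \<phi>) f = (\<integral>x. f x * of_real (max 0 (G x)) \<partial>M)"
    if G: "integrable M G" and \<phi>: "\<And>A. A \<in> sets M \<Longrightarrow> \<phi> A = (\<integral>x. indicator A x * G x \<partial>M)" for G \<phi>
  proof -
    have [measurable]: "G \<in> borel_measurable M" using G by auto
    have "integral\<^sup>L (positive_variation T \<phi>) f = integral\<^sup>L (density M (\<lambda>x. ennreal (max 0 (G x)))) f"
      by (subst positive_variation_density[OF G sets]) (use \<phi> sets in auto)
    also have "\<dots> = (\<integral>x. max 0 (G x) *\<^sub>R f x \<partial>M)" by (rule integral_density) auto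
    also have "\<dots> = (\<integral>x. f x * of_real (max 0 (G x)) \<partial>M)" by (simp add: scaleR_conv_of_real mult.commute)
    finally show ?thesis .
  qed
  have bi: "integrable M (\<lambda>x. f x * of_real (g x))" if "integrable M g" for g :: "'a \<Rightarrow> real"
  proof (rule Bochner_Integration.integrable_bound)
    have [measurable]: "g \<in> borel_measurable M" using that by auto
    show "integrable M (\<lambda>x. B * g x)" using that by simp
    show "(\<lambda>x. f x * of_real (g x)) \<in> borel_measurable M" by measurable
    show "AE x in M. norm (f x * of_real (g x)) \<le> norm (B * g x)"
    proof (rule AE_I2)
      fix x assume "x \<in> space M"
      then have "cmod (f x) \<le> \<bar>B\<bar>" using B by fastforce
      then show "norm (f x * of_real (g x)) \<le> norm (B * g x)"
        unfolding norm_mult norm_of_real by (auto simp: abs_mult intro: mult_right_mono)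
    qed
  qed
  have parts: "(\<integral>x. f x * of_real (max 0 (G x)) \<partial>M) - (\<integral>x. f x * of_real (max 0 (- G x)) \<partial>M) =
      (\<integral>x. f x * of_real (G x) \<partial>M)"
    if G: "integrable M G" for G
  proof -
    have "(\<integral>x. f x * of_real (max 0 (G x)) \<partial>M) - (\<integral>x. f x * of_real (max 0 (- G x)) \<partial>M) =
        (\<integral>x. f x * of_real (max 0 (G x)) - f x * of_real (max 0 (- G x)) \<partial>M)"
      using G by (intro Bochner_Integration.integral_diff[symmetric] bi) auto
    also have "\<dots> = (\<integral>x. f x * of_real (G x) \<partial>M)"
      by (intro Bochner_Integration.integral_cong) (auto simp: max_def)
    finally show ?thesis .
  qed
  have n: "integrable M (\<lambda>x. - Re (F x))" "integrable M (\<lambda>x. - Im (F x))" using rF by auto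
  have "cm_integral T (\<lambda>A. \<integral>x. indicator A x * F x \<partial>M) f =
      (\<integral>x. f x * of_real (Re (F x)) \<partial>M) + \<i> * (\<integral>x. f x * of_real (Im (F x)) \<partial>M)"
    unfolding cm_integral_def
    using dens[OF rF(1) re] dens[OF rF(2) im] dens[OF n(1), of "\<lambda>A. - Re (\<integral>x. indicator A x * F x \<partial>M)"]
      dens[OF n(2), of "\<lambda>A. - Im (\<integral>x. indicator A x * F x \<partial>M)"] parts[OF rF(1)] parts[OF rF(2)]
    by (simp add: re im)
  also have "\<dots> = (\<integral>x. f x * of_real (Re (F x)) + \<i> * (f x * of_real (Im (F x))) \<partial>M)"
    using bi[OF rF(1)] bi[OF rF(2)] by simp
  also have "\<dots> = (\<integral>x. f x * F x \<partial>M)"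
  proof (intro Bochner_Integration.integral_cong refl)
    fix x
    have "f x * F x = f x * (of_real (Re (F x)) + \<i> * of_real (Im (F x)))"
      using complex_eq[of "F x"] by simp
    then show "f x * of_real (Re (F x)) + \<i> * (f x * of_real (Im (F x))) = f x * F x"
      by (simp add: algebra_simps)
  qed
  finally show ?thesis .
qed

lemma complex_measure_density:
  fixes F :: "'a \<Rightarrow> complex"
  assumes F: "integrable M F" and sets: "sets M = sets T"
  shows "complex_measure T (\<lambda>A. \<integral>x. indicator A x * F x \<partial>M)"
  unfolding complex_measure_def
proof (intro conjI allI impI)
  have [measurable]: "F \<in> borel_measurable M" using F by auto
  fix A :: "nat \<Rightarrow> 'a set" assume A: "range A \<subseteq> sets T" "disjoint_family A"
  then have Am[measurable]: "A i \<in> sets M" for i using sets by auto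
  have sums: "(\<lambda>n. indicator (A n) x * F x) sums (indicator (\<Union>i. A i) x * F x)" for x
  proof (cases "x \<in> (\<Union>i. A i)")
    case True
    then obtain i where i: "x \<in> A i" by auto
    have "indicator (A n) x * F x = (if n = i then F x else 0)" for n
      using i A(2) by (auto simp: indicator_def disjoint_family_on_def)
    then show ?thesis using sums_single[of i "\<lambda>_. F x"] True by simp
  qed auto
  have "(\<lambda>n. \<integral>x. (\<Sum>i<n. indicator (A i) x * F x) \<partial>M) \<longlonglongrightarrow> (\<integral>x. indicator (\<Union>i. A i) x * F x \<partial>M)"
  proof (rule integral_dominated_convergence[where w="\<lambda>x. norm (F x)"])
    show "AE x in M. (\<lambda>n. \<Sum>i<n. indicator (A i) x * F x) \<longlonglongrightarrow> indicator (\<Union>i. A i) x * F x"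
      using sums unfolding sums_def by (intro AE_I2)
    show "AE x in M. norm (\<Sum>i<n. indicator (A i) x * F x) \<le> norm (F x)" for n
    proof (rule AE_I2)
      fix x
      have eq: "(\<Sum>i<n. indicator (A i) x * F x) = indicator (\<Union>i<n. A i) x * F x"
        unfolding sum_distrib_right[symmetric]
        by (subst indicator_UN_disjoint) (use A(2) in \<open>auto simp: disjoint_family_on_def\<close>)
      show "norm (\<Sum>i<n. indicator (A i) x * F x) \<le> norm (F x)"
        unfolding eq by (auto simp: indicator_def)
    qed
    show "integrable M (\<lambda>x. norm (F x))" using F by simp
  qed measurable
  moreover have "(\<integral>x. (\<Sum>i<n. indicator (A i) x * F x) \<partial>M) = (\<Sum>i<n. \<integral>x. indicator (A i) x * F x \<partial>M)" for n
  proof (rule Bochner_Integration.integral_sum)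
    show "integrable M (\<lambda>x. indicator (A i) x * F x)" for i
      by (rule Bochner_Integration.integrable_bound[OF F]) (auto simp: indicator_def)
  qed
  ultimately show "(\<lambda>i. \<integral>x. indicator (A i) x * F x \<partial>M) sums (\<integral>x. indicator (\<Union>i. A i) x * F x \<partial>M)"
    by (simp add: sums_def)
qed simp

section \<open>Null sets, rectangles and the carrier of a decomposed measure\<close>

lemma total_variation_zero_subset:
  assumes "total_variation T \<nu> N = 0" "N \<in> sets T" "A \<in> sets T" "A \<subseteq> N"
  shows "\<nu> A = 0"
proof -
  define E where "E n = (if n = 0 then A else if n = 1 then N - A else {})" for n :: nat
  have "range E \<subseteq> sets T" "disjoint_family E" "(\<Union>i. E i) = N"
    using assms by (auto simp: E_def disjoint_family_on_def split: if_splits)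
  then have "(\<Sum>i. ennreal (norm (\<nu> (E i)))) \<le> total_variation T \<nu> N"
    unfolding total_variation_def by (intro SUP_upper) auto
  then have "(\<Sum>i. ennreal (norm (\<nu> (E i)))) = 0" using assms(1) by simp
  then have "ennreal (norm (\<nu> (E 0))) = 0" by (simp add: suminf_eq_zero_iff)
  then show ?thesis by (simp add: E_def)
qed

text \<open>The passage from rectangles to Borel sets is the \<pi>-\<lambda> theorem. Closure under
  complements uses that V itself is cut out by the rectangle UNIV \<times> UNIV and therefore has
  measure 0.\<close>

lemma complex_measure_rectangles:
  assumes \<mu>: "complex_measure torus_borel \<mu>" and V: "V \<in> sets torus_borel"
    and rect: "\<And>A B. \<lbrakk>A \<in> sets circle_borel; B \<in> sets circle_borel\<rbrakk> \<Longrightarrow> \<mu> ((A \<times> B) \<inter> V) = 0"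
    and S: "S \<in> sets torus_borel"
  shows "\<mu> (S \<inter> V) = 0"
proof -
  have tb: "torus \<in> sets borel" unfolding torus_def by (intro borel_closed closed_Times closed_sphere)
  have Vb: "V \<in> sets borel" "V \<subseteq> torus" using V tb by (auto simp: sets_restrict_space_iff)
  have Sb: "S \<in> sets borel" using S tb by (auto simp: sets_restrict_space_iff)
  have inV: "S \<inter> V \<in> sets torus_borel" if "S \<in> sets borel" for S
    using that Vb tb by (auto simp: sets_restrict_space_iff)
  have sb: "sphere (0::complex) 1 \<in> sets borel" by (intro borel_closed closed_sphere)
  define G :: "(complex \<times> complex) set set" where "G = {A \<times> B | A B. A \<in> sets borel \<and> B \<in> sets borel}"
  have e0: "\<mu> {} = 0" using \<mu> by (simp add: complex_measure_def)
  have sums: "(\<lambda>i. \<mu> (A i)) sums \<mu> (\<Union>i. A i)" if "range A \<subseteq> sets torus_borel"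
      "disjoint_family A" for A :: "nat \<Rightarrow> _"
    using \<mu> that by (simp add: complex_measure_def)
  have base: "\<mu> (R \<inter> V) = 0" if R: "R \<in> G" for R
  proof -
    obtain A B where AB: "R = A \<times> B" "A \<in> sets borel" "B \<in> sets borel" using R by (auto simp: G_def)
    have "R \<inter> V = ((A \<inter> sphere 0 1) \<times> (B \<inter> sphere 0 1)) \<inter> V"
      using Vb(2) unfolding AB(1) torus_def by auto
    moreover have "A \<inter> sphere 0 1 \<in> sets circle_borel" "B \<inter> sphere 0 1 \<in> sets circle_borel"
      using AB sb by (auto simp: sets_restrict_space_iff)
    ultimately show ?thesis using rect by simp
  qed
  have gen: "sigma_sets UNIV G = sets borel"
    unfolding borel_prod[symmetric] sets_pair_measure G_def by simp
  have "S \<in> sigma_sets UNIV G" using Sb gen by simp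
  then show ?thesis
  proof (rule sigma_sets_induct_disjoint[rotated 2])
    show "Int_stable G"
    proof (rule Int_stableI)
      fix P Q assume "P \<in> G" "Q \<in> G"
      then obtain A B C D where "P = A \<times> B" "Q =
          C \<times> D" "A \<in> sets borel" "B \<in> sets borel" "C \<in> sets borel" "D \<in> sets borel"
        by (auto simp: G_def)
      moreover have "A \<times> B \<inter> C \<times> D = (A \<inter> C) \<times> (B \<inter> D)" by auto
      ultimately show "P \<inter> Q \<in> G" unfolding G_def by blast
    qed
    show "G \<subseteq> Pow UNIV" by simp
    show "\<mu> ({} \<inter> V) = 0" using e0 by simp
    show "\<mu> (R \<inter> V) = 0" if "R \<in> G" for R by (rule base[OF that])
    fix P assume P: "P \<in> sigma_sets UNIV G" "\<mu> (P \<inter> V) = 0"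
    have Pb: "P \<in> sets borel" using P gen by simp
    \<comment> \<open>Padding by empty sets extracts finite additivity from countable
      additivity.\<close>
    define A where "A n = (if n = 0 then P \<inter> V else if n = 1 then (UNIV - P) \<inter> V else {})" for n :: nat
    have A01: "A 0 = P \<inter> V" "A 1 = (UNIV - P) \<inter> V" by (simp_all add: A_def)
    have "(\<lambda>i. \<mu> (A i)) sums \<mu> (\<Union>i. A i)"
    proof (rule sums)
      show "range A \<subseteq> sets torus_borel" using inV[OF Pb] inV[of "UNIV - P"] Pb by (auto simp: A_def)
      show "disjoint_family A" by (auto simp: A_def disjoint_family_on_def)
    qed
    moreover have "(\<Union>i. A i) = UNIV \<inter> V"
    proof (intro equalityI subsetI)
      fix x assume "x \<in> UNIV \<inter> V"
      then have "x \<in> A 0 \<or> x \<in> A 1" unfolding A01 by blast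
      then show "x \<in> (\<Union>i. A i)" by blast
    next
      fix x assume "x \<in> (\<Union>i. A i)"
      then obtain i where "x \<in> A i" by blast
      then show "x \<in> UNIV \<inter> V" unfolding A_def by (simp split: if_splits)
    qed
    moreover have "\<mu> (UNIV \<inter> V) = 0"
    proof (rule base)
      have "UNIV \<times> UNIV \<in> G"
        unfolding G_def by (rule CollectI, rule exI[of _ UNIV], rule exI[of _ UNIV]) simp
      then show "UNIV \<in> G" by simp
    qed
    ultimately have "(\<lambda>i. \<mu> (A i)) sums 0" by simp
    moreover have "(\<lambda>i. \<mu> (A i)) sums (\<Sum>i\<in>{0,1}. \<mu> (A i))"
      by (rule sums_finite) (auto simp: A_def e0)
    ultimately have "(\<Sum>i\<in>{0,1}. \<mu> (A i)) = 0" by (rule sums_unique2[symmetric])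
    then show "\<mu> ((UNIV - P) \<inter> V) = 0" using P(2) by (simp add: A_def)
  next
    fix A :: "nat \<Rightarrow> (complex \<times> complex) set"
    assume A: "disjoint_family A" "range A \<subseteq> sigma_sets UNIV G" "\<And>i. \<mu> (A i \<inter> V) = 0"
    have "(\<lambda>i. \<mu> (A i \<inter> V)) sums \<mu> (\<Union>i. A i \<inter> V)"
    proof (rule sums)
      show "range (\<lambda>i. A i \<inter> V) \<subseteq> sets torus_borel" using A(2) gen inV by auto
      show "disjoint_family (\<lambda>i. A i \<inter> V)" using A(1) by (auto simp: disjoint_family_on_def)
    qed
    then have "\<mu> (\<Union>i. A i \<inter> V) = 0" using A(3) by (simp add: sums_iff)
    then show "\<mu> (\<Union> (range A) \<inter> V) = 0" by (simp add: Int_commute Int_UN_distrib2 flip: UN_simps(4))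
  qed
qed

text \<open>On the part R of the torus outside N, Z1 \<times> T and T \<times> Z2 every component
  vanishes: \<mu>0 because of its carrier, \<mu>1 and \<mu>2 because their values on rectangles
  confine them to the points over Z1 and Z2. Since \<sigma> is positive, \<sigma>(R) = 0 makes R
  negligible.\<close>

lemma RP_decomposition_carrier:
  assumes dec: "RP_decomposition (complex_measure_of \<sigma>) \<mu>0 \<mu>1 \<mu>2" and N: "carrier_of torus_borel \<mu>0 N"
    and \<sigma>: "finite_measure \<sigma>" "sets \<sigma> = sets torus_borel"
  obtains Z1 Z2 where "Z1 \<in> sets circle_borel" "emeasure circle_lebesgue Z1 = 0"
    "Z2 \<in> sets circle_borel" "emeasure circle_lebesgue Z2 = 0"
    "emeasure \<sigma> {\<zeta> \<in> torus. \<zeta> \<notin> N \<and> fst \<zeta> \<notin> Z1 \<and> snd \<zeta> \<notin> Z2} = 0"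
proof -
  interpret finite_measure \<sigma> by fact
  from dec obtain \<tau>1 Z1 where Z1: "real_measure circle_borel \<tau>1" "carrier_of circle_borel \<tau>1 Z1"
      "emeasure circle_lebesgue Z1 = 0"
    "\<And>A B. A \<in> sets circle_borel \<Longrightarrow> B \<in> sets circle_borel \<Longrightarrow>
      \<mu>1 (A \<times> B) = \<tau>1 A * of_real (measure circle_lebesgue B)"
    unfolding RP_decomposition_def by blast
  from dec obtain \<tau>2 Z2 where Z2: "real_measure circle_borel \<tau>2" "carrier_of circle_borel \<tau>2 Z2"
      "emeasure circle_lebesgue Z2 = 0"
    "\<And>A B. A \<in> sets circle_borel \<Longrightarrow> B \<in> sets circle_borel \<Longrightarrow>
      \<mu>2 (A \<times> B) = of_real (measure circle_lebesgue A) * \<tau>2 B"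
    unfolding RP_decomposition_def by blast
  have cm: "complex_measure torus_borel \<mu>0" "complex_measure torus_borel \<mu>1" "complex_measure torus_borel \<mu>2"
    and sum: "\<And>A. A \<in> sets torus_borel \<Longrightarrow> complex_measure_of \<sigma> A = \<mu>0 A + \<mu>1 A + \<mu>2 A"
    using dec unfolding RP_decomposition_def RP_def real_measure_def by auto
  have tb: "torus \<in> sets borel" unfolding torus_def by (intro borel_closed closed_Times closed_sphere)
  have sb: "sphere (0::complex) 1 \<in> sets borel" by (intro borel_closed closed_sphere)
  have Zc: "Z1 \<in> sets circle_borel" "Z2 \<in> sets circle_borel" and Nt: "N \<in> sets torus_borel"
    using Z1(2) Z2(2) N by (auto simp: carrier_of_def)
  have Zb: "Z1 \<in> sets borel" "Z1 \<subseteq> sphere 0 1" "Z2 \<in> sets borel" "Z2 \<subseteq> sphere 0 1"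
    using Zc sb by (auto simp: sets_restrict_space_iff)
  define V1 where "V1 = (sphere 0 1 - Z1) \<times> sphere (0::complex) 1"
  define V2 where "V2 = sphere (0::complex) 1 \<times> (sphere 0 1 - Z2)"
  have V: "V1 \<in> sets torus_borel" "V2 \<in> sets torus_borel"
    using Zb sb tb by (auto simp: V1_def V2_def sets_restrict_space_iff torus_def borel_prod[symmetric])
  have e0: "\<tau>1 {} = 0" "\<tau>2 {} = 0" using Z1(1) Z2(1) by (auto simp: real_measure_def complex_measure_def)
  have D: "A - Z1 \<in> sets circle_borel" "A - Z2 \<in> sets circle_borel" if "A \<in> sets circle_borel" for A
    using that Zc by auto
  have 1: "\<mu>1 (S \<inter> V1) = 0" if "S \<in> sets torus_borel" for S
  proof (rule complex_measure_rectangles[OF cm(2) V(1) _ that])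
    fix A B assume AB: "A \<in> sets circle_borel" "B \<in> sets circle_borel"
    have "A \<times> B \<inter> V1 = (A - Z1) \<times> B"
      using AB sb by (auto simp: V1_def sets_restrict_space_iff)
    moreover have "\<tau>1 (A - Z1) = \<tau>1 ((A - Z1) \<inter> Z1)"
        using Z1(2) D(1)[OF AB(1)] unfolding carrier_of_def by blast
    moreover have "(A - Z1) \<inter> Z1 = {}" by auto
    ultimately show "\<mu>1 (A \<times> B \<inter> V1) = 0" using Z1(4)[OF D(1)[OF AB(1)] AB(2)] e0 by simp
  qed
  have 2: "\<mu>2 (S \<inter> V2) = 0" if "S \<in> sets torus_borel" for S
  proof (rule complex_measure_rectangles[OF cm(3) V(2) _ that])
    fix A B assume AB: "A \<in> sets circle_borel" "B \<in> sets circle_borel"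
    have "A \<times> B \<inter> V2 = A \<times> (B - Z2)"
      using AB sb by (auto simp: V2_def sets_restrict_space_iff)
    moreover have "\<tau>2 (B - Z2) = \<tau>2 ((B - Z2) \<inter> Z2)"
        using Z2(2) D(2)[OF AB(2)] unfolding carrier_of_def by blast
    moreover have "(B - Z2) \<inter> Z2 = {}" by auto
    ultimately show "\<mu>2 (A \<times> B \<inter> V2) = 0" using Z2(4)[OF AB(1) D(2)[OF AB(2)]] e0 by simp
  qed
  define R where "R = {\<zeta> \<in> torus. \<zeta> \<notin> N \<and> fst \<zeta> \<notin> Z1 \<and> snd \<zeta> \<notin> Z2}"
  have Req: "R = (V1 \<inter> V2) - N" unfolding R_def V1_def V2_def torus_def by auto
  have R: "R \<in> sets torus_borel" unfolding Req using V Nt by auto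
  have "R = R \<inter> V1" "R = R \<inter> V2" "R \<inter> N = {}" unfolding Req by auto
  then have "\<mu>1 R = 0" "\<mu>2 R = 0" "\<mu>0 R = \<mu>0 {}"
    using 1[OF R] 2[OF R] N R unfolding carrier_of_def by metis+
  moreover have "\<mu>0 {} = 0" using cm(1) by (simp add: complex_measure_def)
  ultimately have "complex_measure_of \<sigma> R = 0" using sum[OF R] by simp
  then have "emeasure \<sigma> R = 0" by (simp add: complex_measure_of_def emeasure_eq_measure)
  then show ?thesis using that[OF Zc(1) Z1(3) Zc(2) Z2(3)] unfolding R_def by blast
qed

section \<open>Domination in the square mean\<close>

text \<open>By duality this says that the restriction of \<open>M\<close> to \<open>S\<close> has a density in \<open>L\<^sup>2(N)\<close>.\<close>

definition L2_dominated_on ::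
  "(complex \<times> complex) set \<Rightarrow> (complex \<times> complex) measure \<Rightarrow> (complex \<times> complex) measure \<Rightarrow> bool" where
  "L2_dominated_on S M N \<longleftrightarrow> (\<exists>K\<ge>0. \<forall>\<phi> B. \<phi> \<in> borel_measurable borel \<longrightarrow> (\<forall>\<zeta>. 0 \<le> \<phi> \<zeta> \<and> \<phi> \<zeta> \<le> B) \<longrightarrow>
    (\<integral>\<^sup>+\<zeta>. indicator S \<zeta> * ennreal (\<phi> \<zeta>) \<partial>M) \<le> ennreal (K * sqrt (\<integral>\<zeta>. (\<phi> \<zeta>)\<^sup>2 \<partial>N)))"

text \<open>The shape in which Cauchy-Schwarz yields domination: the multiplier Y is controlled by c
  g, and f enters only through its norm, as part of the constant.\<close>

lemma cauchy_schwarz_bound: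
  fixes Y f :: "'a \<Rightarrow> complex" and g :: "'a \<Rightarrow> real"
  assumes M: "finite_measure M" and f: "f \<in> square_integrable M"
    and Y: "Y \<in> borel_measurable M" and g: "g \<in> borel_measurable M"
    and Yg: "\<And>x. x \<in> space M \<Longrightarrow> cmod (Y x) \<le> c * g x"
    and gB: "\<And>x. x \<in> space M \<Longrightarrow> 0 \<le> g x \<and> g x \<le> B" and c: "0 \<le> c"
  shows "cmod (\<integral>x. Y x * cnj (f x) \<partial>M) \<le> c * sqrt (\<integral>x. (cmod (f x))\<^sup>2 \<partial>M) * sqrt (\<integral>x. (g x)\<^sup>2 \<partial>M)"
proof -
  interpret finite_measure M by fact
  interpret L2: semi_inner_product "square_integrable M" "\<lambda>f g. \<integral>x. f x * cnj (g x) \<partial>M"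
    by (rule L2_semi_inner_product)
  have YL: "Y \<in> square_integrable M"
  proof (rule square_integrable_bounded[OF M Y])
    fix x assume x: "x \<in> space M"
    have "c * g x \<le> c * B" using gB[OF x] c by (intro mult_left_mono) auto
    then show "cmod (Y x) \<le> c * B" using Yg[OF x] by simp
  qed
  have g2: "integrable M (\<lambda>x. (g x)\<^sup>2)"
  proof (rule integrable_const_bound[where B="B\<^sup>2"])
    show "AE x in M. norm ((g x)\<^sup>2) \<le> B\<^sup>2"
      using gB by (intro AE_I2) (auto intro!: power_mono)
  qed (use g in measurable)
  have "(\<integral>x. (cmod (Y x))\<^sup>2 \<partial>M) \<le> (\<integral>x. c\<^sup>2 * (g x)\<^sup>2 \<partial>M)"
  proof (rule integral_mono)
    show "integrable M (\<lambda>x. (cmod (Y x))\<^sup>2)" using YL by (simp add: square_integrable_def)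
    show "integrable M (\<lambda>x. c\<^sup>2 * (g x)\<^sup>2)" using g2 by simp
    show "(cmod (Y x))\<^sup>2 \<le> c\<^sup>2 * (g x)\<^sup>2" if "x \<in> space M" for x
      using power_mono[OF Yg[OF that] norm_ge_zero, of 2] by (simp add: power_mult_distrib)
  qed
  then have Y2: "(\<integral>x. (cmod (Y x))\<^sup>2 \<partial>M) \<le> c\<^sup>2 * (\<integral>x. (g x)\<^sup>2 \<partial>M)" by simp
  have "(cmod (\<integral>x. Y x * cnj (f x) \<partial>M))\<^sup>2 \<le> (\<integral>x. (cmod (Y x))\<^sup>2 \<partial>M) * (\<integral>x. (cmod (f x))\<^sup>2 \<partial>M)"
    using L2.cauchy_schwarz[OF YL f] unfolding L2_self .
  also have "\<dots> \<le> c\<^sup>2 * (\<integral>x. (g x)\<^sup>2 \<partial>M) * (\<integral>x. (cmod (f x))\<^sup>2 \<partial>M)"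
    by (rule mult_right_mono[OF Y2]) (intro Bochner_Integration.integral_nonneg, simp)
  also have "\<dots> = (c * sqrt (\<integral>x. (cmod (f x))\<^sup>2 \<partial>M) * sqrt (\<integral>x. (g x)\<^sup>2 \<partial>M))\<^sup>2"
    by (simp add: power_mult_distrib Bochner_Integration.integral_nonneg mult_ac)
  finally show ?thesis
    by (rule power2_le_imp_le) (intro mult_nonneg_nonneg c real_sqrt_ge_zero
        Bochner_Integration.integral_nonneg zero_le_power2)
qed

text \<open>What remains of condition (iii) once 1 - cnj \<alpha> b2(z) and a constant are
  cancelled: f d\<sigma>2 and C(\<cdot>, w) d\<sigma>1 have the same Cauchy transform.\<close>

locale clark_pair = c1: clark b1 \<alpha> \<sigma>1 + c2: clark b2 \<alpha> \<sigma>2 for b1 b2 \<alpha> \<sigma>1 \<sigma>2 +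
  fixes f :: "complex \<times> complex \<Rightarrow> complex" and w :: "complex \<times> complex"
  assumes w: "w \<in> bidisc" and f: "f \<in> square_integrable \<sigma>2"
    and transforms_eq: "\<And>z. z \<in> bidisc \<Longrightarrow>
      (\<integral>\<zeta>. f \<zeta> * cnj (cauchy2 \<zeta> z) \<partial>\<sigma>2) = (\<integral>\<zeta>. cauchy2 \<zeta> w * cnj (cauchy2 \<zeta> z) \<partial>\<sigma>1)"
begin

text \<open>Written as F dM with M finite and positive, the annihilating measure becomes accessible
  to \<open>F_and_M_Riesz\<close> and \<open>integral_multiplier_zero\<close>. The conjugates in F
  arise because the transform integrates against cnj C(\<zeta>, z), which is antiholomorphic in
  \<zeta>.\<close>

lemma annihilating_density:
  obtains M F where "finite_measure M" "sets M = sets torus_borel" "integrable M F"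
    "\<And>X B. \<lbrakk>X \<in> borel_measurable torus_borel; \<And>\<zeta>. \<zeta> \<in> torus \<Longrightarrow> cmod (X \<zeta>) \<le> B\<rbrakk> \<Longrightarrow>
      (\<integral>\<zeta>. X \<zeta> * F \<zeta> \<partial>M) = (\<integral>\<zeta>. X \<zeta> * cnj (f \<zeta>) \<partial>\<sigma>2) - (\<integral>\<zeta>. X \<zeta> * cnj (cauchy2 \<zeta> w) \<partial>\<sigma>1)"
    "\<And>p. p \<in> bidisc_algebra \<Longrightarrow> (\<integral>\<zeta>. p \<zeta> * F \<zeta> \<partial>M) = 0"
proof -
  have s12: "sets \<sigma>2 = sets \<sigma>1" using c1.sets c2.sets by simp
  obtain M h1 h2 where M: "finite_measure M" "sets M = sets \<sigma>1"
    and h[measurable]: "h1 \<in> borel_measurable M" "h2 \<in> borel_measurable M"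
    and h0: "\<And>x. 0 \<le> h1 x" "\<And>x. 0 \<le> (h2 x :: real)"
    and d: "\<sigma>1 = density M (\<lambda>x. ennreal (h1 x))" "\<sigma>2 = density M (\<lambda>x. ennreal (h2 x))"
    using common_density[OF c1.finite c2.finite s12] by metis
  have setsM: "sets M = sets torus_borel" using M(2) c1.sets by simp
  have sp: "space M = torus" by (rule space_torus[OF setsM])
  have bm: "g \<in> borel_measurable \<sigma>1 \<longleftrightarrow> g \<in> borel_measurable M"
    "g \<in> borel_measurable \<sigma>2 \<longleftrightarrow> g \<in> borel_measurable M"
    "g \<in> borel_measurable torus_borel \<longleftrightarrow> g \<in> borel_measurable M" for g :: "complex \<times> complex \<Rightarrow> complex"
    unfolding measurable_cong_sets[OF c1.sets refl] measurable_cong_sets[OF c2.sets refl]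
      measurable_cong_sets[OF setsM refl] by simp_all
  have fi: "integrable \<sigma>2 f" by (rule square_integrable_integrable[OF c2.finite f])
  have [measurable]: "f \<in> borel_measurable M" using f by (simp add: square_integrable_def bm)
  note [measurable] = measurable_cauchy2(1)[OF setsM]
  define F where "F \<zeta> = h2 \<zeta> *\<^sub>R cnj (f \<zeta>) - h1 \<zeta> *\<^sub>R cnj (cauchy2 \<zeta> w)" for \<zeta>
  have i2: "integrable M (\<lambda>\<zeta>. h2 \<zeta> *\<^sub>R (X \<zeta> * cnj (f \<zeta>)))"
    and i1: "integrable M (\<lambda>\<zeta>. h1 \<zeta> *\<^sub>R (X \<zeta> * cnj (cauchy2 \<zeta> w)))"
    if X: "X \<in> borel_measurable M" "\<And>\<zeta>. \<zeta> \<in> torus \<Longrightarrow> cmod (X \<zeta>) \<le> B" for X B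
  proof -
    note [measurable] = X(1)
    have "(\<lambda>\<zeta>. X \<zeta> * cnj (f \<zeta>)) \<in> square_integrable \<sigma>2"
      using X f by (intro square_integrable_mult_bounded[where B=B] square_integrable_cnj) (auto simp: bm
          c2.space)
    then have "integrable \<sigma>2 (\<lambda>\<zeta>. X \<zeta> * cnj (f \<zeta>))" by (rule square_integrable_integrable[OF c2.finite])
    then show "integrable M (\<lambda>\<zeta>. h2 \<zeta> *\<^sub>R (X \<zeta> * cnj (f \<zeta>)))"
      unfolding d(2) by (subst (asm) integrable_density) (use h0 in auto)
    have "integrable \<sigma>1 (\<lambda>\<zeta>. X \<zeta> * cnj (cauchy2 \<zeta> w))"
    proof (rule c1.integrable_bounded)
      fix \<zeta> assume "\<zeta> \<in> space \<sigma>1"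
      then have \<zeta>: "\<zeta> \<in> torus" by (simp add: c1.space)
      show "cmod (X \<zeta> * cnj (cauchy2 \<zeta> w)) \<le> B * (1 / (1 - cmod (fst w)) * (1 / (1 - cmod (snd w))))"
        unfolding norm_mult[of "X \<zeta>"] complex_mod_cnj
        using X(2)[OF \<zeta>] norm_cauchy2_le[OF \<zeta> w] order_trans[OF norm_ge_zero X(2)[OF \<zeta>]]
            by (intro mult_mono) auto
    qed (simp add: bm)
    then show "integrable M (\<lambda>\<zeta>. h1 \<zeta> *\<^sub>R (X \<zeta> * cnj (cauchy2 \<zeta> w)))"
      unfolding d(1) by (subst (asm) integrable_density) (use h0 in auto)
  qed
  have Fi: "integrable M F"
    unfolding F_def using i1[of "\<lambda>_. 1" 1] i2[of "\<lambda>_. 1" 1] by simp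
  have T: "(\<integral>\<zeta>. X \<zeta> * F \<zeta> \<partial>M) = (\<integral>\<zeta>. X \<zeta> * cnj (f \<zeta>) \<partial>\<sigma>2) - (\<integral>\<zeta>. X \<zeta> * cnj (cauchy2 \<zeta> w) \<partial>\<sigma>1)"
    if X: "X \<in> borel_measurable torus_borel" "\<And>\<zeta>. \<zeta> \<in> torus \<Longrightarrow> cmod (X \<zeta>) \<le> B" for X B
  proof -
    have Xm[measurable]: "X \<in> borel_measurable M" using X(1) by (simp add: bm)
    have "(\<integral>\<zeta>. X \<zeta> * F \<zeta> \<partial>M) = (\<integral>\<zeta>. h2 \<zeta> *\<^sub>R (X \<zeta> * cnj (f \<zeta>)) - h1 \<zeta> *\<^sub>R (X \<zeta> * cnj (cauchy2 \<zeta> w)) \<partial>M)"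
      unfolding F_def by (simp add: right_diff_distrib)
    also have "\<dots> = (\<integral>\<zeta>. h2 \<zeta> *\<^sub>R (X \<zeta> * cnj (f \<zeta>)) \<partial>M) - (\<integral>\<zeta>. h1 \<zeta> *\<^sub>R (X \<zeta> * cnj (cauchy2 \<zeta> w)) \<partial>M)"
      by (rule Bochner_Integration.integral_diff[OF i2[OF Xm X(2)] i1[OF Xm X(2)]])
    also have "(\<integral>\<zeta>. h2 \<zeta> *\<^sub>R (X \<zeta> * cnj (f \<zeta>)) \<partial>M) = (\<integral>\<zeta>. X \<zeta> * cnj (f \<zeta>) \<partial>\<sigma>2)"
      unfolding d(2) by (subst integral_density) (use h0 in auto)
    also have "(\<integral>\<zeta>. h1 \<zeta> *\<^sub>R (X \<zeta> * cnj (cauchy2 \<zeta> w)) \<partial>M) = (\<integral>\<zeta>. X \<zeta> * cnj (cauchy2 \<zeta> w) \<partial>\<sigma>1)"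
      unfolding d(1) by (subst integral_density) (use h0 in auto)
    finally show ?thesis .
  qed
  have P: "(\<integral>\<zeta>. p \<zeta> * F \<zeta> \<partial>M) = 0" if p: "p \<in> bidisc_algebra" for p
  proof -
    have "(\<integral>\<zeta>. p (fst \<zeta>, snd \<zeta>) * F \<zeta> \<partial>M) = 0"
    proof (rule annihilates_bidisc_algebra[OF M(1) Fi measurable_fst_torus[OF setsM]
        measurable_snd_torus[OF setsM] _ _ _ p])
      show "cmod (fst x) = 1" "cmod (snd x) = 1" if "x \<in> space M" for x
        using that by (auto simp: sp torus_def)
      fix z assume z: "z \<in> bidisc"
      have "(\<integral>\<zeta>. cauchy2 \<zeta> z * F \<zeta> \<partial>M) = (\<integral>\<zeta>. cauchy2 \<zeta> z * cnj (f \<zeta>) \<partial>\<sigma>2) -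
          (\<integral>\<zeta>. cauchy2 \<zeta> z * cnj (cauchy2 \<zeta> w) \<partial>\<sigma>1)"
        by (rule T[OF _ norm_cauchy2_le[OF _ z]]) (simp_all add: bm)
      also have "(\<integral>\<zeta>. cauchy2 \<zeta> z * cnj (f \<zeta>) \<partial>\<sigma>2) = (\<integral>\<zeta>. cnj (f \<zeta> * cnj (cauchy2 \<zeta> z)) \<partial>\<sigma>2)"
        by (simp add: mult.commute)
      also have "\<dots> = cnj (\<integral>\<zeta>. f \<zeta> * cnj (cauchy2 \<zeta> z) \<partial>\<sigma>2)"
        by (rule Bochner_Integration.integral_cnj)
      also have "\<dots> = cnj (\<integral>\<zeta>. cauchy2 \<zeta> w * cnj (cauchy2 \<zeta> z) \<partial>\<sigma>1)"
        unfolding transforms_eq[OF z] ..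
      also have "\<dots> = (\<integral>\<zeta>. cnj (cauchy2 \<zeta> w * cnj (cauchy2 \<zeta> z)) \<partial>\<sigma>1)"
        by (rule Bochner_Integration.integral_cnj[symmetric])
      also have "\<dots> = (\<integral>\<zeta>. cauchy2 \<zeta> z * cnj (cauchy2 \<zeta> w) \<partial>\<sigma>1)" by (simp add: mult.commute)
      finally show "(\<integral>x. cauchy2 (fst x, snd x) z * F x \<partial>M) = 0" by simp
    qed
    then show ?thesis by simp
  qed
  show ?thesis by (rule that[OF M(1) setsM Fi T P])
qed

text \<open>The factor cnj C(\<zeta>, w) attached to \<sigma>1 is undone by two factors of modulus
  at most 2 each. Over a cylinder only multipliers in the first coordinate are admissible; there
  only the first factor is removed, which leaves a function of \<zeta>2.\<close>

lemma inverse_cauchy2: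
  assumes "\<zeta> \<in> torus"
  shows "(1 - cnj (fst \<zeta>) * fst w) * (1 - cnj (snd \<zeta>) * snd w) * cnj (cauchy2 \<zeta> w) = 1"
    and "cmod ((1 - cnj (fst \<zeta>) * fst w) * (1 - cnj (snd \<zeta>) * snd w)) \<le> 4"
    and "(1 - cnj (fst \<zeta>) * fst w) * cnj (cauchy2 \<zeta> w) = 1 / (1 - snd w * cnj (snd \<zeta>))"
    and "cmod (1 - cnj (fst \<zeta>) * fst w) \<le> 2"
proof -
  have l: "cmod (cnj (fst \<zeta>)) \<le> 1" "cmod (cnj (snd \<zeta>)) \<le> 1" "cmod (fst w) < 1" "cmod (snd w) < 1"
    using assms w by (auto simp: torus_def bidisc_def)
  have ne: "1 - cnj (fst \<zeta>) * fst w \<noteq> 0" "1 - cnj (snd \<zeta>) * snd w \<noteq> 0"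
    using one_minus_mult_bound(1) l by blast+
  have c: "cnj (cauchy2 \<zeta> w) = 1 / (1 - cnj (fst \<zeta>) * fst w) * (1 / (1 - cnj (snd \<zeta>) * snd w))"
    by (simp add: cauchy2_def)
  show "(1 - cnj (fst \<zeta>) * fst w) * (1 - cnj (snd \<zeta>) * snd w) * cnj (cauchy2 \<zeta> w) = 1"
    unfolding c using ne by simp
  show "(1 - cnj (fst \<zeta>) * fst w) * cnj (cauchy2 \<zeta> w) = 1 / (1 - snd w * cnj (snd \<zeta>))"
    unfolding c using ne by (simp add: mult.commute)
  have b: "cmod (1 - u * v) \<le> 2" if "cmod u \<le> 1" "cmod v < 1" for u v
  proof -
    have "cmod (u * v) \<le> 1" using that by (simp add: norm_mult mult_le_one)
    then show ?thesis using norm_triangle_ineq4[of 1 "u * v"] by simp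
  qed
  show "cmod (1 - cnj (fst \<zeta>) * fst w) \<le> 2" using b l by blast
  have "cmod (1 - cnj (fst \<zeta>) * fst w) * cmod (1 - cnj (snd \<zeta>) * snd w) \<le> 2 * 2"
    using b l by (intro mult_mono) auto
  then show "cmod ((1 - cnj (fst \<zeta>) * fst w) * (1 - cnj (snd \<zeta>) * snd w)) \<le> 4" by (simp add: norm_mult)
qed

lemma nn_integral_eq_norm:
  fixes g :: "complex \<times> complex \<Rightarrow> real"
  assumes g: "g \<in> borel_measurable \<sigma>1" "\<And>\<zeta>. \<zeta> \<in> space \<sigma>1 \<Longrightarrow> 0 \<le> g \<zeta> \<and> g \<zeta> \<le> B"
  shows "(\<integral>\<^sup>+\<zeta>. ennreal (g \<zeta>) \<partial>\<sigma>1) = ennreal (cmod (\<integral>\<zeta>. of_real (g \<zeta>) \<partial>\<sigma>1))"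
proof -
  have "integrable \<sigma>1 g"
    using g by (intro finite_measure.integrable_const_bound[OF c1.finite, where B=B] AE_I2) auto
  then have "(\<integral>\<^sup>+\<zeta>. ennreal (g \<zeta>) \<partial>\<sigma>1) = ennreal (\<integral>\<zeta>. g \<zeta> \<partial>\<sigma>1)"
    using g by (intro nn_integral_eq_integral AE_I2) auto
  moreover have "0 \<le> (\<integral>\<zeta>. g \<zeta> \<partial>\<sigma>1)"
    using g by (intro Bochner_Integration.integral_nonneg_AE AE_I2) auto
  ultimately show ?thesis by simp
qed

text \<open>Put q = 1 / cnj C(\<cdot>, w). Integrating \<phi> q over N against the annihilating
  measure gives 0, that is, the integral of \<phi> over N with respect to \<sigma>1 equals that of
  \<phi> q cnj f with respect to \<sigma>2. The latter is bounded by Cauchy-Schwarz.\<close>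

theorem L2_dominated_on_null_set:
  assumes N: "null_set_for (annihilator bidisc_algebra) N"
  shows "L2_dominated_on N \<sigma>1 \<sigma>2"
proof -
  obtain M F where M: "finite_measure M" "sets M = sets torus_borel" "integrable M F"
    and T: "\<And>X B. \<lbrakk>X \<in> borel_measurable torus_borel; \<And>\<zeta>. \<zeta> \<in> torus \<Longrightarrow> cmod (X \<zeta>) \<le> B\<rbrakk> \<Longrightarrow>
      (\<integral>\<zeta>. X \<zeta> * F \<zeta> \<partial>M) = (\<integral>\<zeta>. X \<zeta> * cnj (f \<zeta>) \<partial>\<sigma>2) - (\<integral>\<zeta>. X \<zeta> * cnj (cauchy2 \<zeta> w) \<partial>\<sigma>1)"
    and P: "\<And>p. p \<in> bidisc_algebra \<Longrightarrow> (\<integral>\<zeta>. p \<zeta> * F \<zeta> \<partial>M) = 0"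
    by (rule annihilating_density) blast
  have sp: "space M = torus" by (rule space_torus[OF M(2)])
  have Nt: "N \<in> sets torus_borel" using N by (simp add: null_set_for_def)
  then have NM[measurable]: "N \<in> sets M" "N \<in> sets torus_borel" "N \<in> sets \<sigma>1" "N \<in> sets \<sigma>2"
    using M(2) c1.sets c2.sets by auto
  define \<nu> where "\<nu> A = (\<integral>x. indicator A x * F x \<partial>M)" for A
  have "\<nu> \<in> annihilator bidisc_algebra"
    unfolding annihilator_def
  proof (intro CollectI conjI ballI)
    show "complex_measure torus_borel \<nu>"
      unfolding \<nu>_def[abs_def] by (rule complex_measure_density[OF M(3,2)])
    fix p assume p: "p \<in> bidisc_algebra"
    then have pc: "continuous_on closed_bidisc p" by (simp add: bidisc_algebra_def)
    have sub: "torus \<subseteq> closed_bidisc" unfolding torus_def closed_bidisc_def by auto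
    have "compact torus" unfolding torus_def by (intro compact_Times compact_sphere)
    then have "bounded (p ` torus)"
      by (intro compact_imp_bounded compact_continuous_image continuous_on_subset[OF pc sub])
    then obtain B where B: "\<And>z. z \<in> torus \<Longrightarrow> cmod (p z) \<le> B" by (auto simp: bounded_iff)
    have "p \<in> borel_measurable torus_borel"
      by (rule borel_measurable_continuous_on_restrict[OF continuous_on_subset[OF pc sub]])
    then have pM: "p \<in> borel_measurable M" using measurable_cong_sets[OF M(2) refl] by blast
    show "cm_integral torus_borel \<nu> p = 0"
      unfolding \<nu>_def[abs_def] using cm_integral_density[OF M(3,2) pM B] P[OF p] by (simp add: sp)
  qed
  then have tv: "total_variation torus_borel \<nu> N = 0" using N by (auto simp: null_set_for_def)
  \<comment> \<open>Zero total variation on N gives vanishing on every Borel subset of N, which is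
    the form needed to insert a multiplier.\<close>
  have zero: "(\<integral>x. indicator E x * (indicator N x * F x) \<partial>M) = 0" if E: "E \<in> sets M" for E
  proof -
    have "\<nu> (E \<inter> N) = 0"
      using total_variation_zero_subset[OF tv Nt, of "E \<inter> N"] E Nt M(2) by auto
    then show ?thesis unfolding \<nu>_def by (simp add: indicator_inter_arith mult.assoc)
  qed
  have NF: "integrable M (\<lambda>x. indicator N x * F x)"
  proof -
    have [measurable]: "F \<in> borel_measurable M" using M(3) by auto
    show ?thesis by (rule Bochner_Integration.integrable_bound[OF M(3)]) (auto simp: indicator_def)
  qed
  \<comment> \<open>Here 4 is the bound for |q| from \<open>inverse_cauchy2\<close>.\<close>
  define K where "K = 4 * sqrt (\<integral>x. (cmod (f x))\<^sup>2 \<partial>\<sigma>2)"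
  have K: "0 \<le> K" unfolding K_def by (intro mult_nonneg_nonneg real_sqrt_ge_zero
      Bochner_Integration.integral_nonneg) auto
  show ?thesis
    unfolding L2_dominated_on_def
  proof (intro exI[of _ K] conjI K allI impI)
    fix \<phi> :: "complex \<times> complex \<Rightarrow> real" and B
    assume \<phi>: "\<phi> \<in> borel_measurable borel" "\<forall>\<zeta>. 0 \<le> \<phi> \<zeta> \<and> \<phi> \<zeta> \<le> B"
    have ct: "sets torus_borel = sets torus_borel" ..
    have \<phi>m[measurable]: "\<phi> \<in> borel_measurable M" "\<phi> \<in> borel_measurable torus_borel"
        "\<phi> \<in> borel_measurable \<sigma>1" "\<phi> \<in> borel_measurable \<sigma>2"
      by (rule borel_measurable_torus[OF _ \<phi>(1)], rule M c1.sets c2.sets ct)+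
    note [measurable] = measurable_fst_torus[OF M(2)] measurable_snd_torus[OF M(2)]
      measurable_fst_torus[OF ct] measurable_snd_torus[OF ct]
    define q where "q \<zeta> = (1 - cnj (fst \<zeta>) * fst w) * (1 - cnj (snd \<zeta>) * snd w)" for \<zeta> :: "complex \<times> complex"
    define X where "X \<zeta> = of_real (\<phi> \<zeta>) * q \<zeta>" for \<zeta>
    have Xm[measurable]: "X \<in> borel_measurable M" "X \<in> borel_measurable torus_borel" "X \<in> borel_measurable \<sigma>2"
      unfolding X_def q_def by measurable
    have XB: "cmod (X \<zeta>) \<le> 4 * \<phi> \<zeta>" if "\<zeta> \<in> torus" for \<zeta>
      using mult_left_mono[OF inverse_cauchy2(2)[OF that], of "\<phi> \<zeta>"] \<phi>(2)[rule_format, of \<zeta>]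
      unfolding X_def q_def norm_mult[of "of_real _"] norm_of_real by (simp add: mult.commute abs_of_nonneg)
    have XB4: "cmod (X \<zeta>) \<le> 4 * B" if "\<zeta> \<in> torus" for \<zeta>
      using XB[OF that] \<phi>(2)[rule_format, of \<zeta>] by linarith
    have "(\<integral>x. X x * (indicator N x * F x) \<partial>M) = 0"
      by (rule integral_multiplier_zero[OF NF _ zero Xm(1), where B="4 * B"]) (use XB4 sp in auto)
    then have "(\<integral>x. (X x * indicator N x) * F x \<partial>M) = 0" by (simp only: mult.assoc)
    moreover have "(\<integral>x. (X x * indicator N x) * F x \<partial>M) =
        (\<integral>\<zeta>. (X \<zeta> * indicator N \<zeta>) * cnj (f \<zeta>) \<partial>\<sigma>2) - (\<integral>\<zeta>. (X \<zeta> * indicator N \<zeta>) * cnj (cauchy2 \<zeta> w) \<partial>\<sigma>1)"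
    proof (rule T)
      show "(\<lambda>\<zeta>. X \<zeta> * indicator N \<zeta>) \<in> borel_measurable torus_borel" by measurable
      show "cmod (X \<zeta> * indicator N \<zeta>) \<le> 4 * B" if "\<zeta> \<in> torus" for \<zeta>
        using XB4[OF that] norm_ge_zero[of "X \<zeta>"] by (auto simp: indicator_def simp del: norm_ge_zero)
    qed
    ultimately have "(\<integral>\<zeta>. (X \<zeta> * indicator N \<zeta>) * cnj (f \<zeta>) \<partial>\<sigma>2) =
        (\<integral>\<zeta>. (X \<zeta> * indicator N \<zeta>) * cnj (cauchy2 \<zeta> w) \<partial>\<sigma>1)"
      by simp
    also have "\<dots> = (\<integral>\<zeta>. of_real (indicator N \<zeta> * \<phi> \<zeta>) \<partial>\<sigma>1)"
    proof (rule Bochner_Integration.integral_cong[OF refl])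
      fix \<zeta> assume "\<zeta> \<in> space \<sigma>1"
      then have "q \<zeta> * cnj (cauchy2 \<zeta> w) = 1" unfolding q_def using inverse_cauchy2(1) by (simp add: c1.space)
      moreover have "(X \<zeta> * indicator N \<zeta>) * cnj (cauchy2 \<zeta> w) =
          of_real (\<phi> \<zeta>) * indicator N \<zeta> * (q \<zeta> * cnj (cauchy2 \<zeta> w))"
        unfolding X_def by (simp only: mult_ac)
      ultimately show "(X \<zeta> * indicator N \<zeta>) * cnj (cauchy2 \<zeta> w) = of_real (indicator N \<zeta> * \<phi> \<zeta>)"
        by (simp add: indicator_def)
    qed
    finally have key: "(\<integral>\<zeta>. of_real (indicator N \<zeta> * \<phi> \<zeta>) \<partial>\<sigma>1) =
        (\<integral>\<zeta>. (X \<zeta> * indicator N \<zeta>) * cnj (f \<zeta>) \<partial>\<sigma>2)" ..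
    have "cmod (\<integral>\<zeta>. (X \<zeta> * indicator N \<zeta>) * cnj (f \<zeta>) \<partial>\<sigma>2) \<le> K * sqrt (\<integral>\<zeta>. (\<phi> \<zeta>)\<^sup>2 \<partial>\<sigma>2)"
      unfolding K_def
    proof (rule cauchy_schwarz_bound[OF c2.finite f])
      show "(\<lambda>\<zeta>. X \<zeta> * indicator N \<zeta>) \<in> borel_measurable \<sigma>2" by measurable
      show "cmod (X \<zeta> * indicator N \<zeta>) \<le> 4 * \<phi> \<zeta>" if "\<zeta> \<in> space \<sigma>2" for \<zeta>
        using XB[of \<zeta>] that \<phi>(2)[rule_format, of \<zeta>] by (auto simp: indicator_def c2.space)
    qed (use \<phi> in \<open>auto\<close>)
    moreover have "(\<integral>\<^sup>+\<zeta>. indicator N \<zeta> * ennreal (\<phi> \<zeta>) \<partial>\<sigma>1) =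
        ennreal (cmod (\<integral>\<zeta>. of_real (indicator N \<zeta> * \<phi> \<zeta>) \<partial>\<sigma>1))"
    proof -
      have "(\<integral>\<^sup>+\<zeta>. indicator N \<zeta> * ennreal (\<phi> \<zeta>) \<partial>\<sigma>1) = (\<integral>\<^sup>+\<zeta>. ennreal (indicator N \<zeta> * \<phi> \<zeta>) \<partial>\<sigma>1)"
        by (intro nn_integral_cong) (auto simp: indicator_def)
      also have "\<dots> = ennreal (cmod (\<integral>\<zeta>. of_real (indicator N \<zeta> * \<phi> \<zeta>) \<partial>\<sigma>1))"
      proof (rule nn_integral_eq_norm)
        show "0 \<le> indicator N \<zeta> * \<phi> \<zeta> \<and> indicator N \<zeta> * \<phi> \<zeta> \<le> B" for \<zeta>
          using \<phi>(2)[rule_format, of \<zeta>] by (auto simp: indicator_def)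
      qed measurable
      finally show ?thesis .
    qed
    ultimately show "(\<integral>\<^sup>+\<zeta>. indicator N \<zeta> * ennreal (\<phi> \<zeta>) \<partial>\<sigma>1) \<le> ennreal (K * sqrt (\<integral>\<zeta>. (\<phi> \<zeta>)\<^sup>2 \<partial>\<sigma>2))"
      unfolding key by (simp only: ennreal_leI)
  qed
qed


text \<open>The Riesz theorem kills only the first marginal of the annihilating measure over Z, so
  \<phi> is replaced by its mean \<psi> over the second coordinate. The product structure of
  \<sigma>1 leaves the integral of \<phi> over the cylinder unchanged, and that of \<sigma>2
  together with Jensen's inequality does not increase the square integral. The factor 1 / (1 - w2
  cnj \<zeta>2) that cannot be divided out has mean 1.\<close>

theorem L2_dominated_on_cylinder:
  assumes Z: "Z \<in> sets circle_borel" "emeasure circle_lebesgue Z = 0"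
  shows "L2_dominated_on (Z \<times> UNIV) \<sigma>1 \<sigma>2"
proof -
  obtain M F where M: "finite_measure M" "sets M = sets torus_borel" "integrable M F"
    and T: "\<And>X B. \<lbrakk>X \<in> borel_measurable torus_borel; \<And>\<zeta>. \<zeta> \<in> torus \<Longrightarrow> cmod (X \<zeta>) \<le> B\<rbrakk> \<Longrightarrow>
      (\<integral>\<zeta>. X \<zeta> * F \<zeta> \<partial>M) = (\<integral>\<zeta>. X \<zeta> * cnj (f \<zeta>) \<partial>\<sigma>2) - (\<integral>\<zeta>. X \<zeta> * cnj (cauchy2 \<zeta> w) \<partial>\<sigma>1)"
    and P: "\<And>p. p \<in> bidisc_algebra \<Longrightarrow> (\<integral>\<zeta>. p \<zeta> * F \<zeta> \<partial>M) = 0"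
    by (rule annihilating_density) blast
  interpret C: prob_space circle_mean by (rule prob_space_circle_mean)
  have sp: "space M = torus" by (rule space_torus[OF M(2)])
  have ct: "sets torus_borel = sets torus_borel" ..
  have Zs: "Z \<in> sets borel \<and> Z \<subseteq> sphere 0 1" using Z(1) by (subst (asm) sets_restrict_space_iff) auto
  then have Zb[measurable]: "Z \<in> sets borel" by simp
  have coordsM: "fst \<in> borel_measurable M" "snd \<in> borel_measurable M"
    and coordsT: "fst \<in> borel_measurable torus_borel" "snd \<in> borel_measurable torus_borel"
    using measurable_fst_torus[OF M(2)] measurable_snd_torus[OF M(2)]
      measurable_fst_torus[OF ct] measurable_snd_torus[OF ct] by auto
  note [measurable] = coordsM coordsT
  have Fm[measurable]: "F \<in> borel_measurable M" using M(3) by auto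
  have zero: "(\<integral>\<zeta>. indicator Y (fst \<zeta>) * F \<zeta> \<partial>M) = 0"
    if Y: "Y \<in> sets circle_borel" "emeasure circle_lebesgue Y = 0" for Y
  proof (rule F_and_M_Riesz[OF M(3) coordsM(1) _ _ Y])
    fix g assume g: "continuous_on (cball 0 1) g" "g holomorphic_on ball 0 1"
    show "(\<integral>x. g (fst x) * F x \<partial>M) = 0"
      using P[OF bidisc_algebra_mult_power[OF g, of 0]] by simp
  qed (auto simp: sp torus_def)
  have ZF: "integrable M (\<lambda>\<zeta>. indicator Z (fst \<zeta>) * F \<zeta>)"
    by (rule Bochner_Integration.integrable_bound[OF M(3)]) (auto simp: indicator_def)
  have zero': "(\<integral>\<zeta>. indicator E (fst \<zeta>) * (indicator Z (fst \<zeta>) * F \<zeta>) \<partial>M) = 0" if E: "E \<in> sets borel" for E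
    using zero[OF c1.null_Int[OF Z E]] by (simp add: indicator_inter_arith mult_ac)
  define K where "K = 2 * sqrt (\<integral>x. (cmod (f x))\<^sup>2 \<partial>\<sigma>2)"
  have K: "0 \<le> K" unfolding K_def by (intro mult_nonneg_nonneg real_sqrt_ge_zero
      Bochner_Integration.integral_nonneg) auto
  show ?thesis
    unfolding L2_dominated_on_def
  proof (intro exI[of _ K] conjI K allI impI)
    fix \<phi> :: "complex \<times> complex \<Rightarrow> real" and B
    assume \<phi>: "\<phi> \<in> borel_measurable borel" "\<forall>\<zeta>. 0 \<le> \<phi> \<zeta> \<and> \<phi> \<zeta> \<le> B"
    have \<phi>m[measurable]: "\<phi> \<in> borel_measurable borel" by fact
    have \<phi>0: "0 \<le> \<phi> \<zeta>" "\<phi> \<zeta> \<le> B" for \<zeta> using \<phi>(2) by blast+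
    have \<phi>2m[measurable]: "\<phi> \<in> borel_measurable \<sigma>2" by (rule borel_measurable_torus[OF c2.sets \<phi>(1)])
    have sl[measurable]: "(\<lambda>v. \<phi> (a, v)) \<in> borel_measurable borel" for a
    proof -
      have "(\<lambda>v::complex. (a, v)) \<in> borel_measurable borel"
        by (intro borel_measurable_continuous_onI continuous_intros)
      from measurable_compose[OF this \<phi>(1)] show ?thesis .
    qed
    have B0: "0 \<le> B" using \<phi>0[of 0] by simp
    have isl: "integrable circle_mean (\<lambda>v. \<phi> (a, v))" for a
      using \<phi>0 by (intro C.integrable_const_bound[where B=B] AE_I2) auto
    have isl2: "integrable circle_mean (\<lambda>v. (\<phi> (a, v))\<^sup>2)" for a
    proof (intro C.integrable_const_bound[where B="B\<^sup>2"] AE_I2)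
      show "norm ((\<phi> (a, v))\<^sup>2) \<le> B\<^sup>2" for v using \<phi>0[of "(a, v)"] by (simp add: power_mono)
    qed measurable
    define \<psi> where "\<psi> a = (\<integral>v. \<phi> (a, v) \<partial>circle_mean)" for a
    have \<psi>m[measurable]: "\<psi> \<in> borel_measurable borel"
    proof -
      have sets: "sets (borel \<Otimes>\<^sub>M circle_mean) = sets (borel :: (complex \<times> complex) measure)"
        by (simp add: borel_prod[symmetric] cong: sets_pair_measure_cong)
      have "(\<lambda>(a, v). \<phi> (a, v)) \<in> borel_measurable (borel \<Otimes>\<^sub>M circle_mean)"
        using \<phi>(1) unfolding measurable_cong_sets[OF sets refl] by simp
      then show ?thesis unfolding \<psi>_def[abs_def] by (rule C.borel_measurable_lebesgue_integral)
    qed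
    have \<psi>0: "0 \<le> \<psi> a" for a
      unfolding \<psi>_def using \<phi>0 by (intro Bochner_Integration.integral_nonneg) auto
    have \<psi>B: "\<psi> a \<le> B" for a
    proof -
      have "\<psi> a \<le> (\<integral>v. B \<partial>circle_mean)" unfolding \<psi>_def using \<phi>0 isl by (intro integral_mono) auto
      then show ?thesis using C.prob_space by simp
    qed
    have \<psi>nn: "ennreal (\<psi> a) = (\<integral>\<^sup>+v. ennreal (\<phi> (a, v)) \<partial>circle_mean)" for a
      unfolding \<psi>_def using \<phi>0 by (intro nn_integral_eq_integral[symmetric] isl AE_I2) auto
    have \<psi>sq: "ennreal ((\<psi> a)\<^sup>2) \<le> (\<integral>\<^sup>+v. ennreal ((\<phi> (a, v))\<^sup>2) \<partial>circle_mean)" for a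
    proof -
      \<comment> \<open>Nonnegativity of the variance is Jensen's inequality for the square.\<close>
      have "0 \<le> (\<integral>v. (\<phi> (a, v) - \<psi> a)\<^sup>2 \<partial>circle_mean)" by (intro Bochner_Integration.integral_nonneg) auto
      also have "\<dots> = (\<integral>v. (\<phi> (a, v))\<^sup>2 - 2 * \<psi> a * \<phi> (a, v) + (\<psi> a)\<^sup>2 \<partial>circle_mean)"
        by (intro Bochner_Integration.integral_cong) (auto simp: power2_diff)
      also have "\<dots> = (\<integral>v. (\<phi> (a, v))\<^sup>2 \<partial>circle_mean) - 2 * \<psi> a * \<psi> a + (\<psi> a)\<^sup>2"
        using isl[of a] isl2[of a] C.prob_space unfolding \<psi>_def[of a] by simp
      finally have "(\<psi> a)\<^sup>2 \<le> (\<integral>v. (\<phi> (a, v))\<^sup>2 \<partial>circle_mean)" by (simp add: power2_eq_square)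
      then show ?thesis
        by (subst nn_integral_eq_integral[OF isl2]) (auto intro: ennreal_leI)
    qed
    \<comment> \<open>The multiplier \<psi>(\<zeta>1) (1 - cnj \<zeta>1 w1), cut off to the circle
      so that it is bounded on the whole plane.\<close>
    define \<eta> where "\<eta> a = indicator (sphere 0 1) a * of_real (\<psi> a) * (1 - cnj a * fst w)" for a :: complex
    have sph[measurable]: "sphere (0::complex) 1 \<in> sets borel" by (intro borel_closed closed_sphere)
    have \<eta>m[measurable]: "\<eta> \<in> borel_measurable borel"
    proof -
      have [measurable]: "(\<lambda>a. cnj a) \<in> borel_measurable borel"
        by (intro borel_measurable_continuous_onI continuous_on_cnj continuous_on_id)
      show ?thesis unfolding \<eta>_def by measurable
    qed
    have one_w: "cmod (1 - cnj a * fst w) \<le> 2" if "cmod a = 1" for a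
      using inverse_cauchy2(4)[of "(a, 1)"] that by (simp add: torus_def)
    have \<eta>\<psi>: "cmod (\<eta> a) \<le> 2 * \<psi> a" for a
    proof (cases "cmod a = 1")
      case True
      have "cmod (\<eta> a) = \<psi> a * cmod (1 - cnj a * fst w)"
        using True \<psi>0[of a] by (simp add: \<eta>_def norm_mult)
      also have "\<dots> \<le> \<psi> a * 2" by (intro mult_left_mono one_w True \<psi>0)
      finally show ?thesis by simp
    qed (use \<psi>0 in \<open>simp add: \<eta>_def\<close>)
    have \<eta>B: "cmod (\<eta> a) \<le> 2 * B" for a using \<eta>\<psi>[of a] \<psi>B[of a] by linarith
    have "(\<integral>\<zeta>. \<eta> (fst \<zeta>) * (indicator Z (fst \<zeta>) * F \<zeta>) \<partial>M) = 0"
      by (rule integral_multiplier_zero[OF ZF coordsM(1) zero' \<eta>m \<eta>B])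
    then have "(\<integral>\<zeta>. (\<eta> (fst \<zeta>) * indicator Z (fst \<zeta>)) * F \<zeta> \<partial>M) = 0" by (simp only: mult.assoc)
    moreover have "(\<integral>\<zeta>. (\<eta> (fst \<zeta>) * indicator Z (fst \<zeta>)) * F \<zeta> \<partial>M) =
        (\<integral>\<zeta>. (\<eta> (fst \<zeta>) * indicator Z (fst \<zeta>)) * cnj (f \<zeta>) \<partial>\<sigma>2) -
            (\<integral>\<zeta>. (\<eta> (fst \<zeta>) * indicator Z (fst \<zeta>)) * cnj (cauchy2 \<zeta> w) \<partial>\<sigma>1)"
    proof (rule T)
      show "(\<lambda>\<zeta>. \<eta> (fst \<zeta>) * indicator Z (fst \<zeta>)) \<in> borel_measurable torus_borel" by measurable
      show "cmod (\<eta> (fst \<zeta>) * indicator Z (fst \<zeta>)) \<le> 2 * B" for \<zeta> :: "complex \<times> complex"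
        using \<eta>B[of "fst \<zeta>"] B0 by (auto simp: indicator_def)
    qed
    ultimately have "(\<integral>\<zeta>. (\<eta> (fst \<zeta>) * indicator Z (fst \<zeta>)) * cnj (f \<zeta>) \<partial>\<sigma>2) =
        (\<integral>\<zeta>. (\<eta> (fst \<zeta>) * indicator Z (fst \<zeta>)) * cnj (cauchy2 \<zeta> w) \<partial>\<sigma>1)"
      by simp
    also have "\<dots> = (\<integral>\<zeta>. of_real (\<psi> (fst \<zeta>)) * (indicator Z (fst \<zeta>) * (1 / (1 - snd w * cnj (snd \<zeta>)))) \<partial>\<sigma>1)"
    proof (rule Bochner_Integration.integral_cong[OF refl])
      fix \<zeta> assume "\<zeta> \<in> space \<sigma>1"
      then have \<zeta>: "\<zeta> \<in> torus" by (simp add: c1.space)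
      then have "\<eta> (fst \<zeta>) = of_real (\<psi> (fst \<zeta>)) * (1 - cnj (fst \<zeta>) * fst w)" by (auto simp: \<eta>_def torus_def)
      then have "(\<eta> (fst \<zeta>) * indicator Z (fst \<zeta>)) * cnj (cauchy2 \<zeta> w) =
          of_real (\<psi> (fst \<zeta>)) * (indicator Z (fst \<zeta>) * ((1 - cnj (fst \<zeta>) * fst w) * cnj (cauchy2 \<zeta> w)))"
        by (simp only: mult_ac)
      then show "(\<eta> (fst \<zeta>) * indicator Z (fst \<zeta>)) * cnj (cauchy2 \<zeta> w) =
          of_real (\<psi> (fst \<zeta>)) * (indicator Z (fst \<zeta>) * (1 / (1 - snd w * cnj (snd \<zeta>))))"
        unfolding inverse_cauchy2(3)[OF \<zeta>] .
    qed
    also have "\<dots> = (\<integral>v. 1 / (1 - snd w * cnj v) \<partial>circle_lebesgue) *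
        (\<integral>\<zeta>. of_real (\<psi> (fst \<zeta>)) * indicator Z (fst \<zeta>) \<partial>\<sigma>1)"
    proof (rule c1.integral_over_null_set[OF Z])
      show "(\<lambda>a. complex_of_real (\<psi> a)) \<in> borel_measurable borel" by measurable
      show "cmod (complex_of_real (\<psi> a)) \<le> B" for a using \<psi>0[of a] \<psi>B[of a] by simp
      have [measurable]: "(\<lambda>a. cnj a) \<in> borel_measurable borel"
        by (intro borel_measurable_continuous_onI continuous_on_cnj continuous_on_id)
      show "(\<lambda>v. 1 / (1 - snd w * cnj v)) \<in> borel_measurable borel" by measurable
      show "cmod (1 / (1 - snd w * cnj v)) \<le> 1 / (1 - cmod (snd w))" if "cmod v = 1" for v
        using one_minus_mult_bound(2)[of "cnj v" "snd w"] w that by (auto simp: bidisc_def mult.commute)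
    qed
    \<comment> \<open>Cauchy's mean formula for the constant function 1.\<close>
    also have "(\<integral>v. 1 / (1 - snd w * cnj v) \<partial>circle_lebesgue) = 1"
      using cauchy_mean_formula[of "\<lambda>_. 1" "snd w"] w by (auto simp: bidisc_def)
    also have "1 * (\<integral>\<zeta>. of_real (\<psi> (fst \<zeta>)) * indicator Z (fst \<zeta>) \<partial>\<sigma>1) =
        (\<integral>\<zeta>. of_real (indicator Z (fst \<zeta>) * \<psi> (fst \<zeta>)) \<partial>\<sigma>1)"
      unfolding mult_1 by (intro Bochner_Integration.integral_cong) (auto simp: indicator_def)
    finally have key: "(\<integral>\<zeta>. of_real (indicator Z (fst \<zeta>) * \<psi> (fst \<zeta>)) \<partial>\<sigma>1) =
        (\<integral>\<zeta>. (\<eta> (fst \<zeta>) * indicator Z (fst \<zeta>)) * cnj (f \<zeta>) \<partial>\<sigma>2)" ..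
    have gB: "0 \<le> indicator Z (fst \<zeta>) * \<psi> (fst \<zeta>) \<and> indicator Z (fst \<zeta>) * \<psi> (fst \<zeta>) \<le>
        B" for \<zeta> :: "complex \<times> complex"
      using \<psi>0[of "fst \<zeta>"] \<psi>B[of "fst \<zeta>"] B0 by (auto simp: indicator_def)
    have 1: "cmod (\<integral>\<zeta>. (\<eta> (fst \<zeta>) * indicator Z (fst \<zeta>)) * cnj (f \<zeta>) \<partial>\<sigma>2) \<le>
        K * sqrt (\<integral>\<zeta>. (indicator Z (fst \<zeta>) * \<psi> (fst \<zeta>))\<^sup>2 \<partial>\<sigma>2)"
      unfolding K_def
    proof (rule cauchy_schwarz_bound[OF c2.finite f _ _ _ gB])
      show "(\<lambda>\<zeta>. \<eta> (fst \<zeta>) * indicator Z (fst \<zeta>)) \<in> borel_measurable \<sigma>2" by measurable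
      show "(\<lambda>\<zeta>. indicator Z (fst \<zeta>) * \<psi> (fst \<zeta>)) \<in> borel_measurable \<sigma>2" by measurable
      show "cmod (\<eta> (fst \<zeta>) * indicator Z (fst \<zeta>)) \<le>
          2 * (indicator Z (fst \<zeta>) * \<psi> (fst \<zeta>))" for \<zeta> :: "complex \<times> complex"
        using \<eta>\<psi>[of "fst \<zeta>"] by (auto simp: indicator_def)
    qed simp
    have 2: "(\<integral>\<zeta>. (indicator Z (fst \<zeta>) * \<psi> (fst \<zeta>))\<^sup>2 \<partial>\<sigma>2) \<le> (\<integral>\<zeta>. (\<phi> \<zeta>)\<^sup>2 \<partial>\<sigma>2)"
    proof -
      have i1: "integrable \<sigma>2 (\<lambda>\<zeta>. (indicator Z (fst \<zeta>) * \<psi> (fst \<zeta>))\<^sup>2)"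
      proof (rule finite_measure.integrable_const_bound[OF c2.finite, where B="B\<^sup>2"])
        show "AE \<zeta> in \<sigma>2. norm ((indicator Z (fst \<zeta>) * \<psi> (fst \<zeta>))\<^sup>2) \<le> B\<^sup>2"
          using gB by (intro AE_I2) (simp add: power_mono)
      qed measurable
      have i2: "integrable \<sigma>2 (\<lambda>\<zeta>. (\<phi> \<zeta>)\<^sup>2)"
      proof (rule finite_measure.integrable_const_bound[OF c2.finite, where B="B\<^sup>2"])
        show "AE \<zeta> in \<sigma>2. norm ((\<phi> \<zeta>)\<^sup>2) \<le> B\<^sup>2" using \<phi>0 by (intro AE_I2) (simp add: power_mono)
      qed measurable
      \<comment> \<open>The comparison runs through nonnegative integrals because
        \<open>nn_integral_over_null_set\<close> is a statement about those.\<close>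
      have "ennreal (\<integral>\<zeta>. (indicator Z (fst \<zeta>) * \<psi> (fst \<zeta>))\<^sup>2 \<partial>\<sigma>2) =
          (\<integral>\<^sup>+\<zeta>. ennreal ((indicator Z (fst \<zeta>) * \<psi> (fst \<zeta>))\<^sup>2) \<partial>\<sigma>2)"
        by (rule nn_integral_eq_integral[OF i1, symmetric]) auto
      also have "\<dots> \<le> (\<integral>\<^sup>+\<zeta>. indicator Z (fst \<zeta>) * (\<integral>\<^sup>+v. ennreal ((\<phi> (fst \<zeta>, v))\<^sup>2) \<partial>circle_mean) \<partial>\<sigma>2)"
        using \<psi>sq by (intro nn_integral_mono) (auto simp: indicator_def)
      also have "\<dots> = (\<integral>\<^sup>+\<zeta>. indicator Z (fst \<zeta>) * ennreal ((\<phi> \<zeta>)\<^sup>2) \<partial>\<sigma>2)"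
        by (rule c2.nn_integral_over_null_set[OF Z, symmetric]) measurable
      also have "\<dots> \<le> (\<integral>\<^sup>+\<zeta>. ennreal ((\<phi> \<zeta>)\<^sup>2) \<partial>\<sigma>2)"
        by (intro nn_integral_mono) (auto simp: indicator_def)
      also have "\<dots> = ennreal (\<integral>\<zeta>. (\<phi> \<zeta>)\<^sup>2 \<partial>\<sigma>2)"
        by (rule nn_integral_eq_integral[OF i2]) auto
      finally show ?thesis by (subst (asm) ennreal_le_iff) (auto intro: Bochner_Integration.integral_nonneg)
    qed
    have "(\<integral>\<^sup>+\<zeta>. indicator (Z \<times> UNIV) \<zeta> * ennreal (\<phi> \<zeta>) \<partial>\<sigma>1) =
        (\<integral>\<^sup>+\<zeta>. indicator Z (fst \<zeta>) * ennreal (\<phi> \<zeta>) \<partial>\<sigma>1)"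
      by (intro nn_integral_cong) (auto simp: indicator_def)
    also have "\<dots> = (\<integral>\<^sup>+\<zeta>. indicator Z (fst \<zeta>) * (\<integral>\<^sup>+v. ennreal (\<phi> (fst \<zeta>, v)) \<partial>circle_mean) \<partial>\<sigma>1)"
      by (rule c1.nn_integral_over_null_set[OF Z]) measurable
    also have "\<dots> = (\<integral>\<^sup>+\<zeta>. ennreal (indicator Z (fst \<zeta>) * \<psi> (fst \<zeta>)) \<partial>\<sigma>1)"
      unfolding \<psi>nn[symmetric] by (intro nn_integral_cong) (auto simp: indicator_def)
    also have "\<dots> = ennreal (cmod (\<integral>\<zeta>. of_real (indicator Z (fst \<zeta>) * \<psi> (fst \<zeta>)) \<partial>\<sigma>1))"
      by (rule nn_integral_eq_norm[OF _ gB]) measurable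
    also have "\<dots> \<le> ennreal (K * sqrt (\<integral>\<zeta>. (\<phi> \<zeta>)\<^sup>2 \<partial>\<sigma>2))"
      unfolding key
      by (rule ennreal_leI, rule order_trans[OF 1], intro mult_left_mono K real_sqrt_le_mono 2)
    finally show "(\<integral>\<^sup>+\<zeta>. indicator (Z \<times> UNIV) \<zeta> * ennreal (\<phi> \<zeta>) \<partial>\<sigma>1) \<le> ennreal (K * sqrt (\<integral>\<zeta>. (\<phi> \<zeta>)\<^sup>2 \<partial>\<sigma>2))" .
  qed
qed

end

section \<open>Exchange of the two coordinates\<close>

lemma measurable_swap_torus:
  "prod.swap \<in> torus_borel \<rightarrow>\<^sub>M torus_borel"
proof (rule measurable_restrict_space3)
  show "prod.swap \<in> borel \<rightarrow>\<^sub>M (borel :: (complex \<times> complex) measure)"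
    by (intro borel_measurable_continuous_onI continuous_on_swap)
qed (auto simp: torus_def)

lemma cauchy2_swap: "cauchy2 (prod.swap \<zeta>) w = cauchy2 \<zeta> (prod.swap w)"
  by (simp add: cauchy2_def mult.commute)

lemma (in clark) measurable_swap: "prod.swap \<in> \<sigma> \<rightarrow>\<^sub>M torus_borel"
  using measurable_swap_torus measurable_cong_sets[OF sets refl] by blast

lemma (in clark) clark_swap:
  "clark (\<lambda>z. b (prod.swap z)) \<alpha> (distr \<sigma> torus_borel prod.swap)"
proof
  show "holomorphic2_on (\<lambda>z. b (prod.swap z)) bidisc"
    unfolding holomorphic2_on_def
  proof
    fix z assume "z \<in> bidisc"
    then have sz: "prod.swap z \<in> bidisc" by (auto simp: bidisc_def)
    then obtain a c where "(b has_derivative (\<lambda>h. a * fst h + c * snd h)) (at (prod.swap z) within bidisc)"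
      using holomorphic unfolding holomorphic2_on_def by blast
    then have d: "(b has_derivative (\<lambda>h. a * fst h + c * snd h)) (at (prod.swap z))"
      using at_within_open[OF sz open_bidisc] by simp
    have "(prod.swap has_derivative prod.swap) (at z within bidisc)"
      unfolding prod.swap_def[abs_def] by (auto intro!: derivative_eq_intros)
    from has_derivative_compose[OF this d]
    show "\<exists>a c. ((\<lambda>z. b (prod.swap z)) has_derivative (\<lambda>h. a * fst h + c * snd h)) (at z within bidisc)"
      by (intro exI[of _ c] exI[of _ a]) (simp add: add.commute)
  qed
  show "(\<lambda>z. b (prod.swap z)) ` bidisc \<subseteq> ball 0 1"
    using into_disc by (auto simp: bidisc_def)
  show "clark_measure (\<lambda>z. b (prod.swap z)) \<alpha> (distr \<sigma> torus_borel prod.swap)"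
    unfolding clark_measure_def
  proof (intro conjI ballI)
    show "finite_measure (distr \<sigma> torus_borel prod.swap)"
      by (rule finite_measure.finite_measure_distr[OF finite measurable_swap])
    fix z assume z: "z \<in> bidisc"
    then have sz: "prod.swap z \<in> bidisc" by (auto simp: bidisc_def)
    have ct: "sets torus_borel = sets torus_borel" ..
    note [measurable] = measurable_fst_torus[OF ct] measurable_snd_torus[OF ct]
    have m: "poisson2 z \<in> borel_measurable torus_borel" unfolding poisson2_def[abs_def] by measurable
    have "(\<integral>\<zeta>. poisson2 z \<zeta> \<partial>distr \<sigma> torus_borel prod.swap) = (\<integral>\<zeta>. poisson2 z (prod.swap \<zeta>) \<partial>\<sigma>)"
      by (rule integral_distr[OF measurable_swap m])
    also have "\<dots> = (\<integral>\<zeta>. poisson2 (prod.swap z) \<zeta> \<partial>\<sigma>)"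
      by (simp add: poisson2_def mult.commute)
    also have "\<dots> = (1 - (cmod (b (prod.swap z)))\<^sup>2) / (cmod (\<alpha> - b (prod.swap z)))\<^sup>2"
      using clark_measure sz by (auto simp: clark_measure_def)
    finally show "(\<integral>\<zeta>. poisson2 z \<zeta> \<partial>distr \<sigma> torus_borel prod.swap) =
        (1 - (cmod (b (prod.swap z)))\<^sup>2) / (cmod (\<alpha> - b (prod.swap z)))\<^sup>2" .
  qed simp
qed (rule unimodular)

text \<open>The assumptions of \<open>clark_pair\<close> are invariant under exchanging the
  coordinates, so the estimate on Z \<times> UNIV for the swapped data transports back to UNIV
  \<times> Z.\<close>

lemma (in clark_pair) L2_dominated_on_cylinder_swap:
  assumes Z: "Z \<in> sets circle_borel" "emeasure circle_lebesgue Z = 0"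
  shows "L2_dominated_on (UNIV \<times> Z) \<sigma>1 \<sigma>2"
proof -
  let ?s1 = "distr \<sigma>1 torus_borel prod.swap" and ?s2 = "distr \<sigma>2 torus_borel prod.swap"
  interpret s1: clark "\<lambda>z. b1 (prod.swap z)" \<alpha> ?s1 by (rule c1.clark_swap)
  interpret s2: clark "\<lambda>z. b2 (prod.swap z)" \<alpha> ?s2 by (rule c2.clark_swap)
  have ct: "sets torus_borel = sets torus_borel" ..
  have swap_swap: "prod.swap (prod.swap \<zeta>) = \<zeta>" for \<zeta> :: "complex \<times> complex" by simp
  have fT: "f \<in> borel_measurable torus_borel"
    using f measurable_cong_sets[OF c2.sets refl] by (auto simp: square_integrable_def)
  have fs: "(\<lambda>\<zeta>. f (prod.swap \<zeta>)) \<in> borel_measurable torus_borel"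
    by (rule measurable_compose[OF measurable_swap_torus fT])
  interpret s: clark_pair "\<lambda>z. b1 (prod.swap z)" "\<lambda>z. b2 (prod.swap z)" \<alpha> ?s1 ?s2 "\<lambda>\<zeta>. f (prod.swap \<zeta>)"
      "prod.swap w"
  proof
    show "prod.swap w \<in> bidisc" using w by (auto simp: bidisc_def)
    have m: "(\<lambda>\<zeta>. (cmod (f (prod.swap \<zeta>)))\<^sup>2) \<in> borel_measurable torus_borel" using fs by measurable
    have "integrable ?s2 (\<lambda>\<zeta>. (cmod (f (prod.swap \<zeta>)))\<^sup>2)"
      unfolding integrable_distr_eq[OF c2.measurable_swap m] using f by (simp add: square_integrable_def)
    then show "(\<lambda>\<zeta>. f (prod.swap \<zeta>)) \<in> square_integrable ?s2"
      using fs by (simp add: square_integrable_def)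
    fix z assume z: "z \<in> bidisc"
    then have sz: "prod.swap z \<in> bidisc" by (auto simp: bidisc_def)
    have c: "(\<lambda>\<zeta>. cnj (cauchy2 \<zeta> z)) \<in> borel_measurable torus_borel"
      by (rule borel_measurable_cnj[OF measurable_cauchy2(1)[OF ct]])
    have m1: "(\<lambda>\<zeta>. f (prod.swap \<zeta>) * cnj (cauchy2 \<zeta> z)) \<in> borel_measurable torus_borel"
      by (rule borel_measurable_times[OF fs c])
    have m2: "(\<lambda>\<zeta>. cauchy2 \<zeta> (prod.swap w) * cnj (cauchy2 \<zeta> z)) \<in> borel_measurable torus_borel"
      by (rule borel_measurable_times[OF measurable_cauchy2(1)[OF ct] c])
    show "(\<integral>\<zeta>. f (prod.swap \<zeta>) * cnj (cauchy2 \<zeta> z) \<partial>?s2) =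
        (\<integral>\<zeta>. cauchy2 \<zeta> (prod.swap w) * cnj (cauchy2 \<zeta> z) \<partial>?s1)"
      unfolding integral_distr[OF c2.measurable_swap m1] integral_distr[OF c1.measurable_swap m2]
        cauchy2_swap swap_swap by (rule transforms_eq[OF sz])
  qed
  from s.L2_dominated_on_cylinder[OF Z] obtain K where K: "0 \<le> K"
    and dom: "\<And>\<phi> B. \<phi> \<in> borel_measurable borel \<Longrightarrow> \<forall>\<zeta>. 0 \<le> \<phi> \<zeta> \<and> \<phi> \<zeta> \<le> B \<Longrightarrow>
      (\<integral>\<^sup>+\<zeta>. indicator (Z \<times> UNIV) \<zeta> * ennreal (\<phi> \<zeta>) \<partial>?s1) \<le> ennreal (K * sqrt (\<integral>\<zeta>. (\<phi> \<zeta>)\<^sup>2 \<partial>?s2))"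
    unfolding L2_dominated_on_def by blast
  show ?thesis
    unfolding L2_dominated_on_def
  proof (intro exI[of _ K] conjI K allI impI)
    fix \<phi> :: "complex \<times> complex \<Rightarrow> real" and B
    assume \<phi>: "\<phi> \<in> borel_measurable borel" "\<forall>\<zeta>. 0 \<le> \<phi> \<zeta> \<and> \<phi> \<zeta> \<le> B"
    have sw: "prod.swap \<in> borel \<rightarrow>\<^sub>M (borel :: (complex \<times> complex) measure)"
      by (intro borel_measurable_continuous_onI continuous_on_swap)
    have \<phi>s: "(\<lambda>\<zeta>. \<phi> (prod.swap \<zeta>)) \<in> borel_measurable borel" by (rule measurable_compose[OF sw \<phi>(1)])
    have \<phi>t[measurable]: "(\<lambda>\<zeta>. \<phi> (prod.swap \<zeta>)) \<in> borel_measurable torus_borel"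
      by (rule borel_measurable_torus[OF ct \<phi>s])
    have Zb: "Z \<in> sets borel" using Z(1) by (subst (asm) sets_restrict_space_iff) auto
    have "Z \<times> UNIV \<in> sets (borel :: (complex \<times> complex) measure)"
      using Zb by (simp add: borel_prod[symmetric])
    then have ind[measurable]: "(indicator (Z \<times> UNIV) :: complex \<times> complex \<Rightarrow> ennreal) \<in> borel_measurable
        torus_borel"
      by (intro borel_measurable_torus[OF ct] borel_measurable_indicator)
    have m: "(\<lambda>\<zeta>. indicator (Z \<times> UNIV) \<zeta> * ennreal (\<phi> (prod.swap \<zeta>))) \<in> borel_measurable torus_borel"
        by measurable
    have m2: "(\<lambda>\<zeta>. (\<phi> (prod.swap \<zeta>))\<^sup>2) \<in> borel_measurable torus_borel" by measurable
    have "(\<integral>\<^sup>+\<zeta>. indicator (Z \<times> UNIV) \<zeta> * ennreal (\<phi> (prod.swap \<zeta>)) \<partial>?s1) \<le>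
        ennreal (K * sqrt (\<integral>\<zeta>. (\<phi> (prod.swap \<zeta>))\<^sup>2 \<partial>?s2))"
      using \<phi>(2) by (intro dom[OF \<phi>s, of B]) blast
    moreover have "(\<integral>\<^sup>+\<zeta>. indicator (Z \<times> UNIV) \<zeta> * ennreal (\<phi> (prod.swap \<zeta>)) \<partial>?s1) =
        (\<integral>\<^sup>+\<zeta>. indicator (UNIV \<times> Z) \<zeta> * ennreal (\<phi> \<zeta>) \<partial>\<sigma>1)"
      unfolding nn_integral_distr[OF c1.measurable_swap, of "\<lambda>\<zeta>. indicator (Z \<times> UNIV) \<zeta> * ennreal (\<phi>
          (prod.swap \<zeta>))", unfolded measurable_distr_eq1, OF m] swap_swap
      by (intro nn_integral_cong) (auto simp: indicator_def)
    moreover have "(\<integral>\<zeta>. (\<phi> (prod.swap \<zeta>))\<^sup>2 \<partial>?s2) = (\<integral>\<zeta>. (\<phi> \<zeta>)\<^sup>2 \<partial>\<sigma>2)"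
      unfolding integral_distr[OF c2.measurable_swap m2] swap_swap ..
    ultimately show "(\<integral>\<^sup>+\<zeta>. indicator (UNIV \<times> Z) \<zeta> * ennreal (\<phi> \<zeta>) \<partial>\<sigma>1) \<le>
        ennreal (K * sqrt (\<integral>\<zeta>. (\<phi> \<zeta>)\<^sup>2 \<partial>\<sigma>2))"
      by simp
  qed
qed

section \<open>Proof of the equivalence\<close>

text \<open>The sets may overlap: up to a null set the integral is at most the sum of the three
  partial ones, and the constants add.\<close>

lemma L2_dominated_on_Un_null:
  assumes \<sigma>1: "sets \<sigma>1 = sets torus_borel"
    and S: "S \<in> sets torus_borel" "U \<in> sets borel" "V \<in> sets borel"
    and dom: "L2_dominated_on S \<sigma>1 \<sigma>2" "L2_dominated_on U \<sigma>1 \<sigma>2" "L2_dominated_on V \<sigma>1 \<sigma>2"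
    and null: "emeasure \<sigma>1 {\<zeta> \<in> torus. \<zeta> \<notin> S \<and> \<zeta> \<notin> U \<and> \<zeta> \<notin> V} = 0"
  shows "L2_dominated_on UNIV \<sigma>1 \<sigma>2"
proof -
  obtain K1 where K1: "0 \<le> K1" "\<And>\<phi> B. \<phi> \<in> borel_measurable borel \<Longrightarrow> \<forall>\<zeta>. 0 \<le> \<phi> \<zeta> \<and> \<phi> \<zeta> \<le> B \<Longrightarrow>
      (\<integral>\<^sup>+\<zeta>. indicator S \<zeta> * ennreal (\<phi> \<zeta>) \<partial>\<sigma>1) \<le> ennreal (K1 * sqrt (\<integral>\<zeta>. (\<phi> \<zeta>)\<^sup>2 \<partial>\<sigma>2))"
    using dom(1) unfolding L2_dominated_on_def by blast
  obtain K2 where K2: "0 \<le> K2" "\<And>\<phi> B. \<phi> \<in> borel_measurable borel \<Longrightarrow> \<forall>\<zeta>. 0 \<le> \<phi> \<zeta> \<and> \<phi> \<zeta> \<le> B \<Longrightarrow>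
      (\<integral>\<^sup>+\<zeta>. indicator U \<zeta> * ennreal (\<phi> \<zeta>) \<partial>\<sigma>1) \<le> ennreal (K2 * sqrt (\<integral>\<zeta>. (\<phi> \<zeta>)\<^sup>2 \<partial>\<sigma>2))"
    using dom(2) unfolding L2_dominated_on_def by blast
  obtain K3 where K3: "0 \<le> K3" "\<And>\<phi> B. \<phi> \<in> borel_measurable borel \<Longrightarrow> \<forall>\<zeta>. 0 \<le> \<phi> \<zeta> \<and> \<phi> \<zeta> \<le> B \<Longrightarrow>
      (\<integral>\<^sup>+\<zeta>. indicator V \<zeta> * ennreal (\<phi> \<zeta>) \<partial>\<sigma>1) \<le> ennreal (K3 * sqrt (\<integral>\<zeta>. (\<phi> \<zeta>)\<^sup>2 \<partial>\<sigma>2))"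
    using dom(3) unfolding L2_dominated_on_def by blast
  have sp: "space \<sigma>1 = torus" by (rule space_torus[OF \<sigma>1])
  have tb: "torus \<in> sets borel" unfolding torus_def by (intro borel_closed closed_Times closed_sphere)
  have UV: "U \<inter> torus \<in> sets \<sigma>1" "V \<inter> torus \<in> sets \<sigma>1"
    unfolding \<sigma>1 using S tb by (auto simp: sets_restrict_space_iff)
  have SM[measurable]: "S \<in> sets \<sigma>1" using S \<sigma>1 by simp
  have im[measurable]: "(indicator U :: _ \<Rightarrow> ennreal) \<in> borel_measurable \<sigma>1"
      "(indicator V :: _ \<Rightarrow> ennreal) \<in> borel_measurable \<sigma>1"
    using S by (auto intro!: borel_measurable_torus[OF \<sigma>1])
  have "{\<zeta> \<in> torus. \<zeta> \<notin> S \<and> \<zeta> \<notin> U \<and> \<zeta> \<notin> V} = space \<sigma>1 - (S \<union> (U \<inter> torus) \<union> (V \<inter> torus))"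
    unfolding sp by auto
  then have "{\<zeta> \<in> torus. \<zeta> \<notin> S \<and> \<zeta> \<notin> U \<and> \<zeta> \<notin> V} \<in> null_sets \<sigma>1"
    using null UV SM by (intro null_setsI) auto
  then have AE: "AE \<zeta> in \<sigma>1. \<zeta> \<in> S \<or> \<zeta> \<in> U \<or> \<zeta> \<in> V"
    by (rule AE_I') (auto simp: sp)
  show ?thesis
    unfolding L2_dominated_on_def
  proof (intro exI[of _ "K1 + K2 + K3"] conjI allI impI)
    show "0 \<le> K1 + K2 + K3" using K1 K2 K3 by simp
    fix \<phi> :: "complex \<times> complex \<Rightarrow> real" and B
    assume \<phi>: "\<phi> \<in> borel_measurable borel" "\<forall>\<zeta>. 0 \<le> \<phi> \<zeta> \<and> \<phi> \<zeta> \<le> B"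
    have [measurable]: "\<phi> \<in> borel_measurable \<sigma>1" by (rule borel_measurable_torus[OF \<sigma>1 \<phi>(1)])
    define I where "I = sqrt (\<integral>\<zeta>. (\<phi> \<zeta>)\<^sup>2 \<partial>\<sigma>2)"
    have I: "0 \<le> I" unfolding I_def by (intro real_sqrt_ge_zero Bochner_Integration.integral_nonneg) auto
    have "(\<integral>\<^sup>+\<zeta>. indicator UNIV \<zeta> * ennreal (\<phi> \<zeta>) \<partial>\<sigma>1) \<le>
        (\<integral>\<^sup>+\<zeta>. indicator S \<zeta> * ennreal (\<phi> \<zeta>) + indicator U \<zeta> * ennreal (\<phi> \<zeta>) +
            indicator V \<zeta> * ennreal (\<phi> \<zeta>) \<partial>\<sigma>1)"
      using AE by (intro nn_integral_mono_AE) (auto elim!: eventually_mono simp: indicator_def)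
    also have "\<dots> = (\<integral>\<^sup>+\<zeta>. indicator S \<zeta> * ennreal (\<phi> \<zeta>) \<partial>\<sigma>1) +
        (\<integral>\<^sup>+\<zeta>. indicator U \<zeta> * ennreal (\<phi> \<zeta>) \<partial>\<sigma>1) + (\<integral>\<^sup>+\<zeta>. indicator V \<zeta> * ennreal (\<phi> \<zeta>) \<partial>\<sigma>1)"
    proof -
      have e: "(\<lambda>\<zeta>. ennreal (\<phi> \<zeta>)) \<in> borel_measurable \<sigma>1" by measurable
      have m: "(\<lambda>\<zeta>. indicator S \<zeta> * ennreal (\<phi> \<zeta>)) \<in> borel_measurable \<sigma>1"
        "(\<lambda>\<zeta>. indicator U \<zeta> * ennreal (\<phi> \<zeta>)) \<in> borel_measurable \<sigma>1"
        "(\<lambda>\<zeta>. indicator V \<zeta> * ennreal (\<phi> \<zeta>)) \<in> borel_measurable \<sigma>1"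
        by (intro borel_measurable_times_ennreal im e borel_measurable_indicator SM)+
      show ?thesis
        unfolding nn_integral_add[OF borel_measurable_add[OF m(1,2)] m(3)] nn_integral_add[OF m(1,2)] ..
    qed
    also have "\<dots> \<le> ennreal (K1 * I) + ennreal (K2 * I) + ennreal (K3 * I)"
      unfolding I_def by (intro add_mono K1(2)[OF \<phi>] K2(2)[OF \<phi>] K3(2)[OF \<phi>])
    also have "\<dots> = ennreal ((K1 + K2 + K3) * I)"
      using K1(1) K2(1) K3(1) I by (simp add: ennreal_plus[symmetric] distrib_right del: ennreal_plus)
    finally show "(\<integral>\<^sup>+\<zeta>. indicator UNIV \<zeta> * ennreal (\<phi> \<zeta>) \<partial>\<sigma>1) \<le>
        ennreal ((K1 + K2 + K3) * sqrt (\<integral>\<zeta>. (\<phi> \<zeta>)\<^sup>2 \<partial>\<sigma>2))"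
      unfolding I_def .
  qed
qed

text \<open>Indicators of \<sigma>2-null sets give absolute continuity. For a truncation \<phi> of
  the density D, the integral I of \<phi>^2 with respect to \<sigma>2 is at most \<integral> \<phi>
  d\<sigma>1, since \<phi> \<le> D, and hence at most K sqrt I. So I \<le> K^2 for every level of
  truncation, and Fatou's lemma concludes.\<close>

lemma L2_dominated_imp_L2_density:
  assumes fin: "finite_measure \<sigma>1" "finite_measure \<sigma>2"
    and sets: "sets \<sigma>1 = sets torus_borel" "sets \<sigma>2 = sets torus_borel"
    and dom: "L2_dominated_on UNIV \<sigma>1 \<sigma>2"
  shows "absolutely_continuous \<sigma>2 \<sigma>1" "(\<integral>\<^sup>+ \<zeta>. (RN_deriv \<sigma>2 \<sigma>1 \<zeta>)\<^sup>2 \<partial>\<sigma>2) < \<infinity>"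
proof -
  interpret \<sigma>2: finite_measure \<sigma>2 by fact
  obtain K where K: "0 \<le> K" and le: "\<And>\<phi> B. \<phi> \<in> borel_measurable borel \<Longrightarrow> \<forall>\<zeta>. 0 \<le> \<phi> \<zeta> \<and> \<phi> \<zeta> \<le> B \<Longrightarrow>
      (\<integral>\<^sup>+\<zeta>. ennreal (\<phi> \<zeta>) \<partial>\<sigma>1) \<le> ennreal (K * sqrt (\<integral>\<zeta>. (\<phi> \<zeta>)\<^sup>2 \<partial>\<sigma>2))"
    using dom unfolding L2_dominated_on_def indicator_UNIV mult_1 by blast
  have tb: "torus \<in> sets borel" unfolding torus_def by (intro borel_closed closed_Times closed_sphere)
  have sp: "space \<sigma>1 = torus" "space \<sigma>2 = torus" using space_torus sets by auto
  show ac: "absolutely_continuous \<sigma>2 \<sigma>1"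
    unfolding absolutely_continuous_def
  proof
    fix A assume A: "A \<in> null_sets \<sigma>2"
    then have At: "A \<in> sets torus_borel" using sets by auto
    then have Ab: "A \<in> sets borel" using tb by (simp add: sets_restrict_space_iff)
    have "(\<integral>\<zeta>. (indicator A \<zeta> :: real)\<^sup>2 \<partial>\<sigma>2) = (\<integral>\<zeta>. indicator A \<zeta> \<partial>\<sigma>2)"
      by (intro Bochner_Integration.integral_cong) (auto simp: indicator_def)
    also have "\<dots> = 0" using A by (auto simp: measure_def null_sets_def)
    finally have z: "(\<integral>\<zeta>. (indicator A \<zeta> :: real)\<^sup>2 \<partial>\<sigma>2) = 0" .
    have "(\<integral>\<^sup>+\<zeta>. ennreal (indicator A \<zeta>) \<partial>\<sigma>1) \<le> ennreal (K * sqrt (\<integral>\<zeta>. (indicator A \<zeta> :: real)\<^sup>2 \<partial>\<sigma>2))"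
      using Ab by (intro le[of _ 1]) (auto simp: indicator_def)
    then have "emeasure \<sigma>1 A = 0" unfolding z using At sets by (simp add: ennreal_indicator)
    then show "A \<in> null_sets \<sigma>1" using At sets by auto
  qed
  obtain D where Dm[measurable]: "D \<in> borel_measurable \<sigma>2" and RN: "AE x in \<sigma>2. RN_deriv \<sigma>2 \<sigma>1 x =
      ennreal (D x)"
    and D0: "\<And>x. 0 \<le> D x"
    using \<sigma>2.real_RN_deriv[OF fin(1) ac] sets by metis
  have dens: "\<sigma>1 = density \<sigma>2 (\<lambda>x. ennreal (D x))"
  proof -
    have "\<sigma>1 = density \<sigma>2 (RN_deriv \<sigma>2 \<sigma>1)" using \<sigma>2.density_RN_deriv[OF ac] sets by simp
    also have "\<dots> = density \<sigma>2 (\<lambda>x. ennreal (D x))" using RN by (intro density_cong) auto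
    finally show ?thesis .
  qed
  \<comment> \<open>Truncation makes I finite from the outset, so that its root can be cancelled.
    The indicator makes the function Borel off the torus as well.\<close>
  define \<phi> where "\<phi> n \<zeta> = min (indicator torus \<zeta> * D \<zeta>) (real n)" for n \<zeta>
  have \<phi>m[measurable]: "\<phi> n \<in> borel_measurable borel" for n
  proof -
    have "D \<in> borel_measurable torus_borel" using Dm measurable_cong_sets[OF sets(2) refl] by blast
    then have "(\<lambda>\<zeta>. indicator torus \<zeta> *\<^sub>R D \<zeta>) \<in> borel_measurable borel"
      using tb by (subst (asm) borel_measurable_restrict_space_iff) auto
    then have "(\<lambda>\<zeta>. indicator torus \<zeta> * D \<zeta>) \<in> borel_measurable borel" by simp
    then show ?thesis unfolding \<phi>_def[abs_def] by measurable
  qed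
  have \<phi>m2[measurable]: "\<phi> n \<in> borel_measurable \<sigma>2" for n by (rule borel_measurable_torus[OF sets(2) \<phi>m])
  have \<phi>0: "\<forall>\<zeta>. 0 \<le> \<phi> n \<zeta> \<and> \<phi> n \<zeta> \<le> real n" for n using D0 by (auto simp: \<phi>_def indicator_def)
  have \<phi>D: "\<phi> n \<zeta> \<le> D \<zeta>" for n \<zeta> using D0[of \<zeta>] by (auto simp: \<phi>_def indicator_def)
  have bound: "(\<integral>\<^sup>+\<zeta>. ennreal ((\<phi> n \<zeta>)\<^sup>2) \<partial>\<sigma>2) \<le> ennreal (K\<^sup>2)" for n
  proof -
    define I where "I = (\<integral>\<zeta>. (\<phi> n \<zeta>)\<^sup>2 \<partial>\<sigma>2)"
    have I0: "0 \<le> I" unfolding I_def by (intro Bochner_Integration.integral_nonneg) auto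
    have "integrable \<sigma>2 (\<lambda>\<zeta>. (\<phi> n \<zeta>)\<^sup>2)"
    proof (rule \<sigma>2.integrable_const_bound[where B="(real n)\<^sup>2"])
      show "AE \<zeta> in \<sigma>2. norm ((\<phi> n \<zeta>)\<^sup>2) \<le> (real n)\<^sup>2"
        using \<phi>0[of n] by (intro AE_I2) (auto intro!: power_mono)
    qed measurable
    then have nI: "(\<integral>\<^sup>+\<zeta>. ennreal ((\<phi> n \<zeta>)\<^sup>2) \<partial>\<sigma>2) = ennreal I"
      unfolding I_def by (intro nn_integral_eq_integral) auto
    also have "ennreal I \<le> (\<integral>\<^sup>+\<zeta>. ennreal (D \<zeta>) * ennreal (\<phi> n \<zeta>) \<partial>\<sigma>2)"
      unfolding nI[symmetric]
    proof (intro nn_integral_mono)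
      fix \<zeta>
      have "(\<phi> n \<zeta>)\<^sup>2 \<le> D \<zeta> * \<phi> n \<zeta>"
        using mult_right_mono[OF \<phi>D[of n \<zeta>], of "\<phi> n \<zeta>"] \<phi>0[of n] by (auto simp: power2_eq_square)
      then show "ennreal ((\<phi> n \<zeta>)\<^sup>2) \<le> ennreal (D \<zeta>) * ennreal (\<phi> n \<zeta>)"
        using D0[of \<zeta>] \<phi>0[of n, rule_format, of \<zeta>]
        by (subst ennreal_mult[symmetric]) (auto intro: ennreal_leI)
    qed
    also have "\<dots> = (\<integral>\<^sup>+\<zeta>. ennreal (\<phi> n \<zeta>) \<partial>\<sigma>1)"
      unfolding dens by (subst nn_integral_density) auto
    also have "\<dots> \<le> ennreal (K * sqrt I)"
      unfolding I_def by (rule le[OF \<phi>m \<phi>0])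
    finally have "ennreal I \<le> ennreal (K * sqrt I)" unfolding nI .
    then have "I \<le> K * sqrt I" using K I0 by (subst (asm) ennreal_le_iff) auto
    then have "sqrt I * sqrt I \<le> K * sqrt I" using I0 by simp
    \<comment> \<open>For I = 0 there is nothing to cancel, and the claim is 0 \<le> K.\<close>
    then have "sqrt I \<le> K"
      using K I0 mult_right_le_imp_le[of "sqrt I" "sqrt I" K] by (cases "I = 0") auto
    then have "I \<le> K\<^sup>2" by (rule sqrt_le_D)
    then show ?thesis unfolding nI by (rule ennreal_leI)
  qed
  have "(\<integral>\<^sup>+ \<zeta>. (RN_deriv \<sigma>2 \<sigma>1 \<zeta>)\<^sup>2 \<partial>\<sigma>2) = (\<integral>\<^sup>+ \<zeta>. liminf (\<lambda>n. ennreal ((\<phi> n \<zeta>)\<^sup>2)) \<partial>\<sigma>2)"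
  proof (rule nn_integral_cong_AE)
    show "AE \<zeta> in \<sigma>2. (RN_deriv \<sigma>2 \<sigma>1 \<zeta>)\<^sup>2 = liminf (\<lambda>n. ennreal ((\<phi> n \<zeta>)\<^sup>2))"
      using RN AE_space
    proof eventually_elim
      case (elim \<zeta>)
      obtain n0 :: nat where n0: "D \<zeta> \<le> real n0" using real_arch_simple by blast
      have "\<phi> n \<zeta> = D \<zeta>" if "n0 \<le> n" for n
      proof -
        have "D \<zeta> \<le> real n" using n0 that by linarith
        then show ?thesis using elim(2) sp by (simp add: \<phi>_def)
      qed
      then have "(\<lambda>n. ennreal ((\<phi> n \<zeta>)\<^sup>2)) \<longlonglongrightarrow> ennreal ((D \<zeta>)\<^sup>2)"
        by (intro tendsto_eventually eventually_sequentiallyI[of n0]) auto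
      then have "liminf (\<lambda>n. ennreal ((\<phi> n \<zeta>)\<^sup>2)) = ennreal ((D \<zeta>)\<^sup>2)" by (intro lim_imp_Liminf) auto
      then show ?case using elim(1) D0 by (simp add: ennreal_power)
    qed
  qed
  also have "\<dots> \<le> liminf (\<lambda>n. \<integral>\<^sup>+ \<zeta>. ennreal ((\<phi> n \<zeta>)\<^sup>2) \<partial>\<sigma>2)"
    by (rule nn_integral_liminf) measurable
  also have "\<dots> \<le> limsup (\<lambda>n. \<integral>\<^sup>+ \<zeta>. ennreal ((\<phi> n \<zeta>)\<^sup>2) \<partial>\<sigma>2)" by (rule Liminf_le_Limsup) simp
  also have "\<dots> \<le> ennreal (K\<^sup>2)"
    by (rule Limsup_bounded) (simp add: bound)
  also have "\<dots> < \<infinity>" by simp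
  finally show "(\<integral>\<^sup>+ \<zeta>. (RN_deriv \<sigma>2 \<sigma>1 \<zeta>)\<^sup>2 \<partial>\<sigma>2) < \<infinity>" .
qed

lemma L2_density:
  assumes fin: "finite_measure M" "finite_measure N" and sets: "sets M = sets N"
    and ac: "absolutely_continuous N M" and L2: "(\<integral>\<^sup>+ x. (RN_deriv N M x)\<^sup>2 \<partial>N) < \<infinity>"
  obtains D :: "'a \<Rightarrow> real" where "(\<lambda>x. of_real (D x)) \<in> square_integrable N" "D \<in> borel_measurable N"
    "\<And>x. 0 \<le> D x" "M = density N (\<lambda>x. ennreal (D x))"
proof -
  interpret N: finite_measure N by fact
  obtain D where Dm[measurable]: "D \<in> borel_measurable N" and RN: "AE x in N. RN_deriv N M x = ennreal (D x)"
    and D0: "\<And>x. 0 \<le> D x"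
    using N.real_RN_deriv[OF fin(1) ac sets] by metis
  have "M = density N (RN_deriv N M)" using N.density_RN_deriv[OF ac sets] by simp
  also have "\<dots> = density N (\<lambda>x. ennreal (D x))" using RN by (intro density_cong) auto
  finally have dens: "M = density N (\<lambda>x. ennreal (D x))" .
  have "(\<integral>\<^sup>+ x. ennreal ((D x)\<^sup>2) \<partial>N) = (\<integral>\<^sup>+ x. (RN_deriv N M x)\<^sup>2 \<partial>N)"
    using RN D0 by (intro nn_integral_cong_AE) (auto elim!: eventually_mono simp: ennreal_power)
  then have "integrable N (\<lambda>x. (D x)\<^sup>2)"
    using L2 by (intro integrableI_nonneg) auto
  then have "(\<lambda>x. complex_of_real (D x)) \<in> square_integrable N"
    by (simp add: square_integrable_def)
  then show ?thesis using that Dm D0 dens by blast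
qed

text \<open>The quotient exchanges the outer factor 1 - cnj \<alpha> b1(z) of the kernel identity
  for 1 - cnj \<alpha> c. With c = b2(z) the latter is the weight in front of Cauchy transforms in
  H(b2).\<close>

lemma quotient_kernel_eq:
  assumes c1: "clark b1 \<alpha> \<sigma>1" and z: "z \<in> bidisc" and w: "w \<in> bidisc"
  shows "(\<alpha> - c) / (\<alpha> - b1 z) * dbr_kernel b1 z w =
    (1 - cnj \<alpha> * c) * ((1 - \<alpha> * cnj (b1 w)) * (\<integral>\<zeta>. cauchy2 \<zeta> w * cnj (cauchy2 \<zeta> z) \<partial>\<sigma>1))"
proof -
  interpret clark b1 \<alpha> \<sigma>1 by fact
  have a: "\<alpha> * cnj \<alpha> = 1" using unimodular by (simp add: complex_norm_square[symmetric])
  have e: "\<alpha> - x = \<alpha> * (1 - cnj \<alpha> * x)" for x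
  proof -
    have "\<alpha> * (1 - cnj \<alpha> * x) = \<alpha> - (\<alpha> * cnj \<alpha>) * x" by (simp add: algebra_simps)
    then show ?thesis by (simp add: a)
  qed
  have "cmod (b1 z) < 1" using into_disc z by auto
  then have n: "1 - cnj \<alpha> * b1 z \<noteq> 0"
    using one_minus_mult_bound(1)[of "cnj \<alpha>" "b1 z"] unimodular by simp
  have "\<alpha> \<noteq> 0" using unimodular by auto
  then have q: "(\<alpha> - c) / (\<alpha> - b1 z) = (1 - cnj \<alpha> * c) / (1 - cnj \<alpha> * b1 z)"
    unfolding e[of c] e[of "b1 z"] by (rule mult_divide_mult_cancel_left)
  have "p / n * (n * r * s) = p * (r * s)" if "n \<noteq> 0" for p n r s :: complex using that by simp
  from this[OF n] show ?thesis
    unfolding q clark_measure_kernel[OF holomorphic into_disc unimodular clark_measure z w, symmetric]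
        cnj_cauchy2 .
qed

theorem theorem4p5:
  fixes b1 b2 :: "complex \<times> complex \<Rightarrow> complex"
    and \<alpha> :: complex
    and \<sigma>1 \<sigma>2 :: "(complex \<times> complex) measure"
    and \<sigma>1_0 \<sigma>1_1 \<sigma>1_2 :: "(complex \<times> complex) set \<Rightarrow> complex"
    and H2 :: "(complex \<times> complex \<Rightarrow> complex) set"
    and ip2 :: "(complex \<times> complex \<Rightarrow> complex) \<Rightarrow> (complex \<times> complex \<Rightarrow> complex) \<Rightarrow> complex"
    and N :: "(complex \<times> complex) set"
  assumes "holomorphic2_on b1 bidisc" and "b1 ` bidisc \<subseteq> ball 0 1" and "\<not> b1 constant_on bidisc"
    and "holomorphic2_on b2 bidisc" and "b2 ` bidisc \<subseteq> ball 0 1" and "\<not> b2 constant_on bidisc"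
    and "\<alpha> \<in> sphere 0 1"
    and "clark_measure b1 \<alpha> \<sigma>1" and "clark_measure b2 \<alpha> \<sigma>2"
    and "de_branges_rovnyak b2 H2 ip2"
    and "RP_decomposition (complex_measure_of \<sigma>1) \<sigma>1_0 \<sigma>1_1 \<sigma>1_2"
    and "null_set_for (annihilator bidisc_algebra) N"
    and "carrier_of torus_borel \<sigma>1_0 N"
  shows "((absolutely_continuous \<sigma>2 \<sigma>1 \<and> (\<integral>\<^sup>+ \<zeta>. (RN_deriv \<sigma>2 \<sigma>1 \<zeta>)\<^sup>2 \<partial>\<sigma>2) < \<infinity>)
      \<longleftrightarrow> (\<forall>w\<in>bidisc. zero_extend bidisc (\<lambda>z. (\<alpha> - b2 z) / (\<alpha> - b1 z) * dbr_kernel b1 z w) \<in> H2)) \<and>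
     ((\<forall>w\<in>bidisc. zero_extend bidisc (\<lambda>z. (\<alpha> - b2 z) / (\<alpha> - b1 z) * dbr_kernel b1 z w) \<in> H2)
      \<longleftrightarrow> (\<exists>w\<in>bidisc. zero_extend bidisc (\<lambda>z. (\<alpha> - b2 z) / (\<alpha> - b1 z) * dbr_kernel b1 z w) \<in> H2))"
proof -
  interpret c1: clark b1 \<alpha> \<sigma>1 by unfold_locales (use assms in auto)
  interpret c2: clark_dbr b2 \<alpha> \<sigma>2 H2 ip2 by unfold_locales (use assms in auto)
  have sets12: "sets \<sigma>1 = sets \<sigma>2" using c1.sets c2.sets by simp
  let ?G = "\<lambda>w. zero_extend bidisc (\<lambda>z. (\<alpha> - b2 z) / (\<alpha> - b1 z) * dbr_kernel b1 z w)"
  have i_ii: "?G w \<in> H2"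
    if i: "absolutely_continuous \<sigma>2 \<sigma>1" "(\<integral>\<^sup>+ \<zeta>. (RN_deriv \<sigma>2 \<sigma>1 \<zeta>)\<^sup>2 \<partial>\<sigma>2) < \<infinity>" and w: "w \<in> bidisc" for w
  proof -
    obtain D where D: "(\<lambda>x. complex_of_real (D x)) \<in> square_integrable \<sigma>2" "D \<in> borel_measurable \<sigma>2"
      "\<And>x. 0 \<le> D x" "\<sigma>1 = density \<sigma>2 (\<lambda>x. ennreal (D x))"
      using L2_density[OF c1.finite c2.finite sets12 i] by metis
    \<comment> \<open>A bounded kernel times the density of \<sigma>1 with respect to \<sigma>2,
      hence in L^2(\<sigma>2); the constant is the one left over in
      \<open>quotient_kernel_eq\<close>.\<close>
    define \<phi> where "\<phi> \<zeta> = (1 - \<alpha> * cnj (b1 w)) * (cauchy2 \<zeta> w * of_real (D \<zeta>))" for \<zeta>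
    have "(\<lambda>\<zeta>. cauchy2 \<zeta> w * of_real (D \<zeta>)) \<in> square_integrable \<sigma>2"
      by (rule square_integrable_mult_bounded[OF D(1) measurable_cauchy2(1)[OF c2.sets]])
        (rule norm_cauchy2_le[OF _ w], simp add: space_torus[OF c2.sets])
    then have \<phi>: "\<phi> \<in> square_integrable \<sigma>2"
      unfolding \<phi>_def[abs_def] by (rule square_integrable_scale)
    have "?G w = zero_extend bidisc (\<lambda>z. (1 - cnj \<alpha> * b2 z) * (\<integral>\<zeta>. \<phi> \<zeta> * cnj (cauchy2 \<zeta> z) \<partial>\<sigma>2))"
    proof
      fix z
      show "?G w z = zero_extend bidisc (\<lambda>z. (1 - cnj \<alpha> * b2 z) * (\<integral>\<zeta>. \<phi> \<zeta> * cnj (cauchy2 \<zeta> z) \<partial>\<sigma>2)) z"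
      proof (cases "z \<in> bidisc")
        case True
        have "(\<integral>\<zeta>. cauchy2 \<zeta> w * cnj (cauchy2 \<zeta> z) \<partial>\<sigma>1) = (\<integral>\<zeta>. D \<zeta> *\<^sub>R (cauchy2 \<zeta> w * cnj (cauchy2 \<zeta> z)) \<partial>\<sigma>2)"
          unfolding D(4) using D(2,3) measurable_cauchy2(1)[OF c2.sets] borel_measurable_cnj
          by (intro integral_density borel_measurable_times) auto
        also have "(1 - \<alpha> * cnj (b1 w)) * \<dots> =
            (\<integral>\<zeta>. (1 - \<alpha> * cnj (b1 w)) * (D \<zeta> *\<^sub>R (cauchy2 \<zeta> w * cnj (cauchy2 \<zeta> z))) \<partial>\<sigma>2)"
          by (rule integral_mult_right_zero[symmetric])
        also have "\<dots> = (\<integral>\<zeta>. \<phi> \<zeta> * cnj (cauchy2 \<zeta> z) \<partial>\<sigma>2)"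
          unfolding \<phi>_def scaleR_conv_of_real by (simp only: mult_ac)
        finally have eq: "(1 - \<alpha> * cnj (b1 w)) * (\<integral>\<zeta>. cauchy2 \<zeta> w * cnj (cauchy2 \<zeta> z) \<partial>\<sigma>1) =
            (\<integral>\<zeta>. \<phi> \<zeta> * cnj (cauchy2 \<zeta> z) \<partial>\<sigma>2)" .
        show ?thesis
          unfolding zero_extend_def quotient_kernel_eq[OF c1.clark_axioms True w] eq ..
      qed (simp add: zero_extend_def)
    qed
    then show ?thesis using c2.weighted_cauchy_transform_mem[OF \<phi>] by simp
  qed
  have iii_i: "absolutely_continuous \<sigma>2 \<sigma>1 \<and> (\<integral>\<^sup>+ \<zeta>. (RN_deriv \<sigma>2 \<sigma>1 \<zeta>)\<^sup>2 \<partial>\<sigma>2) < \<infinity>"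
    if w: "w \<in> bidisc" and G: "?G w \<in> H2" for w
  proof -
    obtain f0 where f0: "f0 \<in> square_integrable \<sigma>2"
      and Gf: "\<And>z. z \<in> bidisc \<Longrightarrow> ?G w z = (1 - cnj \<alpha> * b2 z) * (\<integral>\<zeta>. f0 \<zeta> * cnj (cauchy2 \<zeta> z) \<partial>\<sigma>2)"
      by (rule c2.weighted_cauchy_transform_surj[OF G]) (rule that)
    define c where "c = 1 - \<alpha> * cnj (b1 w)"
    have "cmod (cnj (b1 w)) < 1" using c1.into_disc w by auto
    then have c0: "c \<noteq> 0"
      unfolding c_def using one_minus_mult_bound(1)[of \<alpha> "cnj (b1 w)"] c1.unimodular by simp
    \<comment> \<open>Dividing by c makes the two transforms agree exactly, as
      \<open>clark_pair\<close> demands.\<close>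
    define f where "f \<zeta> = (1 / c) * f0 \<zeta>" for \<zeta>
    interpret clark_pair b1 b2 \<alpha> \<sigma>1 \<sigma>2 f w
    proof (intro clark_pair.intro c1.clark_axioms c2.clark_axioms clark_pair_axioms.intro w)
      show "f \<in> square_integrable \<sigma>2" unfolding f_def[abs_def] by (rule square_integrable_scale[OF f0])
      fix z assume z: "z \<in> bidisc"
      have "?G w z = (1 - cnj \<alpha> * b2 z) * (c * (\<integral>\<zeta>. cauchy2 \<zeta> w * cnj (cauchy2 \<zeta> z) \<partial>\<sigma>1))"
        unfolding zero_extend_def c_def quotient_kernel_eq[OF c1.clark_axioms z w] using z by simp
      then have "(1 - cnj \<alpha> * b2 z) * (c * (\<integral>\<zeta>. cauchy2 \<zeta> w * cnj (cauchy2 \<zeta> z) \<partial>\<sigma>1)) =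
          (1 - cnj \<alpha> * b2 z) * (\<integral>\<zeta>. f0 \<zeta> * cnj (cauchy2 \<zeta> z) \<partial>\<sigma>2)"
        unfolding Gf[OF z] by (rule sym)
      then have "c * (\<integral>\<zeta>. cauchy2 \<zeta> w * cnj (cauchy2 \<zeta> z) \<partial>\<sigma>1) = (\<integral>\<zeta>. f0 \<zeta> * cnj (cauchy2 \<zeta> z) \<partial>\<sigma>2)"
        by (rule mult_left_cancel[THEN iffD1, OF c2.one_minus_nonzero(1)[OF z]])
      then show "(\<integral>\<zeta>. f \<zeta> * cnj (cauchy2 \<zeta> z) \<partial>\<sigma>2) = (\<integral>\<zeta>. cauchy2 \<zeta> w * cnj (cauchy2 \<zeta> z) \<partial>\<sigma>1)"
        unfolding f_def mult.assoc integral_mult_right_zero using c0 by (simp add: field_simps)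
    qed
    obtain Z1 Z2 where Z: "Z1 \<in> sets circle_borel" "emeasure circle_lebesgue Z1 = 0"
      "Z2 \<in> sets circle_borel" "emeasure circle_lebesgue Z2 = 0"
      "emeasure \<sigma>1 {\<zeta> \<in> torus. \<zeta> \<notin> N \<and> fst \<zeta> \<notin> Z1 \<and> snd \<zeta> \<notin> Z2} = 0"
      by (rule RP_decomposition_carrier[OF assms(11,13) c1.finite c1.sets])
    have Zb: "Z1 \<in> sets borel" "Z2 \<in> sets borel"
      using Z(1,3) by (auto simp: sets_restrict_space_iff)
    have "L2_dominated_on UNIV \<sigma>1 \<sigma>2"
    proof (rule L2_dominated_on_Un_null[OF c1.sets _ _ _ L2_dominated_on_null_set[OF assms(12)]
          L2_dominated_on_cylinder[OF Z(1,2)] L2_dominated_on_cylinder_swap[OF Z(3,4)]])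
      show "N \<in> sets torus_borel" using assms(12) by (simp add: null_set_for_def)
      show "Z1 \<times> UNIV \<in> sets (borel :: (complex \<times> complex) measure)"
        "UNIV \<times> Z2 \<in> sets (borel :: (complex \<times> complex) measure)"
        using Zb by (simp_all add: borel_prod[symmetric])
      have "{\<zeta> \<in> torus. \<zeta> \<notin> N \<and> \<zeta> \<notin> Z1 \<times> UNIV \<and> \<zeta> \<notin> UNIV \<times> Z2} = {\<zeta> \<in> torus. \<zeta> \<notin> N \<and> fst \<zeta> \<notin> Z1 \<and> snd \<zeta> \<notin> Z2}"
        by auto
      then show "emeasure \<sigma>1 {\<zeta> \<in> torus. \<zeta> \<notin> N \<and> \<zeta> \<notin> Z1 \<times> UNIV \<and> \<zeta> \<notin> UNIV \<times> Z2} = 0"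
        using Z(5) by simp
    qed
    from L2_dominated_imp_L2_density[OF c1.finite c2.finite c1.sets c2.sets this] show ?thesis by blast
  qed
  \<comment> \<open>The bidisc has a point, so (ii) implies (iii). Conversely (iii) for a single w
    gives (i), which returns (ii) for every w.\<close>
  have "(0, 0) \<in> bidisc" by (simp add: bidisc_def)
  then show ?thesis using i_ii iii_i by blast
qed

end
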